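(* Let $A,B\in\mathbb{R}$ and $\phi_{A,B}(y) = Ay$ for $y\ge 0$, $\phi_{A,B}(y)=-By$ for $y<0$. Let $v:\mathbb{R}\times(0,\infty)\to\mathbb{R}$ be smooth, satisfy $|\partial_x^\ell v(x,t)|\le C_\ell t^{-\ell/4}$ for $\ell=0,1,2$, solve $$v(t) = e^{-t\partial_x^4}v_0 + \int_0^t \partial_x^2 e^{-(t-s)\partial_x^4}\big(\alpha[v]v_{xx}+F[v]\big)(s)\,ds$$ with $v_0 = \phi_{A,B}'$ (i.e. $v_0=-B$ on $x<0$, $v_0=A$ on $x>0$), and be self-similar: $v(\sigma^{1/4}x,\sigma t) = v(x,t)$ for all $x\in\mathbb{R}$, $t>0$, $\sigma>0$. Let $$U(x,t) := \big(e^{-t\partial_x^4}\phi_{A,B}\big)(x) + \int_0^t \Big(\partial_x e^{-(t-s)\partial_x^4}\big(\alpha[v]v_{xx}+F[v]\big)(s)\Big)(x)\,ds.$$ Then $U$ is uniformly continuous up to $t=0$ with $U(\cdot,0)=\phi_{A,B}$, $U_x=v$, $U$ solves $U_t = -\big((1+U_x^2)^{-1/2}\big(U_{xx}(1+U_x^2)^{-3/2}\big)_x\big)_x$, and $U$ is forward self-similar: $\sigma^{-1/4}U(\sigma^{1/4}x,\sigma t) = U(x,t)$ for all $x\in\mathbb{R}$, $t>0$, $\sigma>0$.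
   Context: $e^{-t\partial_x^4}$ denotes the biharmonic heat semigroup on $\mathbb{R}$ (convolution with $G_t(x)=t^{-1/4}G(xt^{-1/4})$, $G$ the inverse Fourier transform of $e^{-\xi^4}$). $\alpha[v] = 1-(1+v^2)^{-2}$ and $F[v] = 3vv_x^2/(1+v^2)^3$. *)

theory Defs
  imports "HOL-Analysis.Analysis"
begin

fun Ck :: "nat \<Rightarrow> (real \<times> real) set \<Rightarrow> (real \<times> real \<Rightarrow> real) \<Rightarrow> bool" where
  "Ck 0 S f = continuous_on S f"
| "Ck (Suc k) S f = (continuous_on S f \<and>
     (\<exists>f1 f2. (\<forall>p\<in>S. (f has_derivative (\<lambda>h. fst h * f1 p + snd h * f2 p)) (at p))
              \<and> Ck k S f1 \<and> Ck k S f2))"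

definition smooth2_on :: "(real \<times> real) set \<Rightarrow> (real \<times> real \<Rightarrow> real) \<Rightarrow> bool" where
  "smooth2_on S f \<longleftrightarrow> (\<forall>k. Ck k S f)"

text \<open>Biharmonic heat kernel: G = inverse Fourier transform of exp(-xi^4),
  G(x) = (1/(2 pi)) \<integral> exp(i x xi) exp(-xi^4) d xi (real since the symbol is even).\<close>
definition Gbh :: "real \<Rightarrow> real" where
  "Gbh x = integral UNIV (\<lambda>\<xi>. exp (-(\<xi> ^ 4)) * cos (x * \<xi>)) / (2 * pi)"

definition Gbh_t :: "real \<Rightarrow> real \<Rightarrow> real" where
  "Gbh_t t x = t powr (-1/4) * Gbh (x * t powr (-1/4))"

definition biheat :: "real \<Rightarrow> (real \<Rightarrow> real) \<Rightarrow> real \<Rightarrow> real" where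
  "biheat t f x = integral UNIV (\<lambda>y. Gbh_t t (x - y) * f y)"

definition phiAB :: "real \<Rightarrow> real \<Rightarrow> real \<Rightarrow> real" where
  "phiAB A B y = (if y \<ge> 0 then A * y else - B * y)"

definition alphaN :: "real \<Rightarrow> real" where
  "alphaN w = 1 - 1 / (1 + w\<^sup>2)\<^sup>2"

definition FN :: "real \<Rightarrow> real \<Rightarrow> real" where
  "FN w wx = 3 * w * wx\<^sup>2 / (1 + w\<^sup>2) ^ 3"

definition dx :: "(real \<Rightarrow> real \<Rightarrow> real) \<Rightarrow> real \<Rightarrow> real \<Rightarrow> real" where
  "dx u x t = deriv (\<lambda>y. u y t) x"

definition Nl :: "(real \<Rightarrow> real \<Rightarrow> real) \<Rightarrow> real \<Rightarrow> real \<Rightarrow> real" where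
  "Nl v x s = alphaN (v x s) * dx (dx v) x s + FN (v x s) (dx v x s)"

end

theory Submission
  imports Defs "HOL-Probability.Probability"
begin

text \<open>
  Every derivative of the kernel decays rapidly (integration by parts in the Fourier integral), and Fourier
  inversion gives the semigroup law and the moments \<open>1, 0, 0, 0, -24\<close> of the kernel. Differentiating
  under the integrals, \<open>U\<^sub>x\<close> is the right-hand side of the mild equation, so \<open>U\<^sub>x = v\<close>. The semigroup law lets
  the formula for \<open>U\<close> be restarted at any time \<open>t \<ge> 0\<close>: \<open>U(t + h)\<close> is the biharmonic flow of \<open>U(t)\<close>
  over time \<open>h\<close> plus a Duhamel integral over \<open>(t, t + h)\<close>. As \<open>U(t)\<close> is Lipschitz
  uniformly in \<open>t\<close>, both parts move by at most a multiple of \<open>h\<^bsup>1/4\<^esup>\<close>, which gives uniform continuity up to \<open>t = 0\<close>.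
  Self-similarity \<open>U(x,t) = t\<^bsup>1/4\<^esup> U(x t\<^bsup>-1/4\<^esup>, 1)\<close> makes \<open>U\<close> differentiable in time, so it suffices to
  compute the right derivative from the restarted formula: Taylor expansion and the moments give \<open>-v\<^sub>x\<^sub>x\<^sub>x\<close>
  for the flow and the \<open>x\<close>-derivative of the nonlinearity for the Duhamel integral.
\<close>


section \<open>Integrals of rapidly decaying functions\<close>

text \<open>The kernel changes sign, as its vanishing second moment shows, so there is no maximum
  principle and every estimate rests on weighted L1 norms of the kernel and its derivatives. By
  scaling, j kernel derivatives cost a factor (t-s)^(-j/4), and the hypotheses give a source of size
  s^(-1/2); the time integral is a Beta integral, finite for j < 4. For j = 1 it is of order h^(1/4)
  on an interval of length h, and the flow moves a Lipschitz function by the same order. The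
  obstacle is the time derivative: differentiating the Duhamel kernel in time costs four more
  x-derivatives, hence a factor (t-s)^(-5/4), which is not integrable. This forces the detour:
  self-similarity for existence, a short interval (t, t+h) for the value. On that interval the
  source is smooth in x, and one kernel derivative acts in the limit as one derivative of the
  source. The moment -24 is the coefficient of z^4 in exp(-z^4) times 4!, and it cancels the 4! in
  Taylor's formula. As \<open>phiAB\<close> is unbounded, the flow is set up on functions of linear
  growth.\<close>

lemma integrable_inverse_one_plus_square: "integrable lborel (\<lambda>x::real. 1 / (1 + x\<^sup>2))"
  using integrable_inverse_1_plus_square
  by (simp add: set_integrable_def einterval_eq_UNIV inverse_eq_divide)

lemma integrable_if_quadratic_decay:
  fixes f :: "real \<Rightarrow> real"
  assumes [measurable]: "f \<in> borel_measurable borel" and b: "\<And>x. (1 + x\<^sup>2) * \<bar>f x\<bar> \<le> C"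
  shows "integrable lborel f"
proof (rule Bochner_Integration.integrable_bound)
  show "integrable lborel (\<lambda>x::real. C * (1 / (1 + x\<^sup>2)))"
    by (intro integrable_mult_right integrable_inverse_one_plus_square)
  have "norm (f x) \<le> norm (C * (1 / (1 + x\<^sup>2)))" for x
  proof -
    have "\<bar>f x\<bar> \<le> C / (1 + x\<^sup>2)"
      using b[of x] by (subst pos_le_divide_eq) (auto simp: add_pos_nonneg mult.commute)
    then show ?thesis by (metis abs_ge_self mult.right_neutral norm_conv_dist order_trans real_norm_def times_divide_eq_right)
  qed
  then show "AE x in lborel. norm (f x) \<le> norm (C * (1 / (1 + x\<^sup>2)))" by simp
qed simp

text \<open>Integration by parts without boundary terms: the source of the decay of the kernel and
  of the moments of its derivative.\<close>

lemma integral_derivative_whole_line_eq_0: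
  fixes F f :: "real \<Rightarrow> real"
  assumes F: "\<And>x. (F has_real_derivative f x) (at x)" and f: "\<And>x. isCont f x"
    and int: "integrable lborel f" and lim: "(F \<longlongrightarrow> 0) at_top" "(F \<longlongrightarrow> 0) at_bot"
  shows "(\<integral>x. f x \<partial>lborel) = 0"
proof -
  have "(LBINT x=-\<infinity>..\<infinity>. f x) = 0 - 0"
  proof (rule interval_integral_FTC_integrable)
    show "set_integrable lborel (einterval (- \<infinity>) \<infinity>) f"
      using int by (simp add: set_integrable_def einterval_eq_UNIV)
    show "((F \<circ> real_of_ereal) \<longlongrightarrow> 0) (at_right (-\<infinity>))"
      using lim by (simp add: at_right_MInf filterlim_filtermap o_def)
    show "((F \<circ> real_of_ereal) \<longlongrightarrow> 0) (at_left \<infinity>)"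
      using lim by (simp add: at_left_PInf filterlim_filtermap o_def)
  qed (use F f in \<open>auto simp: has_real_derivative_iff_has_vector_derivative\<close>)
  then show ?thesis
    by (simp add: interval_lebesgue_integral_def einterval_eq_UNIV set_lebesgue_integral_def)
qed

lemma tendsto_0_if_linear_decay:
  fixes F :: "real \<Rightarrow> real"
  assumes "\<And>x. \<bar>x\<bar> * \<bar>F x\<bar> \<le> C"
  shows "(F \<longlongrightarrow> 0) at_top" "(F \<longlongrightarrow> 0) at_bot"
proof -
  have *: "norm (F x) \<le> C * inverse \<bar>x\<bar>" if "x \<noteq> 0" for x
    using assms[of x] that by (simp add: field_simps)
  have "((\<lambda>x::real. C * inverse \<bar>x\<bar>) \<longlongrightarrow> C * 0) at_top"
    by (intro tendsto_intros tendsto_inverse_0_at_top filterlim_abs_real) 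
  moreover have "\<forall>\<^sub>F x in at_top. norm (F x) \<le> C * inverse \<bar>x\<bar>"
    using eventually_gt_at_top[of 0] by eventually_elim (rule *, auto)
  ultimately show "(F \<longlongrightarrow> 0) at_top" by (intro Lim_null_comparison[of F]) auto
  have "((\<lambda>x::real. C * inverse \<bar>x\<bar>) \<longlongrightarrow> C * 0) at_bot"
    by (intro tendsto_intros tendsto_inverse_0_at_top)
       (auto simp: filterlim_at_bot_mirror intro: filterlim_abs_real)
  moreover have "\<forall>\<^sub>F x in at_bot. norm (F x) \<le> C * inverse \<bar>x\<bar>"
    using eventually_gt_at_bot[of 0] by eventually_elim (rule *, auto)
  ultimately show "(F \<longlongrightarrow> 0) at_bot" by (intro Lim_null_comparison[of F]) auto
qed

text \<open>Dominated convergence of difference quotients. Differentiability is asked only for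
  almost every \<open>y\<close>, and the domination is a Lipschitz bound, because the integrand
  inherits the kink of \<open>phiAB\<close> when the initial profile is convolved.\<close>

lemma has_real_derivative_integral_Lipschitz:
  fixes f :: "real \<Rightarrow> 'a \<Rightarrow> real"
  assumes d: "d > 0" and int: "\<And>x. \<bar>x - a\<bar> < d \<Longrightarrow> integrable M (f x)"
    and der: "AE y in M. ((\<lambda>x. f x y) has_real_derivative f' y) (at a)"
    and lip: "\<And>x y. y \<in> space M \<Longrightarrow> \<bar>x - a\<bar> < d \<Longrightarrow> \<bar>f x y - f a y\<bar> \<le> g y * \<bar>x - a\<bar>"
    and g: "integrable M g" and m: "f' \<in> borel_measurable M"
  shows "((\<lambda>x. \<integral>y. f x y \<partial>M) has_real_derivative (\<integral>y. f' y \<partial>M)) (at a)"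
  unfolding has_field_derivative_iff tendsto_at_iff_sequentially
proof (intro allI impI)
  fix X :: "nat \<Rightarrow> real" assume X: "\<forall>i. X i \<in> UNIV - {a}" and lim: "X \<longlonglongrightarrow> a"
  have "\<forall>\<^sub>F n in sequentially. \<bar>X n - a\<bar> < d"
    using lim d by (auto simp: tendsto_iff dist_real_def)
  then obtain n0 where n0: "\<And>n. n \<ge> n0 \<Longrightarrow> \<bar>X n - a\<bar> < d"
    by (auto simp: eventually_sequentially)
  define Y where "Y n = X (n + n0)" for n
  have Y: "Y n \<noteq> a" "\<bar>Y n - a\<bar> < d" for n using X n0 by (auto simp: Y_def)
  have limY: "Y \<longlonglongrightarrow> a" unfolding Y_def using lim by (rule LIMSEQ_ignore_initial_segment)
  have "(\<lambda>n. \<integral>y. (f (Y n) y - f a y) / (Y n - a) \<partial>M) \<longlonglongrightarrow> (\<integral>y. f' y \<partial>M)"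
  proof (rule integral_dominated_convergence[where w=g])
    fix n
    show "(\<lambda>y. (f (Y n) y - f a y) / (Y n - a)) \<in> borel_measurable M"
      using int[OF Y(2)] int[of a] d by auto
    have "\<bar>f (Y n) y - f a y\<bar> / \<bar>Y n - a\<bar> \<le> g y" if "y \<in> space M" for y
      using lip[OF that Y(2)] Y(1) by (subst pos_divide_le_eq) auto
    then show "AE y in M. norm ((f (Y n) y - f a y) / (Y n - a)) \<le> g y"
      by (auto simp: abs_divide)
  next
    show "AE y in M. (\<lambda>n. (f (Y n) y - f a y) / (Y n - a)) \<longlonglongrightarrow> f' y"
      using der
    proof eventually_elim
      case (elim y)
      then have "((\<lambda>x. (f x y - f a y) / (x - a)) \<longlongrightarrow> f' y) (at a)"
        by (simp add: has_field_derivative_iff)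
      then show ?case using limY Y(1)
        by (auto simp: tendsto_at_iff_sequentially o_def)
    qed
  qed (use g m in auto)
  also have "(\<lambda>n. \<integral>y. (f (Y n) y - f a y) / (Y n - a) \<partial>M)
      = (\<lambda>n. ((\<integral>y. f (Y n) y \<partial>M) - (\<integral>y. f a y \<partial>M)) / (Y n - a))"
    using int[OF Y(2)] int[of a] d by (intro ext) simp
  finally have "(\<lambda>n. ((\<integral>y. f (X (n + n0)) y \<partial>M) - (\<integral>y. f a y \<partial>M)) / (X (n + n0) - a)) \<longlonglongrightarrow> (\<integral>y. f' y \<partial>M)"
    unfolding Y_def .
  from LIMSEQ_offset[OF this]
  show "((\<lambda>x. ((\<integral>y. f x y \<partial>M) - (\<integral>y. f a y \<partial>M)) / (x - a)) \<circ> X) \<longlonglongrightarrow> (\<integral>y. f' y \<partial>M)"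
    by (simp add: o_def)
qed

lemma has_real_derivative_integral:
  fixes f :: "real \<Rightarrow> 'a \<Rightarrow> real"
  assumes d: "d > 0" and int: "\<And>x. \<bar>x - a\<bar> < d \<Longrightarrow> integrable M (f x)"
    and der: "\<And>x y. y \<in> space M \<Longrightarrow> \<bar>x - a\<bar> < d \<Longrightarrow> ((\<lambda>x. f x y) has_real_derivative f' x y) (at x)"
    and bd: "\<And>x y. y \<in> space M \<Longrightarrow> \<bar>x - a\<bar> < d \<Longrightarrow> \<bar>f' x y\<bar> \<le> g y"
    and g: "integrable M g" and m: "f' a \<in> borel_measurable M"
  shows "((\<lambda>x. \<integral>y. f x y \<partial>M) has_real_derivative (\<integral>y. f' a y \<partial>M)) (at a)"
proof (rule has_real_derivative_integral_Lipschitz[OF d int _ _ g m])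
  show "AE y in M. ((\<lambda>x. f x y) has_real_derivative f' a y) (at a)"
    using der d by auto
  fix x y assume xy: "y \<in> space M" "\<bar>x - a\<bar> < d"
  show "\<bar>f x y - f a y\<bar> \<le> g y * \<bar>x - a\<bar>"
  proof -
    have "norm (f x y - f a y) \<le> g y * norm (x - a)"
    proof (rule field_differentiable_bound[where S="ball a d"])
      show "((\<lambda>x. f x y) has_real_derivative f' z y) (at z within ball a d)" if "z \<in> ball a d" for z
        using der[OF xy(1), of z] that by (auto simp: dist_real_def abs_minus_commute intro: DERIV_subset)
      show "norm (f' z y) \<le> g y" if "z \<in> ball a d" for z
        using bd[OF xy(1), of z] that by (auto simp: dist_real_def abs_minus_commute)
    qed (use xy d in \<open>auto simp: dist_real_def abs_minus_commute\<close>)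
    then show ?thesis by simp
  qed
qed auto

section \<open>Fourier integrals with weight exp(-xi^4)\<close>

lemma poly_exp_quartic_bounded: "\<exists>C. \<forall>x::real. \<bar>poly p x\<bar> * exp (-(x ^ 4)) \<le> C"
proof -
  have mono: "\<bar>x\<bar> ^ n * exp (-(x ^ 4)) \<le> 1 + fact n" for x :: real and n
  proof -
    have x4: "x ^ 4 \<ge> 0" by simp
    \<comment> \<open>A single term of the exponential series at \<open>x ^ 4\<close> already
      controls the power.\<close>
    have "(x ^ 4) ^ n / fact n \<le> exp (x ^ 4)"
    proof -
      have "(\<Sum>k<Suc n. (x ^ 4) ^ k /\<^sub>R fact k) \<le> exp (x ^ 4)"
        unfolding exp_def by (rule sum_le_suminf[OF summable_exp_generic]) (use x4 in auto)
      moreover have "(x ^ 4) ^ n /\<^sub>R fact n \<le> (\<Sum>k<Suc n. (x ^ 4) ^ k /\<^sub>R fact k)"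
        by (rule member_le_sum) (use x4 in auto)
      ultimately show ?thesis by (simp add: divide_inverse mult.commute)
    qed
    then have A: "(x ^ 4) ^ n * exp (-(x ^ 4)) \<le> fact n"
      by (simp add: exp_minus field_simps)
    have "\<bar>x\<bar> ^ n \<le> 1 + (x ^ 4) ^ n"
    proof (cases "\<bar>x\<bar> \<le> 1")
      case True
      then show ?thesis using power_le_one[of "\<bar>x\<bar>" n] x4 by (simp add: add_increasing2)
    next
      case False
      then have "\<bar>x\<bar> ^ n \<le> \<bar>x\<bar> ^ (4 * n)" by (intro power_increasing) auto
      then show ?thesis by (simp add: power_mult)
    qed
    then have "\<bar>x\<bar> ^ n * exp (-(x ^ 4)) \<le> (1 + (x ^ 4) ^ n) * exp (-(x ^ 4))"
      by (intro mult_right_mono) auto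
    also have "\<dots> \<le> 1 + fact n" using A x4 by (simp add: distrib_right add_mono)
    finally show ?thesis .
  qed
  have "\<bar>poly p x\<bar> * exp (-(x ^ 4)) \<le> (\<Sum>i\<le>degree p. \<bar>coeff p i\<bar> * (1 + fact i))" for x :: real
  proof -
    have "\<bar>poly p x\<bar> * exp (-(x ^ 4)) \<le> (\<Sum>i\<le>degree p. \<bar>coeff p i * x ^ i\<bar>) * exp (-(x ^ 4))"
      unfolding poly_altdef by (intro mult_right_mono sum_abs) auto
    also have "\<dots> = (\<Sum>i\<le>degree p. \<bar>coeff p i\<bar> * (\<bar>x\<bar> ^ i * exp (-(x ^ 4))))"
      by (simp add: sum_distrib_right abs_mult power_abs mult.assoc)
    also have "\<dots> \<le> (\<Sum>i\<le>degree p. \<bar>coeff p i\<bar> * (1 + fact i))"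
      by (intro sum_mono mult_left_mono mono) auto
    finally show ?thesis .
  qed
  then show ?thesis by blast
qed

lemma integrable_poly_exp_quartic:
  fixes f :: "real \<Rightarrow> real"
  assumes [measurable]: "f \<in> borel_measurable borel"
    and "\<And>x. \<bar>f x\<bar> \<le> \<bar>poly p x\<bar> * exp (-(x ^ 4))"
  shows "integrable lborel f"
proof -
  \<comment> \<open>The weight \<open>1 + x^2\<close> demanded by quadratic decay is absorbed into
    the polynomial.\<close>
  obtain C where C: "\<bar>poly ([:1,0,1:] * p) x\<bar> * exp (-(x ^ 4)) \<le> C" for x
    using poly_exp_quartic_bounded by metis
  show ?thesis
  proof (rule integrable_if_quadratic_decay)
    fix x
    have "(1 + x\<^sup>2) * \<bar>f x\<bar> \<le> (1 + x\<^sup>2) * (\<bar>poly p x\<bar> * exp (-(x ^ 4)))"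
      by (intro mult_left_mono assms) auto
    also have "\<dots> = \<bar>poly ([:1,0,1:] * p) x\<bar> * exp (-(x ^ 4))"
    proof -
      have "poly ([:1,0,1:] * p) x = (1 + x\<^sup>2) * poly p x" by (simp add: power2_eq_square algebra_simps)
      then show ?thesis by (simp only: abs_mult) simp
    qed
    finally show "(1 + x\<^sup>2) * \<bar>f x\<bar> \<le> C" using C[of x] by linarith
  qed simp
qed

text \<open>A family of real integrals closed under both operations needed: differentiation in
  \<open>x\<close> multiplies \<open>p\<close> by \<open>xi\<close>, multiplication by
  \<open>x\<close> replaces \<open>p\<close> by \<open>p' - 4 xi^3 p\<close>, and each advances the
  phase by \<open>pi / 2\<close>. The phase stands in for powers of the imaginary unit.\<close>

definition quartic_fourier :: "real poly \<Rightarrow> real \<Rightarrow> real \<Rightarrow> real" where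
  "quartic_fourier p \<theta> x = (\<integral>\<xi>. poly p \<xi> * exp (-(\<xi> ^ 4)) * cos (x * \<xi> + \<theta>) \<partial>lborel)"

lemma borel_measurable_poly [measurable]: "poly (p :: real poly) \<in> borel_measurable (borel :: real measure)"
  by (intro borel_measurable_continuous_onI continuous_intros)

lemma integrable_quartic_fourier:
  "integrable lborel (\<lambda>\<xi>::real. poly p \<xi> * exp (-(\<xi> ^ 4)) * cos (x * \<xi> + \<theta>))"
  by (rule integrable_poly_exp_quartic[where p=p]) (auto simp: abs_mult intro!: mult_left_le)

lemma quartic_fourier_deriv:
  "(quartic_fourier p \<theta> has_real_derivative quartic_fourier ([:0,1:] * p) (\<theta> + pi / 2) x) (at x)"
proof -
  have "((\<lambda>x. \<integral>\<xi>. poly p \<xi> * exp (-(\<xi> ^ 4)) * cos (x * \<xi> + \<theta>) \<partial>lborel) has_real_derivative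
     (\<integral>\<xi>. poly ([:0,1:] * p) \<xi> * exp (-(\<xi> ^ 4)) * cos (x * \<xi> + (\<theta> + pi / 2)) \<partial>lborel)) (at x)"
  proof (rule has_real_derivative_integral[where d=1 and g="\<lambda>\<xi>. \<bar>poly ([:0,1:] * p) \<xi>\<bar> * exp (-(\<xi> ^ 4))"])
    show "integrable lborel (\<lambda>\<xi>. \<bar>poly ([:0,1:] * p) \<xi>\<bar> * exp (-(\<xi> ^ 4)))"
      by (rule integrable_poly_exp_quartic[where p="[:0,1:] * p"]) auto
    fix x \<xi> :: real
    show "((\<lambda>x. poly p \<xi> * exp (-(\<xi> ^ 4)) * cos (x * \<xi> + \<theta>)) has_real_derivative
       poly ([:0,1:] * p) \<xi> * exp (-(\<xi> ^ 4)) * cos (x * \<xi> + (\<theta> + pi / 2))) (at x)"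
      by (auto intro!: derivative_eq_intros simp: cos_add sin_add algebra_simps)
    show "\<bar>poly ([:0,1:] * p) \<xi> * exp (-(\<xi> ^ 4)) * cos (x * \<xi> + (\<theta> + pi / 2))\<bar>
        \<le> \<bar>poly ([:0,1:] * p) \<xi>\<bar> * exp (-(\<xi> ^ 4))"
      by (simp only: abs_mult) (auto intro!: mult_left_le)
  qed (auto intro: integrable_quartic_fourier)
  then show ?thesis by (simp add: quartic_fourier_def[abs_def])
qed

lemma continuous_quartic_fourier: "isCont (quartic_fourier p \<theta>) x"
  by (rule DERIV_isCont[OF quartic_fourier_deriv])

lemma borel_measurable_quartic_fourier [measurable]: "quartic_fourier p \<theta> \<in> borel_measurable borel"
  by (intro borel_measurable_continuous_onI continuous_at_imp_continuous_on ballI continuous_quartic_fourier)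

text \<open>Integration by parts: \<open>x cos (x xi + theta)\<close> is the
  \<open>xi\<close>-derivative of \<open>sin (x xi + theta)\<close>, and the derivative of
  \<open>p exp(-xi^4)\<close> produces the new polynomial.\<close>

lemma quartic_fourier_mult:
  "x * quartic_fourier p \<theta> x = quartic_fourier (pderiv p - [:0,0,0,4:] * p) (\<theta> + pi / 2) x"
proof -
  let ?q = "pderiv p - [:0,0,0,4:] * p"
  let ?F = "\<lambda>\<xi>. poly p \<xi> * exp (-(\<xi> ^ 4)) * sin (x * \<xi> + \<theta>)"
  let ?f1 = "\<lambda>\<xi>. poly p \<xi> * exp (-(\<xi> ^ 4)) * cos (x * \<xi> + \<theta>)"
  let ?f2 = "\<lambda>\<xi>. poly ?q \<xi> * exp (-(\<xi> ^ 4)) * cos (x * \<xi> + (\<theta> + pi / 2))"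
  have i1: "integrable lborel ?f1" and i2: "integrable lborel ?f2"
    by (rule integrable_quartic_fourier)+
  obtain C where C: "\<bar>poly ([:0,1:] * p) \<xi>\<bar> * exp (-(\<xi> ^ 4)) \<le> C" for \<xi>
    using poly_exp_quartic_bounded by metis
  have dec: "\<bar>\<xi>\<bar> * \<bar>?F \<xi>\<bar> \<le> C" for \<xi>
  proof -
    have "\<bar>\<xi>\<bar> * \<bar>?F \<xi>\<bar> = (\<bar>poly ([:0,1:] * p) \<xi>\<bar> * exp (-(\<xi> ^ 4))) * \<bar>sin (x * \<xi> + \<theta>)\<bar>"
      by (simp add: abs_mult)
    also have "\<dots> \<le> \<bar>poly ([:0,1:] * p) \<xi>\<bar> * exp (-(\<xi> ^ 4))"
      by (intro mult_left_le) auto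
    finally show ?thesis using C[of \<xi>] by linarith
  qed
  have "(\<integral>\<xi>. x * ?f1 \<xi> - ?f2 \<xi> \<partial>lborel) = 0"
  proof (rule integral_derivative_whole_line_eq_0[where F="?F"])
    fix \<xi> :: real
    have p3: "\<xi> ^ 3 = \<xi> * (\<xi> * \<xi>)" by (simp add: power3_eq_cube)
    show "(?F has_real_derivative (x * ?f1 \<xi> - ?f2 \<xi>)) (at \<xi>)"
      apply (rule derivative_eq_intros poly_DERIV refl)+
      by (simp add: cos_add sin_add p3 algebra_simps)
    show "isCont (\<lambda>\<xi>. x * ?f1 \<xi> - ?f2 \<xi>) \<xi>" by (intro continuous_intros)
  qed (use i1 i2 tendsto_0_if_linear_decay[OF dec] in auto)
  moreover have "(\<integral>\<xi>. x * ?f1 \<xi> - ?f2 \<xi> \<partial>lborel) = x * integral\<^sup>L lborel ?f1 - integral\<^sup>L lborel ?f2"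
    by (subst Bochner_Integration.integral_diff) (use i1 i2 in auto)
  ultimately show ?thesis by (simp add: quartic_fourier_def)
qed

text \<open>Each power of \<open>x\<close> is traded for a new polynomial and phase by
  \<open>quartic_fourier_mult\<close>, so the induction must leave both arbitrary; with no power
  left, the absolute integral bounds the value.\<close>

lemma quartic_fourier_decay: "\<exists>C. \<forall>x. \<bar>x\<bar> ^ n * \<bar>quartic_fourier p \<theta> x\<bar> \<le> C"
proof (induction n arbitrary: p \<theta>)
  case 0
  have "\<bar>quartic_fourier p \<theta> x\<bar> \<le> (\<integral>\<xi>. \<bar>poly p \<xi>\<bar> * exp (-(\<xi> ^ 4)) \<partial>lborel)" for x
  proof -
    have "norm (quartic_fourier p \<theta> x) \<le> (\<integral>\<xi>. \<bar>poly p \<xi>\<bar> * exp (-(\<xi> ^ 4)) \<partial>lborel)"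
      unfolding quartic_fourier_def
    proof (rule Bochner_Integration.integral_norm_bound_integral)
      show "integrable lborel (\<lambda>\<xi>. \<bar>poly p \<xi>\<bar> * exp (-(\<xi> ^ 4)))"
        by (rule integrable_poly_exp_quartic[where p=p]) auto
    qed (auto simp: abs_mult intro: mult_left_le integrable_quartic_fourier)
    then show ?thesis by simp
  qed
  then show ?case by auto
next
  case (Suc n)
  from Suc[of "pderiv p - [:0,0,0,4:] * p" "\<theta> + pi / 2"] obtain C where
    C: "\<bar>x\<bar> ^ n * \<bar>quartic_fourier (pderiv p - [:0,0,0,4:] * p) (\<theta> + pi / 2) x\<bar> \<le> C" for x by auto
  have "\<bar>x\<bar> ^ Suc n * \<bar>quartic_fourier p \<theta> x\<bar> \<le> C" for x
    using C[of x] unfolding quartic_fourier_mult[symmetric] by (simp add: abs_mult mult_ac)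
  then show ?case by blast
qed

lemma quartic_fourier_quadratic_decay: "\<exists>C. \<forall>x. (1 + x\<^sup>2) * (\<bar>x\<bar> ^ n * \<bar>quartic_fourier p \<theta> x\<bar>) \<le> C"
proof -
  obtain C1 C2 where "\<bar>x\<bar> ^ n * \<bar>quartic_fourier p \<theta> x\<bar> \<le> C1" 
    "\<bar>x\<bar> ^ (n + 2) * \<bar>quartic_fourier p \<theta> x\<bar> \<le> C2" for x
    using quartic_fourier_decay by metis
  then have "(1 + x\<^sup>2) * (\<bar>x\<bar> ^ n * \<bar>quartic_fourier p \<theta> x\<bar>) \<le> C1 + C2" for x
    using add_mono[of "\<bar>x\<bar> ^ n * \<bar>quartic_fourier p \<theta> x\<bar>" C1 "\<bar>x\<bar> ^ (n + 2) * \<bar>quartic_fourier p \<theta> x\<bar>" C2]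
    unfolding power_add power2_abs by (simp add: algebra_simps)
  then show ?thesis by blast
qed

section \<open>The biharmonic kernel: Fourier inversion and moments\<close>

text \<open>The j-th derivative of the kernel G: a factor \<open>xi^j\<close> and j quarter turns of
  the phase.\<close>

definition Gder :: "nat \<Rightarrow> real \<Rightarrow> real" where
  "Gder j x = quartic_fourier (monom 1 j) (real j * pi / 2) x / (2 * pi)"

lemma Gbh_eq_Gder: "Gbh = Gder 0"
proof
  fix x :: real
  have "integral UNIV (\<lambda>\<xi>. exp (-(\<xi> ^ 4)) * cos (x * \<xi>)) = (\<integral>\<xi>. exp (-(\<xi> ^ 4)) * cos (x * \<xi>) \<partial>lborel)"
    by (rule integral_lborel) (use integrable_quartic_fourier[of 1 x 0] in simp)
  then show "Gbh x = Gder 0 x"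
    by (simp add: Gbh_def Gder_def quartic_fourier_def monom_0)
qed

lemma Gder_deriv: "(Gder j has_real_derivative Gder (Suc j) x) (at x)"
proof -
  have "real j * pi / 2 + pi / 2 = real (Suc j) * pi / 2" by (simp add: field_simps)
  then show ?thesis unfolding Gder_def[abs_def]
    using DERIV_cdivide[OF quartic_fourier_deriv[of "monom 1 j" "real j * pi / 2" x], of "2 * pi"]
    by (simp only: monom_Suc) simp
qed

lemma Gder_decay: "\<exists>C. \<forall>x. \<bar>x\<bar> ^ n * \<bar>Gder j x\<bar> \<le> C"
proof -
  obtain C where "\<bar>x\<bar> ^ n * \<bar>quartic_fourier (monom 1 j) (real j * pi / 2) x\<bar> \<le> C" for x
    using quartic_fourier_decay by metis
  then have "\<bar>x\<bar> ^ n * \<bar>Gder j x\<bar> \<le> C / (2 * pi)" for x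
    by (simp add: Gder_def abs_mult divide_right_mono)
  then show ?thesis by blast
qed

lemma borel_measurable_Gder [measurable]: "Gder j \<in> borel_measurable borel"
  unfolding Gder_def[abs_def] by measurable

lemma integrable_Gder: "integrable lborel (\<lambda>x. x ^ n * Gder j x)"
proof -
  obtain C where C: "(1 + x\<^sup>2) * (\<bar>x\<bar> ^ n * \<bar>quartic_fourier (monom 1 j) (real j * pi / 2) x\<bar>) \<le> C" for x
    using quartic_fourier_quadratic_decay by metis
  show ?thesis
  proof (rule integrable_if_quadratic_decay)
    fix x
    show "(1 + x\<^sup>2) * \<bar>x ^ n * Gder j x\<bar> \<le> C / (2 * pi)"
      using divide_right_mono[OF C[of x], of "2 * pi"]
      by (simp add: Gder_def abs_mult power_abs)
  qed simp
qed

lemma integrable_abs_Gder: "integrable lborel (\<lambda>x. \<bar>x\<bar> ^ n * \<bar>Gder j x\<bar>)"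
  using integrable_abs[OF integrable_Gder[of n j]] by (simp add: abs_mult power_abs)

lemma Gder_0_even: "Gder 0 (- x) = Gder 0 x"
  by (simp add: Gder_def quartic_fourier_def)

text \<open>A product majorant makes the double integral absolutely convergent, which is what Fubini
  requires.\<close>

lemma Fubini_dominated:
  fixes f :: "real \<Rightarrow> real \<Rightarrow> real"
  assumes a: "integrable lborel a" and b: "integrable lborel b"
    and [measurable]: "case_prod f \<in> borel_measurable (borel \<Otimes>\<^sub>M borel)"
    and dom: "\<And>x y. \<bar>f x y\<bar> \<le> \<bar>a x\<bar> * \<bar>b y\<bar>"
  shows "(\<integral>x. \<integral>y. f x y \<partial>lborel \<partial>lborel) = (\<integral>y. \<integral>x. f x y \<partial>lborel \<partial>lborel)"
proof -
  have fy: "integrable lborel (\<lambda>y. f x y)" for x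
    by (rule Bochner_Integration.integrable_bound[OF integrable_mult_right[OF b, of "a x"]])
       (auto simp: abs_mult intro!: dom)
  have "integrable (lborel \<Otimes>\<^sub>M lborel) (case_prod f)"
  proof (rule lborel_pair.Fubini_integrable)
    show "integrable lborel (\<lambda>x. \<integral>y. norm (case (x, y) of (x, y) \<Rightarrow> f x y) \<partial>lborel)"
    proof (rule Bochner_Integration.integrable_bound)
      show "integrable lborel (\<lambda>x. \<bar>a x\<bar> * (\<integral>y. \<bar>b y\<bar> \<partial>lborel))"
        using a by simp
      show "AE x in lborel. norm (\<integral>y. norm (case (x, y) of (x, y) \<Rightarrow> f x y) \<partial>lborel)
          \<le> norm (\<bar>a x\<bar> * (\<integral>y. \<bar>b y\<bar> \<partial>lborel))"
      proof (intro AE_I2)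
        fix x
        have "\<bar>\<integral>y. \<bar>f x y\<bar> \<partial>lborel\<bar> = (\<integral>y. \<bar>f x y\<bar> \<partial>lborel)"
          by (intro abs_of_nonneg Bochner_Integration.integral_nonneg) auto
        also have "\<dots> \<le> (\<integral>y. \<bar>a x\<bar> * \<bar>b y\<bar> \<partial>lborel)"
          by (rule integral_mono[OF integrable_abs[OF fy] integrable_mult_right[OF integrable_abs[OF b]] dom])
        also have "\<dots> = \<bar>a x\<bar> * (\<integral>y. \<bar>b y\<bar> \<partial>lborel)" by (rule integral_mult_right_zero)
        finally show "norm (\<integral>y. norm (case (x, y) of (x, y) \<Rightarrow> f x y) \<partial>lborel)
            \<le> norm (\<bar>a x\<bar> * (\<integral>y. \<bar>b y\<bar> \<partial>lborel))"
          by (simp only: prod.case real_norm_def)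
      qed
    qed measurable
  qed (use fy in auto)
  from lborel_pair.Fubini_integral[OF this] show ?thesis by simp
qed

lemma Fubini_bounded_kernel:
  fixes a b :: "real \<Rightarrow> real" and c :: "real \<Rightarrow> real \<Rightarrow> real"
  assumes a: "integrable lborel a" and b: "integrable lborel b"
    and [measurable]: "case_prod c \<in> borel_measurable (borel \<Otimes>\<^sub>M borel)" and c1: "\<And>x y. \<bar>c x y\<bar> \<le> 1"
  shows "(\<integral>x. a x * (\<integral>y. b y * c x y \<partial>lborel) \<partial>lborel) = (\<integral>y. b y * (\<integral>x. a x * c x y \<partial>lborel) \<partial>lborel)"
proof -
  have [measurable]: "a \<in> borel_measurable borel" "b \<in> borel_measurable borel" using a b by auto
  have "(\<integral>x. \<integral>y. a x * (b y * c x y) \<partial>lborel \<partial>lborel) = (\<integral>y. \<integral>x. a x * (b y * c x y) \<partial>lborel \<partial>lborel)"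
    by (rule Fubini_dominated[OF a b]) (auto simp: abs_mult intro!: mult_left_mono mult_left_le c1)
  moreover have "(\<integral>x. a x * (b y * c x y) \<partial>lborel) = b y * (\<integral>x. a x * c x y \<partial>lborel)" for y
    by (subst integral_mult_right_zero[symmetric]) (simp only: mult.left_commute)
  ultimately show ?thesis by (simp only: integral_mult_right_zero)
qed

section \<open>Gaussian regularization and Fourier inversion\<close>

lemma integrable_std_normal: "integrable lborel std_normal_density"
  using integrable_normal_density[of 1 0] by simp

text \<open>The real part of the known characteristic function of the standard normal law.\<close>

lemma integral_std_normal_cos: "(\<integral>x. std_normal_density x * cos (t * x) \<partial>lborel) = exp (- (t\<^sup>2) / 2)"
proof -
  have i: "integrable lborel (\<lambda>x. std_normal_density x *\<^sub>R iexp (t * x))"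
    by (rule Bochner_Integration.integrable_bound[OF integrable_std_normal]) auto
  have "complex_of_real (exp (- (t\<^sup>2) / 2)) = (\<integral>x. std_normal_density x *\<^sub>R iexp (t * x) \<partial>lborel)"
    using char_std_normal_distribution[THEN fun_cong, of t]
    by (simp add: char_def integral_density)
  then have "exp (- (t\<^sup>2) / 2) = Re (\<integral>x. std_normal_density x *\<^sub>R iexp (t * x) \<partial>lborel)"
    by (metis Re_complex_of_real)
  also have "\<dots> = (\<integral>x. Re (std_normal_density x *\<^sub>R iexp (t * x)) \<partial>lborel)"
    by (rule integral_Re[symmetric, OF i])
  also have "\<dots> = (\<integral>x. std_normal_density x * cos (t * x) \<partial>lborel)"
    by (simp add: Re_exp)
  finally show ?thesis by simp
qed

lemma integral_gaussian_cos:
  assumes e: "e > 0"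
  shows "(\<integral>x. exp (- ((e * x)\<^sup>2) / 2) * cos (x * z) \<partial>lborel) = sqrt (2 * pi) / e * exp (- ((z / e)\<^sup>2) / 2)"
proof -
  have "exp (- ((z / e)\<^sup>2) / 2) = (\<integral>x. std_normal_density x * cos (z / e * x) \<partial>lborel)"
    by (simp only: integral_std_normal_cos)
  also have "\<dots> = \<bar>e\<bar> *\<^sub>R (\<integral>x. std_normal_density (0 + e * x) * cos (z / e * (0 + e * x)) \<partial>lborel)"
    by (rule lborel_integral_real_affine) (use e in auto)
  also have "(\<lambda>x. std_normal_density (0 + e * x) * cos (z / e * (0 + e * x)))
      = (\<lambda>x. 1 / sqrt (2 * pi) * (exp (- ((e * x)\<^sup>2) / 2) * cos (x * z)))"
    using e by (auto simp: std_normal_density_def field_simps)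
  finally show ?thesis using e by (simp add: field_simps)
qed

lemma integrable_gaussian:
  assumes e: "e > 0"
  shows "integrable lborel (\<lambda>x::real. exp (- ((e * x)\<^sup>2) / 2))"
proof -
  have "integrable lborel (\<lambda>x. sqrt (2 * pi) * std_normal_density (0 + e * x))"
    using lborel_integrable_real_affine[OF integrable_std_normal, of e 0] e by simp
  then show ?thesis by (simp add: std_normal_density_def)
qed

text \<open>Multiplying by a Gaussian of width \<open>1/e\<close> makes the double integral
  absolutely convergent, and \<open>e \<rightarrow> 0\<close> recovers the symbol.\<close>

lemma Gder_fourier_regularized:
  assumes e: "e > 0"
  shows "(\<integral>x. Gder 0 x * cos (x * z) * exp (- ((e * x)\<^sup>2) / 2) \<partial>lborel)
    = (\<integral>u. std_normal_density u * exp (-((z + e * u) ^ 4)) \<partial>lborel)"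
proof -
  have ie: "integrable lborel (\<lambda>\<xi>::real. exp (-(\<xi> ^ 4)))"
    by (rule integrable_poly_exp_quartic[where p=1]) auto
  let ?g = "\<lambda>x. exp (- ((e * x)\<^sup>2) / 2)"
  have ig: "integrable lborel (\<lambda>x. ?g x * cos (x * w))" for w
    by (rule Bochner_Integration.integrable_bound[OF integrable_gaussian[OF e]]) (auto simp: abs_mult)
  \<comment> \<open>\<open>h\<close> is the cosine transform of the Gaussian damping factor, and
    \<open>E\<close> is the symbol with the normalization of the inverse transform.\<close>
  define h where "h w = sqrt (2 * pi) / e * exp (- ((w / e)\<^sup>2) / 2)" for w
  define E where "E \<xi> = exp (-(\<xi> ^ 4)) / (2 * pi)" for \<xi> :: real
  have [measurable]: "h \<in> borel_measurable borel" "E \<in> borel_measurable borel"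
    unfolding h_def[abs_def] E_def[abs_def] by measurable
  have even: "h (- w) = h w" "E (- w) = E w" for w by (simp_all add: h_def E_def)
  have "(\<integral>x. Gder 0 x * cos (x * z) * ?g x \<partial>lborel)
      = (\<integral>x. ?g x * (\<integral>\<xi>. E \<xi> * (cos (x * \<xi>) * cos (x * z)) \<partial>lborel) \<partial>lborel)"
  proof (intro Bochner_Integration.integral_cong refl)
    fix x
    have "(\<integral>\<xi>. E \<xi> * (cos (x * \<xi>) * cos (x * z)) \<partial>lborel)
        = (\<integral>\<xi>. (exp (-(\<xi> ^ 4)) * cos (x * \<xi>)) * (cos (x * z) / (2 * pi)) \<partial>lborel)"
      by (intro Bochner_Integration.integral_cong refl) (simp add: E_def)
    also have "\<dots> = Gder 0 x * cos (x * z)"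
      by (simp add: Gder_def quartic_fourier_def monom_0)
    finally show "Gder 0 x * cos (x * z) * ?g x
      = ?g x * (\<integral>\<xi>. E \<xi> * (cos (x * \<xi>) * cos (x * z)) \<partial>lborel)"
      by simp
  qed
  also have "\<dots> = (\<integral>\<xi>. E \<xi> * (\<integral>x. ?g x * (cos (x * \<xi>) * cos (x * z)) \<partial>lborel) \<partial>lborel)"
  proof (rule Fubini_bounded_kernel)
    show "\<bar>cos (x * y) * cos (x * z)\<bar> \<le> 1" for x y
      unfolding abs_mult by (intro mult_le_one) auto
    show "integrable lborel E" using ie by (simp add: E_def[abs_def])
    show "integrable lborel ?g" by (rule integrable_gaussian[OF e])
  qed measurable
  \<comment> \<open>The product of two cosines is split into half the sum of the cosines of
    difference and sum.\<close>
  also have "\<dots> = (\<integral>\<xi>. E \<xi> * ((h (\<xi> - z) + h (\<xi> + z)) / 2) \<partial>lborel)"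
  proof (intro Bochner_Integration.integral_cong refl arg_cong2[where f="(*)"])
    fix \<xi>
    have "(\<integral>x. ?g x * (cos (x * \<xi>) * cos (x * z)) \<partial>lborel)
        = (\<integral>x. (?g x * cos (x * (\<xi> - z)) + ?g x * cos (x * (\<xi> + z))) / 2 \<partial>lborel)"
      by (intro Bochner_Integration.integral_cong refl) (simp add: cos_add cos_diff algebra_simps)
    also have "\<dots> = ((\<integral>x. ?g x * cos (x * (\<xi> - z)) \<partial>lborel) + (\<integral>x. ?g x * cos (x * (\<xi> + z)) \<partial>lborel)) / 2"
      using ig by (simp del: add_divide_distrib)
    also have "\<dots> = (h (\<xi> - z) + h (\<xi> + z)) / 2"
      by (simp only: integral_gaussian_cos[OF e] h_def)
    finally show "(\<integral>x. ?g x * (cos (x * \<xi>) * cos (x * z)) \<partial>lborel) = (h (\<xi> - z) + h (\<xi> + z)) / 2" .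
  qed
  also have "\<dots> = ((\<integral>\<xi>. E \<xi> * h (\<xi> - z) \<partial>lborel)
      + (\<integral>\<xi>. E \<xi> * h (\<xi> + z) \<partial>lborel)) / 2"
  proof -
    have i: "integrable lborel (\<lambda>\<xi>. E \<xi> * h (\<xi> + w))" for w
    proof (rule Bochner_Integration.integrable_bound)
      show "integrable lborel (\<lambda>\<xi>. E \<xi> * (sqrt (2 * pi) / e))"
        using ie by (simp add: E_def)
      show "AE \<xi> in lborel. norm (E \<xi> * h (\<xi> + w)) \<le> norm (E \<xi> * (sqrt (2 * pi) / e))"
        using e by (auto simp: abs_mult h_def intro!: mult_left_mono mult_left_le divide_right_mono)
    qed measurable
    have "(\<lambda>\<xi>. E \<xi> * ((h (\<xi> - z) + h (\<xi> + z)) / 2)) = (\<lambda>\<xi>. (E \<xi> * h (\<xi> + - z) + E \<xi> * h (\<xi> + z)) / 2)"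
      by (simp add: distrib_left)
    then show ?thesis using i[of "- z"] i[of z] by (simp del: add_divide_distrib)
  qed
  \<comment> \<open>Both \<open>E\<close> and \<open>h\<close> are even, so reflecting
    \<open>xi\<close> makes the two halves equal.\<close>
  also have "(\<integral>\<xi>. E \<xi> * h (\<xi> + z) \<partial>lborel)
      = (\<integral>\<xi>. E \<xi> * h (\<xi> - z) \<partial>lborel)"
  proof -
    have "(\<integral>\<xi>. E \<xi> * h (\<xi> + z) \<partial>lborel) = \<bar>-1\<bar> *\<^sub>R (\<integral>\<xi>. E (0 + -1 * \<xi>) * h (0 + -1 * \<xi> + z) \<partial>lborel)"
      by (rule lborel_integral_real_affine) auto
    also have "\<dots> = (\<integral>\<xi>. E \<xi> * h (\<xi> - z) \<partial>lborel)"
      using even(1)[of "_ - z"] even(2) by simp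
    finally show ?thesis .
  qed
  also have "((\<integral>\<xi>. E \<xi> * h (\<xi> - z) \<partial>lborel)
     + (\<integral>\<xi>. E \<xi> * h (\<xi> - z) \<partial>lborel)) / 2
     = (\<integral>\<xi>. E \<xi> * h (\<xi> - z) \<partial>lborel)" by simp
  \<comment> \<open>The substitution \<open>xi = z + e u\<close> turns \<open>h\<close> into the
    standard normal density, whose mass stays fixed as \<open>e\<close> shrinks.\<close>
  also have "\<dots> = \<bar>e\<bar> *\<^sub>R (\<integral>u. E (z + e * u) * h (z + e * u - z) \<partial>lborel)"
    by (rule lborel_integral_real_affine) (use e in auto)
  also have "\<dots> = (\<integral>u. e * (E (z + e * u) * h (z + e * u - z)) \<partial>lborel)"
    using e by simp
  also have "\<dots> = (\<integral>u. std_normal_density u * exp (-((z + e * u) ^ 4)) \<partial>lborel)"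
  proof (intro Bochner_Integration.integral_cong refl)
    fix u
    have "sqrt (2 * pi) * sqrt (2 * pi) = 2 * pi" by simp
    then have "sqrt (2 * pi) / (2 * pi) = 1 / sqrt (2 * pi)" by (metis divide_divide_eq_left divide_self_if div_by_0 mult_zero_left)
    then show "e * (E (z + e * u) * h (z + e * u - z)) = std_normal_density u * exp (-((z + e * u) ^ 4))"
      using e by (simp add: std_normal_density_def E_def h_def frac_eq_eq)
  qed
  finally show ?thesis .
qed

text \<open>Dominated convergence applies to both sides of the regularized identity:
  \<open>Gder 0\<close> in absolute value dominates the left, the normal density dominates the
  right.\<close>

lemma Gder_fourier: "(\<integral>x. Gder 0 x * cos (x * z) \<partial>lborel) = exp (-(z ^ 4))"
proof (rule LIMSEQ_unique)
  define e where "e n = 1 / real (Suc n)" for n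
  have e: "e n > 0" for n by (simp add: e_def)
  have elim: "e \<longlonglongrightarrow> 0"
    using LIMSEQ_inverse_real_of_nat unfolding e_def by (simp add: inverse_eq_divide)
  have G: "integrable lborel (\<lambda>x. Gder 0 x)" using integrable_Gder[of 0 0] by simp
  show "(\<lambda>n. \<integral>x. Gder 0 x * cos (x * z) * exp (- ((e n * x)\<^sup>2) / 2) \<partial>lborel)
      \<longlonglongrightarrow> (\<integral>x. Gder 0 x * cos (x * z) \<partial>lborel)"
  proof (rule integral_dominated_convergence[where w="\<lambda>x. \<bar>Gder 0 x\<bar>"])
    show "AE x in lborel. (\<lambda>n. Gder 0 x * cos (x * z) * exp (- ((e n * x)\<^sup>2) / 2)) \<longlonglongrightarrow> Gder 0 x * cos (x * z)"
    proof (intro AE_I2)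
      fix x
      have "(\<lambda>n. Gder 0 x * cos (x * z) * exp (- ((e n * x)\<^sup>2) / 2)) \<longlonglongrightarrow> Gder 0 x * cos (x * z) * exp (- ((0 * x)\<^sup>2) / 2)"
        by (intro tendsto_intros elim) auto
      then show "(\<lambda>n. Gder 0 x * cos (x * z) * exp (- ((e n * x)\<^sup>2) / 2)) \<longlonglongrightarrow> Gder 0 x * cos (x * z)" by simp
    qed
    show "AE x in lborel. norm (Gder 0 x * cos (x * z) * exp (- ((e n * x)\<^sup>2) / 2)) \<le> \<bar>Gder 0 x\<bar>" for n
    proof (intro AE_I2)
      fix x
      have "\<bar>cos (x * z)\<bar> * exp (- ((e n * x)\<^sup>2) / 2) \<le> 1" by (intro mult_le_one) auto
      from mult_left_mono[OF this, of "\<bar>Gder 0 x\<bar>"]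
      show "norm (Gder 0 x * cos (x * z) * exp (- ((e n * x)\<^sup>2) / 2)) \<le> \<bar>Gder 0 x\<bar>"
        by (simp only: real_norm_def abs_mult abs_exp_cancel mult.assoc mult_1_right)
    qed
  qed (use G in auto)
  have "(\<lambda>n. \<integral>u. std_normal_density u * exp (-((z + e n * u) ^ 4)) \<partial>lborel)
      \<longlonglongrightarrow> (\<integral>u. std_normal_density u * exp (-(z ^ 4)) \<partial>lborel)"
  proof (rule integral_dominated_convergence[where w=std_normal_density])
    show "AE u in lborel. (\<lambda>n. std_normal_density u * exp (-((z + e n * u) ^ 4))) \<longlonglongrightarrow> std_normal_density u * exp (-(z ^ 4))"
    proof (intro AE_I2)
      fix u
      have "(\<lambda>n. std_normal_density u * exp (-((z + e n * u) ^ 4))) \<longlonglongrightarrow> std_normal_density u * exp (-((z + 0 * u) ^ 4))"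
        by (intro tendsto_intros elim)
      then show "(\<lambda>n. std_normal_density u * exp (-((z + e n * u) ^ 4))) \<longlonglongrightarrow> std_normal_density u * exp (-(z ^ 4))" by simp
    qed
    show "AE u in lborel. norm (std_normal_density u * exp (-((z + e n * u) ^ 4))) \<le> std_normal_density u" for n
      by (auto simp: abs_mult intro!: mult_left_le)
  qed (use integrable_std_normal in auto)
  also have "(\<integral>u. std_normal_density u * exp (-(z ^ 4)) \<partial>lborel) = exp (-(z ^ 4))"
    using integral_std_normal_cos[of 0] by simp
  finally show "(\<lambda>n. \<integral>x. Gder 0 x * cos (x * z) * exp (- ((e n * x)\<^sup>2) / 2) \<partial>lborel) \<longlonglongrightarrow> exp (-(z ^ 4))"
    unfolding Gder_fourier_regularized[OF e] .
qed

section \<open>Moments of the kernel\<close>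

lemma Gder_odd_moment:
  assumes "odd n" shows "(\<integral>x. x ^ n * Gder 0 x \<partial>lborel) = 0"
proof -
  have "(\<integral>x. x ^ n * Gder 0 x \<partial>lborel) = \<bar>-1\<bar> *\<^sub>R (\<integral>x. (0 + (-1) * x) ^ n * Gder 0 (0 + (-1) * x) \<partial>lborel)"
    by (rule lborel_integral_real_affine) auto
  also have "\<dots> = - (\<integral>x. x ^ n * Gder 0 x \<partial>lborel)"
    using assms by (simp add: Gder_0_even)
  finally show ?thesis by simp
qed

lemma Gder_moment_0: "(\<integral>x. Gder 0 x \<partial>lborel) = 1"
  using Gder_fourier[of 0] by simp

text \<open>Serves to compare Taylor coefficients at 0: the difference of two coefficients is
  bounded by a remainder of relative order \<open>eta^2\<close>.\<close>

lemma zero_if_quadratically_small: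
  fixes a C :: real
  assumes "\<And>\<eta>. 0 < \<eta> \<Longrightarrow> \<eta> \<le> 1 \<Longrightarrow> \<bar>a\<bar> \<le> C * \<eta>\<^sup>2"
  shows "a = 0"
proof -
  have "((\<lambda>\<eta>. C * \<eta>\<^sup>2) \<longlongrightarrow> C * 0\<^sup>2) (at_right 0)" by (intro tendsto_intros)
  moreover have "\<forall>\<^sub>F \<eta> in at_right 0. \<bar>a\<bar> \<le> C * \<eta>\<^sup>2"
    using eventually_at_right_real[of 0 1] by (rule eventually_mono) (use assms in auto)
  ultimately have "\<bar>a\<bar> \<le> C * 0\<^sup>2" by (intro tendsto_lowerbound) auto
  then show ?thesis by simp
qed

lemma cos_taylor_4: "\<bar>cos (x::real) - 1 + x\<^sup>2 / 2\<bar> \<le> x ^ 4 / 24"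
proof -
  obtain t where "cos x = (\<Sum>m<4. cos_coeff m * x ^ m) + cos (t + 1/2 * real (4::nat) * pi) / fact 4 * x ^ 4"
    using Maclaurin_cos_expansion by blast
  then have "cos x - 1 + x\<^sup>2 / 2 = cos (t + 1/2 * real (4::nat) * pi) * (x ^ 4 / 24)"
    by (simp add: lessThan_nat_numeral cos_coeff_def fact_numeral)
  also have "\<bar>\<dots>\<bar> \<le> x ^ 4 / 24" by (simp add: abs_mult mult_left_le_one_le)
  finally show ?thesis .
qed

lemma cos_taylor_6: "\<bar>cos (x::real) - 1 + x\<^sup>2 / 2 - x ^ 4 / 24\<bar> \<le> x ^ 6 / 720"
proof -
  obtain t where "cos x = (\<Sum>m<6. cos_coeff m * x ^ m) + cos (t + 1/2 * real (6::nat) * pi) / fact 6 * x ^ 6"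
    using Maclaurin_cos_expansion by blast
  then have "cos x - 1 + x\<^sup>2 / 2 - x ^ 4 / 24 = cos (t + 1/2 * real (6::nat) * pi) * (x ^ 6 / 720)"
    by (simp add: lessThan_nat_numeral cos_coeff_def fact_numeral)
  also have "\<bar>\<dots>\<bar> \<le> x ^ 6 / 720" by (simp add: abs_mult mult_left_le_one_le)
  finally show ?thesis .
qed

lemma integrable_Gder_cos: "integrable lborel (\<lambda>x. Gder 0 x * cos (x * z))"
  by (rule Bochner_Integration.integrable_bound[OF integrable_Gder[of 0 0]]) (auto simp: abs_mult intro!: mult_left_le)

text \<open>The transform \<open>exp(-eta^4)\<close> has no quadratic term, whereas expanding the
  cosine under the integral gives the moment times \<open>- eta^2 / 2\<close>.\<close>

lemma Gder_moment_2: "(\<integral>x. x\<^sup>2 * Gder 0 x \<partial>lborel) = 0"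
proof -
  let ?m = "\<integral>x. x\<^sup>2 * Gder 0 x \<partial>lborel" and ?M = "\<integral>x. \<bar>x\<bar> ^ 4 * \<bar>Gder 0 x\<bar> \<partial>lborel"
  \<comment> \<open>The cosine remainder contributes \<open>eta^4 ?M / 24\<close> and
    \<open>exp(-eta^4) - 1\<close> contributes \<open>eta^4\<close>; dividing by
    \<open>eta^2 / 2\<close> gives the constant.\<close>
  have "\<bar>?m\<bar> \<le> (?M / 12 + 2) * \<eta>\<^sup>2" if \<eta>: "0 < \<eta>" "\<eta> \<le> 1" for \<eta>
  proof -
    have fe: "(\<lambda>x. Gder 0 x * (cos (x * \<eta>) - 1 + (x * \<eta>)\<^sup>2 / 2))
       = (\<lambda>x. Gder 0 x * cos (x * \<eta>) - x ^ 0 * Gder 0 x + \<eta>\<^sup>2 / 2 * (x\<^sup>2 * Gder 0 x))"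
      by (simp add: algebra_simps power_mult_distrib)
    have "(\<integral>x. Gder 0 x * (cos (x * \<eta>) - 1 + (x * \<eta>)\<^sup>2 / 2) \<partial>lborel) = exp (-(\<eta> ^ 4)) - 1 + \<eta>\<^sup>2 / 2 * ?m"
      using integrable_Gder[of 0 0] integrable_Gder[of 2 0] integrable_Gder_cos[of \<eta>]
      unfolding fe by (simp add: Gder_fourier Gder_moment_0)
    then have eq: "exp (-(\<eta> ^ 4)) - 1 + \<eta>\<^sup>2 / 2 * ?m = (\<integral>x. Gder 0 x * (cos (x * \<eta>) - 1 + (x * \<eta>)\<^sup>2 / 2) \<partial>lborel)" by (rule sym)
    have "norm (exp (-(\<eta> ^ 4)) - 1 + \<eta>\<^sup>2 / 2 * ?m) \<le> (\<integral>x. \<eta> ^ 4 / 24 * (\<bar>x\<bar> ^ 4 * \<bar>Gder 0 x\<bar>) \<partial>lborel)"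
      unfolding eq
    proof (rule Bochner_Integration.integral_norm_bound_integral)
      show "integrable lborel (\<lambda>x. Gder 0 x * (cos (x * \<eta>) - 1 + (x * \<eta>)\<^sup>2 / 2))"
        unfolding fe
        by (intro Bochner_Integration.integrable_add Bochner_Integration.integrable_diff integrable_mult_right integrable_Gder integrable_Gder_cos)
      show "integrable lborel (\<lambda>x. \<eta> ^ 4 / 24 * (\<bar>x\<bar> ^ 4 * \<bar>Gder 0 x\<bar>))"
        using integrable_abs_Gder[of 4 0] by simp
      fix x show "norm (Gder 0 x * (cos (x * \<eta>) - 1 + (x * \<eta>)\<^sup>2 / 2)) \<le> \<eta> ^ 4 / 24 * (\<bar>x\<bar> ^ 4 * \<bar>Gder 0 x\<bar>)"
        using mult_left_mono[OF cos_taylor_4[of "x * \<eta>"], of "\<bar>Gder 0 x\<bar>"]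
        by (simp add: abs_mult power_mult_distrib mult_ac)
    qed
    then have 1: "\<bar>exp (-(\<eta> ^ 4)) - 1 + \<eta>\<^sup>2 / 2 * ?m\<bar> \<le> \<eta> ^ 4 / 24 * ?M" by simp
    have 2: "\<bar>exp (-(\<eta> ^ 4)) - 1\<bar> \<le> \<eta> ^ 4"
      using exp_ge_add_one_self[of "-(\<eta> ^ 4)"] by (simp add: abs_le_iff)
    have "\<eta>\<^sup>2 / 2 * \<bar>?m\<bar> = \<bar>\<eta>\<^sup>2 / 2 * ?m\<bar>" by (simp add: abs_mult)
    also have "\<dots> \<le> \<eta> ^ 4 / 24 * ?M + \<eta> ^ 4" using 1 2 by linarith
    also have "\<dots> = \<eta>\<^sup>2 / 2 * ((?M / 12 + 2) * \<eta>\<^sup>2)"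
      by (simp add: algebra_simps power2_eq_square power4_eq_xxxx)
    finally show ?thesis using \<eta> by simp
  qed
  then show ?thesis by (rule zero_if_quadratically_small)
qed

text \<open>At order 4 the transform contributes \<open>- eta^4\<close> and the cosine expansion
  \<open>eta^4 / 24\<close> times the moment; the quadratic term is gone by
  \<open>Gder_moment_2\<close>.\<close>

lemma Gder_moment_4: "(\<integral>x. x ^ 4 * Gder 0 x \<partial>lborel) = - 24"
proof -
  let ?m = "\<integral>x. x ^ 4 * Gder 0 x \<partial>lborel" and ?M = "\<integral>x. \<bar>x\<bar> ^ 6 * \<bar>Gder 0 x\<bar> \<partial>lborel"
  \<comment> \<open>The constant is 24 times the sum of \<open>?M / 720\<close> from the cosine and
    \<open>3 / 2\<close> from the exponential.\<close>
  have "\<bar>?m + 24\<bar> \<le> (?M / 30 + 36) * \<eta>\<^sup>2" if \<eta>: "0 < \<eta>" "\<eta> \<le> 1" for \<eta>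
  proof -
    have fe: "(\<lambda>x. Gder 0 x * (cos (x * \<eta>) - 1 + (x * \<eta>)\<^sup>2 / 2 - (x * \<eta>) ^ 4 / 24))
       = (\<lambda>x. Gder 0 x * cos (x * \<eta>) - x ^ 0 * Gder 0 x + \<eta>\<^sup>2 / 2 * (x\<^sup>2 * Gder 0 x) - \<eta> ^ 4 / 24 * (x ^ 4 * Gder 0 x))"
      by (simp add: algebra_simps power_mult_distrib)
    have "(\<integral>x. Gder 0 x * (cos (x * \<eta>) - 1 + (x * \<eta>)\<^sup>2 / 2 - (x * \<eta>) ^ 4 / 24) \<partial>lborel) = exp (-(\<eta> ^ 4)) - 1 - \<eta> ^ 4 / 24 * ?m"
      using integrable_Gder[of 0 0] integrable_Gder[of 2 0] integrable_Gder[of 4 0] integrable_Gder_cos[of \<eta>]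
      unfolding fe by (simp add: Gder_fourier Gder_moment_0 Gder_moment_2)
    then have eq: "exp (-(\<eta> ^ 4)) - 1 - \<eta> ^ 4 / 24 * ?m
      = (\<integral>x. Gder 0 x * (cos (x * \<eta>) - 1 + (x * \<eta>)\<^sup>2 / 2 - (x * \<eta>) ^ 4 / 24) \<partial>lborel)" by (rule sym)
    have "norm (exp (-(\<eta> ^ 4)) - 1 - \<eta> ^ 4 / 24 * ?m) \<le> (\<integral>x. \<eta> ^ 6 / 720 * (\<bar>x\<bar> ^ 6 * \<bar>Gder 0 x\<bar>) \<partial>lborel)"
      unfolding eq
    proof (rule Bochner_Integration.integral_norm_bound_integral)
      show "integrable lborel (\<lambda>x. Gder 0 x * (cos (x * \<eta>) - 1 + (x * \<eta>)\<^sup>2 / 2 - (x * \<eta>) ^ 4 / 24))"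
        unfolding fe
        by (intro Bochner_Integration.integrable_add Bochner_Integration.integrable_diff integrable_mult_right integrable_Gder integrable_Gder_cos)
      show "integrable lborel (\<lambda>x. \<eta> ^ 6 / 720 * (\<bar>x\<bar> ^ 6 * \<bar>Gder 0 x\<bar>))"
        using integrable_abs_Gder[of 6 0] by simp
      fix x show "norm (Gder 0 x * (cos (x * \<eta>) - 1 + (x * \<eta>)\<^sup>2 / 2 - (x * \<eta>) ^ 4 / 24)) \<le> \<eta> ^ 6 / 720 * (\<bar>x\<bar> ^ 6 * \<bar>Gder 0 x\<bar>)"
        using mult_left_mono[OF cos_taylor_6[of "x * \<eta>"], of "\<bar>Gder 0 x\<bar>"]
        by (simp add: abs_mult power_mult_distrib mult_ac)
    qed
    then have 1: "\<bar>exp (-(\<eta> ^ 4)) - 1 - \<eta> ^ 4 / 24 * ?m\<bar> \<le> \<eta> ^ 6 / 720 * ?M" by simp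
    have 2: "\<bar>exp (-(\<eta> ^ 4)) - 1 + \<eta> ^ 4\<bar> \<le> 3 / 2 * \<eta> ^ 6"
    proof -
      obtain t where "exp (-(\<eta> ^ 4)) = (\<Sum>m<2. (-(\<eta> ^ 4)) ^ m / fact m) + exp t / fact 2 * (-(\<eta> ^ 4)) ^ 2"
          and t: "\<bar>t\<bar> \<le> \<bar>-(\<eta> ^ 4)\<bar>"
        using Maclaurin_exp_le by blast
      then have eq: "exp (-(\<eta> ^ 4)) - 1 + \<eta> ^ 4 = exp t / 2 * (\<eta> ^ 4)\<^sup>2"
        by (simp add: numeral_2_eq_2)
      have "exp t \<le> exp 1" using t power_le_one[of \<eta> 4] \<eta> by (subst exp_le_cancel_iff) auto
      then have "exp t \<le> 3" using exp_le by linarith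
      \<comment> \<open>The exponential remainder is of order 8; it is weakened to order 6, which
        \<open>eta <= 1\<close> permits, to match the cosine remainder.\<close>
      moreover have "(\<eta> ^ 4)\<^sup>2 \<le> \<eta> ^ 6"
        unfolding power_mult[symmetric] using \<eta> by (intro power_decreasing) auto
      ultimately have "exp t / 2 * (\<eta> ^ 4)\<^sup>2 \<le> 3 / 2 * \<eta> ^ 6" by (intro mult_mono) auto
      then show ?thesis unfolding eq by simp
    qed
    have "\<eta> ^ 4 / 24 * \<bar>?m + 24\<bar> = \<bar>\<eta> ^ 4 / 24 * (?m + 24)\<bar>" by (simp add: abs_mult)
    also have "\<dots> = \<bar>(exp (-(\<eta> ^ 4)) - 1 + \<eta> ^ 4) - (exp (-(\<eta> ^ 4)) - 1 - \<eta> ^ 4 / 24 * ?m)\<bar>"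
      by (simp add: algebra_simps)
    also have "\<dots> \<le> 3 / 2 * \<eta> ^ 6 + \<eta> ^ 6 / 720 * ?M" using 1 2 by linarith
    also have "\<dots> = \<eta> ^ 4 / 24 * ((?M / 30 + 36) * \<eta>\<^sup>2)"
      using power_add[of \<eta> 4 2] by (simp add: algebra_simps)
    finally show ?thesis using \<eta> by simp
  qed
  then have "?m + 24 = 0" by (rule zero_if_quadratically_small)
  then show ?thesis by simp
qed

lemma Gder_1_moment_0: "(\<integral>x. Gder 1 x \<partial>lborel) = 0"
proof (rule integral_derivative_whole_line_eq_0[where F="Gder 0"])
  obtain C where "\<bar>x\<bar> ^ 1 * \<bar>Gder 0 x\<bar> \<le> C" for x using Gder_decay by metis
  then have *: "\<bar>x\<bar> * \<bar>Gder 0 x\<bar> \<le> C" for x by simp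
  show "(Gder 0 \<longlongrightarrow> 0) at_top" "(Gder 0 \<longlongrightarrow> 0) at_bot"
    using tendsto_0_if_linear_decay[OF *] by auto
  show "integrable lborel (Gder 1)" using integrable_Gder[of 0 1] by simp
qed (use Gder_deriv[of 0] DERIV_isCont[OF Gder_deriv] in auto)

text \<open>The derivative of \<open>x G(x)\<close> integrates to zero and contains the mass 1 of
  G.\<close>

lemma Gder_1_moment_1: "(\<integral>x. x * Gder 1 x \<partial>lborel) = - 1"
proof -
  have i: "integrable lborel (Gder 0)" "integrable lborel (\<lambda>x. x * Gder 1 x)"
    using integrable_Gder[of 0 0] integrable_Gder[of 1 1] by auto
  have "(\<integral>x. Gder 0 x + x * Gder 1 x \<partial>lborel) = 0"
  proof (rule integral_derivative_whole_line_eq_0[where F="\<lambda>x. x * Gder 0 x"])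
    obtain C where "\<bar>x\<bar> ^ 2 * \<bar>Gder 0 x\<bar> \<le> C" for x using Gder_decay by metis
    then have *: "\<bar>x\<bar> * \<bar>x * Gder 0 x\<bar> \<le> C" for x by (simp only: abs_mult power2_eq_square mult.assoc)
    show "((\<lambda>x. x * Gder 0 x) \<longlongrightarrow> 0) at_top" "((\<lambda>x. x * Gder 0 x) \<longlongrightarrow> 0) at_bot"
      using tendsto_0_if_linear_decay[OF *] by auto
    show "((\<lambda>x. x * Gder 0 x) has_real_derivative Gder 0 x + x * Gder 1 x) (at x)" for x
      using Gder_deriv[of 0 x] by (auto intro!: derivative_eq_intros)
    show "isCont (\<lambda>x. Gder 0 x + x * Gder 1 x) x" for x
      by (intro continuous_intros DERIV_isCont[OF Gder_deriv])
  qed (use i in auto)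
  then show ?thesis using i by (simp add: Gder_moment_0)
qed

section \<open>The biharmonic semigroup\<close>

text \<open>The length scale of fourth-order diffusion at time t; the value at 0 is 0, since
  \<open>0 powr a = 0\<close>.\<close>

definition qroot :: "real \<Rightarrow> real" where
  "qroot t = t powr (1/4)"

lemma qroot_pos: "t > 0 \<Longrightarrow> qroot t > 0"
  by (simp add: qroot_def)

lemma qroot_nonneg: "qroot t \<ge> 0"
  by (simp add: qroot_def)

lemma qroot_power: "t > 0 \<Longrightarrow> qroot t ^ n = t powr (real n / 4)"
  by (simp add: qroot_def powr_realpow[symmetric] powr_powr)

lemma qroot_power4: "t > 0 \<Longrightarrow> qroot t ^ 4 = t"
  by (simp add: qroot_power)

lemma qroot_mult: "s > 0 \<Longrightarrow> t > 0 \<Longrightarrow> qroot (s * t) = qroot s * qroot t"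
  by (simp add: qroot_def powr_mult)

lemma borel_measurable_qroot [measurable]: "qroot \<in> borel_measurable borel"
  unfolding qroot_def[abs_def] by measurable

text \<open>The j-th x-derivative of the kernel \<open>Gbh_t t\<close>; each derivative costs one
  factor of the length scale.\<close>

definition ker :: "nat \<Rightarrow> real \<Rightarrow> real \<Rightarrow> real" where
  "ker j t y = Gder j (y / qroot t) / qroot t ^ Suc j"

lemma Gbh_t_eq_ker: "t > 0 \<Longrightarrow> Gbh_t t x = ker 0 t x"
proof -
  have "t powr (-1/4) = inverse (qroot t)"
    unfolding qroot_def powr_minus[symmetric] by simp
  then have "Gbh_t t x = inverse (qroot t) * Gder 0 (x * inverse (qroot t))"
    by (simp only: Gbh_t_def Gbh_eq_Gder)
  then show ?thesis by (simp add: ker_def divide_inverse mult.commute)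
qed

lemma borel_measurable_ker [measurable (raw)]:
  assumes [measurable]: "f \<in> borel_measurable M" "g \<in> borel_measurable M"
  shows "(\<lambda>x. ker j (f x) (g x)) \<in> borel_measurable M"
  unfolding ker_def by measurable

lemma ker_deriv:
  assumes "t > 0" shows "(ker j t has_real_derivative ker (Suc j) t y) (at y)"
  unfolding ker_def[abs_def] using qroot_pos[OF assms]
  by (auto intro!: derivative_eq_intros DERIV_chain2[OF Gder_deriv])

text \<open>Weighted L1 norms of the kernel derivatives at time 1. They are the only kernel
  constants in the later convolution estimates.\<close>

definition Gnorm :: "nat \<Rightarrow> nat \<Rightarrow> real" where
  "Gnorm n j = (\<integral>z. \<bar>z\<bar> ^ n * \<bar>Gder j z\<bar> \<partial>lborel)"

lemma Gnorm_nonneg: "Gnorm n j \<ge> 0"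
  unfolding Gnorm_def by (intro Bochner_Integration.integral_nonneg) auto

lemma integral_ker_mult:
  fixes f :: "real \<Rightarrow> real"
  assumes "t > 0"
  shows "(\<integral>y. ker j t y * f y \<partial>lborel) = (\<integral>z. Gder j z * f (qroot t * z) \<partial>lborel) / qroot t ^ j"
proof -
  note q = qroot_pos[OF assms]
  have "(\<integral>y. ker j t y * f y \<partial>lborel) = \<bar>qroot t\<bar> *\<^sub>R (\<integral>z. ker j t (0 + qroot t * z) * f (0 + qroot t * z) \<partial>lborel)"
    by (rule lborel_integral_real_affine) (use q in auto)
  also have "\<dots> = (\<integral>z. qroot t * (ker j t (0 + qroot t * z) * f (0 + qroot t * z)) \<partial>lborel)"
    using q by simp
  also have "\<dots> = (\<integral>z. Gder j z * f (qroot t * z) / qroot t ^ j \<partial>lborel)"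
    using q by (intro Bochner_Integration.integral_cong refl) (simp add: ker_def)
  finally show ?thesis by simp
qed

lemma integrable_ker_mult_iff:
  fixes f :: "real \<Rightarrow> real"
  assumes "t > 0"
  shows "integrable lborel (\<lambda>y. ker j t y * f y) \<longleftrightarrow> integrable lborel (\<lambda>z. Gder j z * f (qroot t * z))"
proof -
  note q = qroot_pos[OF assms]
  have "integrable lborel (\<lambda>y. ker j t y * f y) \<longleftrightarrow> integrable lborel (\<lambda>z. ker j t (0 + qroot t * z) * f (0 + qroot t * z))"
    by (rule lborel_integrable_real_affine_iff[symmetric]) (use q in auto)
  also have "(\<lambda>z. ker j t (0 + qroot t * z) * f (0 + qroot t * z)) = (\<lambda>z. Gder j z * f (qroot t * z) * (1 / qroot t ^ Suc j))"
    using q by (simp add: ker_def)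
  also have "integrable lborel \<dots> \<longleftrightarrow> integrable lborel (\<lambda>z. Gder j z * f (qroot t * z))"
    using q by (simp only: integrable_mult_right_iff) simp
  finally show ?thesis .
qed

lemma integrable_ker_moment:
  assumes "t > 0" shows "integrable lborel (\<lambda>y. \<bar>y\<bar> ^ n * \<bar>ker j t y\<bar>)"
proof -
  have "integrable lborel (\<lambda>y. ker j t y * y ^ n)"
    unfolding integrable_ker_mult_iff[OF assms]
    using integrable_mult_right[OF integrable_Gder[of n j], of "qroot t ^ n"]
    by (simp add: power_mult_distrib mult_ac)
  from integrable_abs[OF this] show ?thesis by (simp add: abs_mult power_abs mult.commute)
qed

lemma integrable_ker: "t > 0 \<Longrightarrow> integrable lborel (ker j t)"
  using integrable_ker_mult_iff[of t j "\<lambda>_. 1"] integrable_Gder[of 0 j] by simp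

lemma ker_decay:
  assumes "t > 0" obtains C where "\<And>y. (1 + y\<^sup>2) * \<bar>ker j t y\<bar> \<le> C"
proof -
  note q = qroot_pos[OF assms]
  obtain C0 C2 where C0: "\<bar>x\<bar> ^ 0 * \<bar>Gder j x\<bar> \<le> C0" and C2: "\<bar>x\<bar> ^ 2 * \<bar>Gder j x\<bar> \<le> C2" for x
    using Gder_decay by metis
  have "(1 + y\<^sup>2) * \<bar>ker j t y\<bar> \<le> (C0 + C2 * (qroot t)\<^sup>2) / qroot t ^ Suc j" for y
  proof -
    have "\<bar>Gder j (y / qroot t)\<bar> + (y / qroot t)\<^sup>2 * \<bar>Gder j (y / qroot t)\<bar> * (qroot t)\<^sup>2 \<le> C0 + C2 * (qroot t)\<^sup>2"
      using C0[of "y / qroot t"] C2[of "y / qroot t"] q by (intro add_mono mult_right_mono) (auto simp: power_divide)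
    also have "\<bar>Gder j (y / qroot t)\<bar> + (y / qroot t)\<^sup>2 * \<bar>Gder j (y / qroot t)\<bar> * (qroot t)\<^sup>2
       = (1 + y\<^sup>2) * \<bar>Gder j (y / qroot t)\<bar>" using q by (simp add: field_simps)
    finally have "(1 + y\<^sup>2) * \<bar>Gder j (y / qroot t)\<bar> / qroot t ^ Suc j \<le> (C0 + C2 * (qroot t)\<^sup>2) / qroot t ^ Suc j"
      using q by (intro divide_right_mono) auto
    then show ?thesis using q by (simp add: ker_def abs_mult)
  qed
  then show thesis by (rule that)
qed

lemma ker_fourier_cos: "t > 0 \<Longrightarrow> (\<integral>y. ker 0 t y * cos (y * \<xi>) \<partial>lborel) = exp (-(t * \<xi> ^ 4))"
  using Gder_fourier[of "qroot t * \<xi>"]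
  by (simp add: integral_ker_mult power_mult_distrib qroot_power4 mult.left_commute mult.assoc)

lemma ker_fourier_sin: "(\<integral>y. ker 0 t y * sin (y * \<xi>) \<partial>lborel) = 0"
proof -
  have "(\<integral>y. ker 0 t y * sin (y * \<xi>) \<partial>lborel)
     = \<bar>-1\<bar> *\<^sub>R (\<integral>y. ker 0 t (0 + -1 * y) * sin ((0 + -1 * y) * \<xi>) \<partial>lborel)"
    by (rule lborel_integral_real_affine) auto
  also have "\<dots> = - (\<integral>y. ker 0 t y * sin (y * \<xi>) \<partial>lborel)"
    by (simp add: ker_def Gder_0_even)
  finally show ?thesis by simp
qed

text \<open>Rescaling the frequency by \<open>qroot t\<close> turns the scaled kernel into the
  inverse transform of the symbol \<open>exp(-t xi^4)\<close>, with j derivatives as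
  \<open>xi^j\<close> and phase.\<close>

lemma ker_eq_fourier:
  assumes "t > 0"
  shows "ker j t y = (\<integral>\<xi>. \<xi> ^ j * exp (-(t * \<xi> ^ 4)) / (2 * pi) * cos (y * \<xi> + real j * pi / 2) \<partial>lborel)"
proof -
  note q = qroot_pos[OF assms]
  let ?f = "\<lambda>\<xi>. \<xi> ^ j * exp (-(\<xi> ^ 4)) * cos (y / qroot t * \<xi> + real j * pi / 2)"
  have "(\<integral>\<xi>. ?f \<xi> \<partial>lborel) = \<bar>qroot t\<bar> *\<^sub>R (\<integral>\<xi>. ?f (0 + qroot t * \<xi>) \<partial>lborel)"
    by (rule lborel_integral_real_affine) (use q in auto)
  also have "\<dots> = (\<integral>\<xi>. qroot t * ?f (0 + qroot t * \<xi>) \<partial>lborel)" using q by simp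
  also have "\<dots> = (\<integral>\<xi>. (2 * pi * qroot t ^ Suc j) * (\<xi> ^ j * exp (-(t * \<xi> ^ 4)) / (2 * pi) * cos (y * \<xi> + real j * pi / 2)) \<partial>lborel)"
    using q by (intro Bochner_Integration.integral_cong refl)
      (simp add: power_mult_distrib qroot_power4[OF assms])
  also have "\<dots> = (2 * pi * qroot t ^ Suc j) * (\<integral>\<xi>. \<xi> ^ j * exp (-(t * \<xi> ^ 4)) / (2 * pi) * cos (y * \<xi> + real j * pi / 2) \<partial>lborel)"
    by (rule integral_mult_right_zero)
  finally have "(\<integral>\<xi>. ?f \<xi> \<partial>lborel) / (2 * pi * qroot t ^ Suc j)
     = (\<integral>\<xi>. \<xi> ^ j * exp (-(t * \<xi> ^ 4)) / (2 * pi) * cos (y * \<xi> + real j * pi / 2) \<partial>lborel)"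
    using q by simp
  then show ?thesis by (simp add: ker_def Gder_def quartic_fourier_def poly_monom)
qed

lemma integrable_power_exp_quartic:
  assumes "t > 0" shows "integrable lborel (\<lambda>\<xi>::real. \<xi> ^ j * exp (-(t * \<xi> ^ 4)))"
proof -
  note q = qroot_pos[OF assms]
  have "integrable lborel (\<lambda>\<xi>::real. \<xi> ^ j * exp (-(\<xi> ^ 4)))"
    by (rule integrable_poly_exp_quartic[where p="monom 1 j"]) (auto simp: poly_monom abs_mult)
  from lborel_integrable_real_affine[OF this, of "qroot t" 0]
  have "integrable lborel (\<lambda>\<xi>. (1 / qroot t ^ j) * ((qroot t * \<xi>) ^ j * exp (-((qroot t * \<xi>) ^ 4))))"
    using q by simp
  then show ?thesis using q by (simp add: power_mult_distrib qroot_power4[OF assms])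
qed

text \<open>Only the second factor is written as a Fourier integral. Integrating the shifted cosine
  against \<open>ker 0 h\<close> multiplies it by \<open>exp(-h xi^4)\<close>, by inversion and
  evenness, and the exponents add.\<close>

lemma ker_semigroup:
  assumes h: "h > 0" and t: "t > 0"
  shows "(\<integral>y. ker 0 h y * ker j t (w - y) \<partial>lborel) = ker j (t + h) w"
proof -
  let ?b = "\<lambda>\<xi>. \<xi> ^ j * exp (-(t * \<xi> ^ 4)) / (2 * pi)"
  let ?c = "\<lambda>y \<xi>. cos ((w - y) * \<xi> + real j * pi / 2)"
  have "(\<integral>y. ker 0 h y * ker j t (w - y) \<partial>lborel) = (\<integral>y. ker 0 h y * (\<integral>\<xi>. ?b \<xi> * ?c y \<xi> \<partial>lborel) \<partial>lborel)"
    by (simp only: ker_eq_fourier[OF t])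
  also have "\<dots> = (\<integral>\<xi>. ?b \<xi> * (\<integral>y. ker 0 h y * ?c y \<xi> \<partial>lborel) \<partial>lborel)"
    by (rule Fubini_bounded_kernel)
       (use integrable_ker[OF h] integrable_power_exp_quartic[OF t] in auto)
  also have "\<dots> = (\<integral>\<xi>. \<xi> ^ j * exp (-((t + h) * \<xi> ^ 4)) / (2 * pi) * cos (w * \<xi> + real j * pi / 2) \<partial>lborel)"
  proof (intro Bochner_Integration.integral_cong refl)
    fix \<xi>
    have i: "integrable lborel (\<lambda>y. ker 0 h y * cos (y * \<xi>))" "integrable lborel (\<lambda>y. ker 0 h y * sin (y * \<xi>))"
      by (rule Bochner_Integration.integrable_bound[OF integrable_ker[OF h, of 0]]; force simp: abs_mult intro: mult_left_le)+
    have "(\<integral>y. ker 0 h y * ?c y \<xi> \<partial>lborel)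
      = (\<integral>y. cos (w * \<xi> + real j * pi / 2) * (ker 0 h y * cos (y * \<xi>)) + sin (w * \<xi> + real j * pi / 2) * (ker 0 h y * sin (y * \<xi>)) \<partial>lborel)"
    proof (intro Bochner_Integration.integral_cong refl)
      fix y
      have "(w - y) * \<xi> + real j * pi / 2 = (w * \<xi> + real j * pi / 2) - y * \<xi>" by (simp add: algebra_simps)
      then show "ker 0 h y * ?c y \<xi> = cos (w * \<xi> + real j * pi / 2) * (ker 0 h y * cos (y * \<xi>)) + sin (w * \<xi> + real j * pi / 2) * (ker 0 h y * sin (y * \<xi>))"
        by (simp only: cos_diff) (simp add: algebra_simps)
    qed
    also have "\<dots> = cos (w * \<xi> + real j * pi / 2) * exp (-(h * \<xi> ^ 4))"
      using i by (simp add: ker_fourier_cos[OF h] ker_fourier_sin)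
    finally show "?b \<xi> * (\<integral>y. ker 0 h y * ?c y \<xi> \<partial>lborel)
        = \<xi> ^ j * exp (-((t + h) * \<xi> ^ 4)) / (2 * pi) * cos (w * \<xi> + real j * pi / 2)"
      by (simp add: distrib_right exp_add[symmetric] mult_exp_exp)
  qed
  also have "\<dots> = ker j (t + h) w" using h t by (simp only: ker_eq_fourier add_pos_pos)
  finally show ?thesis .
qed

section \<open>Convolution with kernel derivatives on functions of linear growth\<close>

definition conv :: "nat \<Rightarrow> real \<Rightarrow> (real \<Rightarrow> real) \<Rightarrow> real \<Rightarrow> real" where
  "conv j t f x = (\<integral>y. ker j t y * f (x - y) \<partial>lborel)"

text \<open>A class containing the unbounded profile \<open>phiAB\<close>, all Lipschitz functions
  such as \<open>U\<close> at a fixed time, and the bounded source.\<close>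

definition lingrowth :: "(real \<Rightarrow> real) \<Rightarrow> bool" where
  "lingrowth f \<longleftrightarrow> f \<in> borel_measurable borel \<and> (\<exists>C. \<forall>x. \<bar>f x\<bar> \<le> C * (1 + \<bar>x\<bar>))"

lemma lingrowthE:
  assumes "lingrowth f"
  obtains C where "f \<in> borel_measurable borel" "C \<ge> 0" "\<And>x. \<bar>f x\<bar> \<le> C * (1 + \<bar>x\<bar>)"
proof -
  from assms obtain C where C: "f \<in> borel_measurable borel" "\<And>x. \<bar>f x\<bar> \<le> C * (1 + \<bar>x\<bar>)"
    by (auto simp: lingrowth_def)
  have "0 \<le> C" using C(2)[of 0] by simp
  with C show thesis by (intro that)
qed

lemma lingrowth_bounded:
  assumes "f \<in> borel_measurable borel" "\<And>x. \<bar>f x\<bar> \<le> C"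
  shows "lingrowth f"
proof -
  have "C \<ge> 0" using assms(2)[of 0] by linarith
  then have "\<bar>f x\<bar> \<le> C * (1 + \<bar>x\<bar>)" for x
    using assms(2)[of x] by (simp add: distrib_left add_increasing2)
  then show ?thesis using assms(1) by (auto simp: lingrowth_def)
qed

lemma lingrowth_Lipschitz:
  fixes f :: "real \<Rightarrow> real"
  assumes "\<And>x y. \<bar>f x - f y\<bar> \<le> L * \<bar>x - y\<bar>"
  shows "lingrowth f"
proof -
  have "L \<ge> 0" using assms[of 0 1] by simp
  have "L-lipschitz_on UNIV f" using assms \<open>L \<ge> 0\<close> by (auto simp: lipschitz_on_def dist_real_def)
  then have "f \<in> borel_measurable borel"
    by (intro borel_measurable_continuous_onI lipschitz_on_continuous_on)
  moreover have "\<bar>f x\<bar> \<le> (\<bar>f 0\<bar> + L) * (1 + \<bar>x\<bar>)" for x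
  proof -
    have "(\<bar>f 0\<bar> + L) * (1 + \<bar>x\<bar>) = \<bar>f 0\<bar> + L * \<bar>x\<bar> + (L + \<bar>f 0\<bar> * \<bar>x\<bar>)" by (simp add: algebra_simps)
    moreover have "\<bar>f x\<bar> \<le> \<bar>f 0\<bar> + L * \<bar>x\<bar>" using assms[of x 0] by simp
    moreover have "0 \<le> L + \<bar>f 0\<bar> * \<bar>x\<bar>" using \<open>L \<ge> 0\<close> by simp
    ultimately show ?thesis by linarith
  qed
  ultimately show ?thesis by (auto simp: lingrowth_def)
qed

lemma integrable_ker_lin: "t > 0 \<Longrightarrow> integrable lborel (\<lambda>y. \<bar>ker j t y\<bar> * (1 + \<bar>y\<bar>))"
  using integrable_ker_moment[of t 0 j] integrable_ker_moment[of t 1 j]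
  by (simp add: algebra_simps)

lemma integrable_conv:
  assumes t: "t > 0" and f: "lingrowth f"
  shows "integrable lborel (\<lambda>y. ker j t y * f (x - y))"
proof -
  obtain C where [measurable]: "f \<in> borel_measurable borel" and C: "C \<ge> 0" "\<And>x. \<bar>f x\<bar> \<le> C * (1 + \<bar>x\<bar>)"
    by (rule lingrowthE[OF f]) blast
  show ?thesis
  proof (rule Bochner_Integration.integrable_bound)
    show "integrable lborel (\<lambda>y. (C * (1 + \<bar>x\<bar>)) * (\<bar>ker j t y\<bar> * (1 + \<bar>y\<bar>)))"
      by (intro integrable_mult_right integrable_ker_lin t)
    have "norm (ker j t y * f (x - y)) \<le> norm ((C * (1 + \<bar>x\<bar>)) * (\<bar>ker j t y\<bar> * (1 + \<bar>y\<bar>)))" for y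
    proof -
      have "\<bar>f (x - y)\<bar> \<le> C * (1 + \<bar>x - y\<bar>)" by (rule C)
      also have "\<dots> \<le> C * ((1 + \<bar>x\<bar>) * (1 + \<bar>y\<bar>))"
      proof (rule mult_left_mono[OF _ C(1)])
        have "(1 + \<bar>x\<bar>) * (1 + \<bar>y\<bar>) = 1 + \<bar>x\<bar> + \<bar>y\<bar> + \<bar>x\<bar> * \<bar>y\<bar>" by (simp add: algebra_simps)
        moreover have "0 \<le> \<bar>x\<bar> * \<bar>y\<bar>" by simp
        ultimately show "1 + \<bar>x - y\<bar> \<le> (1 + \<bar>x\<bar>) * (1 + \<bar>y\<bar>)" by linarith
      qed
      finally have "\<bar>ker j t y\<bar> * \<bar>f (x - y)\<bar> \<le> \<bar>ker j t y\<bar> * (C * ((1 + \<bar>x\<bar>) * (1 + \<bar>y\<bar>)))"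
        by (intro mult_left_mono) auto
      then show ?thesis using C(1) by (simp add: abs_mult mult_ac)
    qed
    then show "AE y in lborel. norm (ker j t y * f (x - y)) \<le> norm ((C * (1 + \<bar>x\<bar>)) * (\<bar>ker j t y\<bar> * (1 + \<bar>y\<bar>)))"
      by simp
  qed measurable
qed

text \<open>Moves \<open>x\<close> into the kernel, so that differentiation in \<open>x\<close>
  falls on the smooth factor and \<open>f\<close> need only be measurable.\<close>

lemma conv_reflect:
  "conv j t f x = (\<integral>y. ker j t (x - y) * f y \<partial>lborel)"
proof -
  have "(\<integral>y. ker j t y * f (x - y) \<partial>lborel) = \<bar>-1\<bar> *\<^sub>R (\<integral>y. ker j t (x + -1 * y) * f (x - (x + -1 * y)) \<partial>lborel)"
    by (rule lborel_integral_real_affine) auto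
  then show ?thesis by (simp add: conv_def)
qed

lemma integrable_conv_reflect:
  assumes "t > 0" "lingrowth f"
  shows "integrable lborel (\<lambda>y. ker j t (x - y) * f y)"
  using lborel_integrable_real_affine[OF integrable_conv[OF assms, of j x], of "-1" x] by simp

lemma biheat_eq_conv:
  assumes "t > 0" "lingrowth f"
  shows "biheat t f x = conv 0 t f x"
  using integral_lborel[OF integrable_conv_reflect[OF assms, of 0 x]]
  by (simp add: biheat_def conv_reflect Gbh_t_eq_ker[OF assms(1)])

lemma conv_scaled:
  "t > 0 \<Longrightarrow> conv j t f x = (\<integral>z. Gder j z * f (x - qroot t * z) \<partial>lborel) / qroot t ^ j"
  using integral_ker_mult[of t j "\<lambda>y. f (x - y)"] by (simp add: conv_def)

text \<open>After rescaling to time 1, vanishing of order n at \<open>x\<close> gains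
  \<open>qroot t ^ n\<close> and j kernel derivatives lose \<open>qroot t ^ j\<close>.\<close>

lemma conv_weighted_bound:
  assumes t: "t > 0" and f: "lingrowth f" and b: "\<And>y. \<bar>f (x - y)\<bar> \<le> C * \<bar>y\<bar> ^ n"
  shows "\<bar>conv j t f x\<bar> \<le> C * Gnorm n j * qroot t ^ n / qroot t ^ j"
proof -
  note q = qroot_pos[OF t]
  have "norm (\<integral>z. Gder j z * f (x - qroot t * z) \<partial>lborel) \<le> (\<integral>z. (C * qroot t ^ n) * (\<bar>z\<bar> ^ n * \<bar>Gder j z\<bar>) \<partial>lborel)"
  proof (rule Bochner_Integration.integral_norm_bound_integral)
    show "integrable lborel (\<lambda>z. Gder j z * f (x - qroot t * z))"
      using integrable_conv[OF t f, of j x] integrable_ker_mult_iff[OF t, of j "\<lambda>y. f (x - y)"] by simp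
    show "integrable lborel (\<lambda>z. (C * qroot t ^ n) * (\<bar>z\<bar> ^ n * \<bar>Gder j z\<bar>))"
      by (intro integrable_mult_right integrable_abs_Gder)
    fix z
    show "norm (Gder j z * f (x - qroot t * z)) \<le> (C * qroot t ^ n) * (\<bar>z\<bar> ^ n * \<bar>Gder j z\<bar>)"
      using mult_left_mono[OF b[of "qroot t * z"], of "\<bar>Gder j z\<bar>"] q
      by (simp add: abs_mult power_mult_distrib mult_ac)
  qed
  then have "\<bar>\<integral>z. Gder j z * f (x - qroot t * z) \<partial>lborel\<bar> \<le> C * Gnorm n j * qroot t ^ n"
    unfolding integral_mult_right_zero Gnorm_def[symmetric] real_norm_def by (simp add: mult_ac)
  then show ?thesis using q by (simp add: conv_scaled[OF t] divide_right_mono)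
qed

lemma conv_bound:
  assumes t: "t > 0" and f: "f \<in> borel_measurable borel" "\<And>y. \<bar>f y\<bar> \<le> C"
  shows "\<bar>conv j t f x\<bar> \<le> C * Gnorm 0 j / qroot t ^ j"
  using conv_weighted_bound[OF t lingrowth_bounded[OF f], of x C 0 j] f(2) by simp

lemma conv_diff_const:
  assumes t: "t > 0" and f: "lingrowth f"
  shows "conv 0 t f x - c = conv 0 t (\<lambda>y. f y - c) x"
proof -
  have 1: "integrable lborel (\<lambda>y. ker 0 t y * c)" using integrable_ker[OF t] by simp
  have "(\<integral>y. ker 0 t y \<partial>lborel) = 1" using ker_fourier_cos[OF t, of 0] by simp
  then show ?thesis using integrable_conv[OF t f, of 0 x] 1
    by (simp add: conv_def right_diff_distrib)
qed

lemma lingrowth_diff_const: "lingrowth f \<Longrightarrow> lingrowth (\<lambda>y. f y - c)"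
proof (erule lingrowthE)
  fix C assume [measurable]: "f \<in> borel_measurable borel" and C: "\<And>x. \<bar>f x\<bar> \<le> C * (1 + \<bar>x\<bar>)"
  have "\<bar>f x - c\<bar> \<le> (C + \<bar>c\<bar>) * (1 + \<bar>x\<bar>)" for x
  proof -
    have "(C + \<bar>c\<bar>) * (1 + \<bar>x\<bar>) = C * (1 + \<bar>x\<bar>) + \<bar>c\<bar> + \<bar>c\<bar> * \<bar>x\<bar>" by (simp add: algebra_simps)
    moreover have "0 \<le> \<bar>c\<bar> * \<bar>x\<bar>" by simp
    ultimately show ?thesis using C[of x] by linarith
  qed
  then show ?thesis by (auto simp: lingrowth_def)
qed

text \<open>The kernel has mass 1, so \<open>f x\<close> may be subtracted under the integral; what
  remains vanishes to first order at \<open>x\<close>.\<close>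

lemma conv_Lipschitz_approx:
  assumes t: "t > 0" and L: "\<And>x y. \<bar>f x - f y\<bar> \<le> L * \<bar>x - y\<bar>"
  shows "\<bar>conv 0 t f x - f x\<bar> \<le> L * Gnorm 1 0 * qroot t"
proof -
  have f: "lingrowth f" using L by (rule lingrowth_Lipschitz)
  have "\<bar>conv 0 t (\<lambda>y. f y - f x) x\<bar> \<le> L * Gnorm 1 0 * qroot t ^ 1 / qroot t ^ 0"
    by (rule conv_weighted_bound[OF t lingrowth_diff_const[OF f]]) (use L[of "x - _" x] in auto)
  then show ?thesis by (simp add: conv_diff_const[OF t f])
qed

lemma conv_deriv:
  assumes t: "t > 0" and f: "f \<in> borel_measurable borel" "\<And>y. \<bar>f y\<bar> \<le> C"
  shows "(conv j t f has_real_derivative conv (Suc j) t f x) (at x)"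
proof -
  obtain D where D: "\<And>y. (1 + y\<^sup>2) * \<bar>ker (Suc j) t y\<bar> \<le> D" using ker_decay[OF t] by metis
  note [measurable] = f(1)
  have C: "C \<ge> 0" using f(2)[of 0] by linarith
  have "((\<lambda>x. \<integral>y. ker j t (x - y) * f y \<partial>lborel) has_real_derivative (\<integral>y. ker (Suc j) t (x - y) * f y \<partial>lborel)) (at x)"
  proof (rule has_real_derivative_integral[where d=1 and g="\<lambda>y. (3 * D * C) * (1 / (1 + (x + -1 * y)\<^sup>2))"])
    show "integrable lborel (\<lambda>y. (3 * D * C) * (1 / (1 + (x + -1 * y)\<^sup>2)))"
      by (intro integrable_mult_right lborel_integrable_real_affine[OF integrable_inverse_one_plus_square]) auto
    fix u y assume u: "\<bar>u - x\<bar> < 1"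
    show "((\<lambda>x. ker j t (x - y) * f y) has_real_derivative ker (Suc j) t (u - y) * f y) (at u)"
      by (auto intro!: derivative_eq_intros DERIV_chain2[OF ker_deriv[OF t]])
    have pos: "1 + (x - y)\<^sup>2 > 0" by (simp add: add_pos_nonneg)
    \<comment> \<open>The kernel decays around the moving point \<open>u\<close>, but the majorant
      must be centred at the fixed \<open>x\<close>. As \<open>u\<close> stays within distance 1,
      the weights differ by a factor of at most 3.\<close>
    have "(x - y)\<^sup>2 \<le> 2 * (u - y)\<^sup>2 + 2 * (u - x)\<^sup>2"
      using zero_le_power2[of "(u - y) + (u - x)"] by (simp add: power2_eq_square algebra_simps)
    moreover have "(u - x)\<^sup>2 \<le> 1" using u by (simp add: abs_square_le_1)
    moreover have "a \<le> 2 * b + 2 * c \<Longrightarrow> c \<le> 1 \<Longrightarrow> 0 \<le> b \<Longrightarrow> 1 + a \<le> 3 * (1 + b)" for a b c :: real by simp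
    ultimately have "1 + (x - y)\<^sup>2 \<le> 3 * (1 + (u - y)\<^sup>2)" using zero_le_power2[of "u - y"] by blast
    then have "(1 + (x - y)\<^sup>2) * \<bar>ker (Suc j) t (u - y)\<bar> \<le> 3 * (1 + (u - y)\<^sup>2) * \<bar>ker (Suc j) t (u - y)\<bar>"
      by (rule mult_right_mono) auto
    also have "\<dots> \<le> 3 * D" using D[of "u - y"] by (simp only: mult.assoc)
    finally have k: "\<bar>ker (Suc j) t (u - y)\<bar> \<le> 3 * D / (1 + (x - y)\<^sup>2)"
      using pos by (simp add: pos_le_divide_eq mult.commute)
    have "\<bar>ker (Suc j) t (u - y)\<bar> * \<bar>f y\<bar> \<le> 3 * D / (1 + (x - y)\<^sup>2) * C"
      by (rule mult_mono[OF k f(2) order_trans[OF abs_ge_zero k]]) simp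
    then show "\<bar>ker (Suc j) t (u - y) * f y\<bar> \<le> (3 * D * C) * (1 / (1 + (x + -1 * y)\<^sup>2))"
      by (simp add: abs_mult)
  qed (use integrable_conv_reflect[OF t lingrowth_bounded[OF f]] in auto)
  then show ?thesis by (simp add: conv_reflect[abs_def])
qed

lemma deriv_biheat:
  assumes "t > 0" "f \<in> borel_measurable borel" "\<And>y. \<bar>f y\<bar> \<le> C"
  shows "deriv (biheat t f) x = conv 1 t f x" "(deriv ^^ 2) (biheat t f) x = conv 2 t f x"
proof -
  have 0: "biheat t f = conv 0 t f"
    using biheat_eq_conv[OF assms(1) lingrowth_bounded[OF assms(2,3)]] by auto
  have 1: "deriv (biheat t f) = conv 1 t f"
    unfolding 0 using conv_deriv[OF assms, of 0] by (auto intro!: DERIV_imp_deriv)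
  then show "deriv (biheat t f) x = conv 1 t f x" by simp
  show "(deriv ^^ 2) (biheat t f) x = conv 2 t f x"
    using conv_deriv[OF assms, of 1 x] by (auto simp: numeral_2_eq_2 1 intro!: DERIV_imp_deriv)
qed

text \<open>Fubini and \<open>ker_semigroup\<close>. The kernel couples the two variables and
  \<open>f\<close> may grow linearly, so a product majorant is not at hand; joint integrability
  comes from a bound on the inner integral that is linear in \<open>y\<close>.\<close>

lemma conv_semigroup:
  assumes h: "h > 0" and t: "t > 0" and f: "lingrowth f"
  shows "conv 0 h (conv j t f) x = conv j (t + h) f x"
proof -
  obtain C where [measurable]: "f \<in> borel_measurable borel" and C: "C \<ge> 0" "\<And>x. \<bar>f x\<bar> \<le> C * (1 + \<bar>x\<bar>)"
    by (rule lingrowthE[OF f]) blast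
  define M where "M = (\<integral>z. \<bar>ker j t z\<bar> * (1 + \<bar>z\<bar>) \<partial>lborel)"
  let ?g = "\<lambda>y w. ker 0 h y * (ker j t (w - y) * f (x - w))"
  have inner: "integrable lborel (\<lambda>w. ker j t (w - y) * f (x - w))"
     "conv j t f (x - y) = (\<integral>w. ker j t (w - y) * f (x - w) \<partial>lborel)" for y
    using lborel_integrable_real_affine[OF integrable_conv[OF t f, of j "x - y"], of 1 "-y"]
      lborel_integral_real_affine[of 1 "\<lambda>z. ker j t z * f (x - y - z)" "-y"]
    by (auto simp: conv_def algebra_simps)
  have bnd: "(\<integral>w. \<bar>ker j t (w - y) * f (x - w)\<bar> \<partial>lborel) \<le> C * (1 + \<bar>x\<bar>) * M * (1 + \<bar>y\<bar>)" for y
  proof -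
    have "(\<integral>w. \<bar>ker j t (w - y) * f (x - w)\<bar> \<partial>lborel)
        \<le> (\<integral>w. (C * (1 + \<bar>x\<bar>) * (1 + \<bar>y\<bar>)) * (\<bar>ker j t (-y + 1 * w)\<bar> * (1 + \<bar>-y + 1 * w\<bar>)) \<partial>lborel)"
    proof (rule integral_mono[OF integrable_abs[OF inner(1)]])
      show "integrable lborel (\<lambda>w. (C * (1 + \<bar>x\<bar>) * (1 + \<bar>y\<bar>)) * (\<bar>ker j t (-y + 1 * w)\<bar> * (1 + \<bar>-y + 1 * w\<bar>)))"
        by (intro integrable_mult_right lborel_integrable_real_affine[OF integrable_ker_lin[OF t]]) auto
      fix w
      \<comment> \<open>The growth of \<open>f\<close> is distributed over factors in
        \<open>y\<close> and \<open>w - y\<close>, each of which one of the two kernels can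
        absorb.\<close>
      have "1 + \<bar>x - w\<bar> \<le> 1 + \<bar>x\<bar> + \<bar>y\<bar> + \<bar>w - y\<bar>" by linarith
      also have "\<dots> \<le> (1 + \<bar>x\<bar>) * (1 + \<bar>y\<bar>) * (1 + \<bar>w - y\<bar>)"
        by (simp add: algebra_simps)
      finally have "C * (1 + \<bar>x - w\<bar>) \<le> C * ((1 + \<bar>x\<bar>) * (1 + \<bar>y\<bar>) * (1 + \<bar>w - y\<bar>))"
        using C(1) by (rule mult_left_mono)
      with C(2)[of "x - w"] have "\<bar>f (x - w)\<bar> \<le> C * ((1 + \<bar>x\<bar>) * (1 + \<bar>y\<bar>) * (1 + \<bar>w - y\<bar>))" by linarith
      from mult_left_mono[OF this, of "\<bar>ker j t (w - y)\<bar>"]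
      show "\<bar>ker j t (w - y) * f (x - w)\<bar> \<le> (C * (1 + \<bar>x\<bar>) * (1 + \<bar>y\<bar>)) * (\<bar>ker j t (-y + 1 * w)\<bar> * (1 + \<bar>-y + 1 * w\<bar>))"
        by (simp add: abs_mult mult_ac)
    qed
    also have "\<dots> = C * (1 + \<bar>x\<bar>) * M * (1 + \<bar>y\<bar>)"
      using lborel_integral_real_affine[of 1 "\<lambda>z. \<bar>ker j t z\<bar> * (1 + \<bar>z\<bar>)" "-y"] by (simp add: M_def)
    finally show ?thesis .
  qed
  have "integrable (lborel \<Otimes>\<^sub>M lborel) (case_prod ?g)"
  proof (rule lborel_pair.Fubini_integrable)
    show "case_prod ?g \<in> borel_measurable (lborel \<Otimes>\<^sub>M lborel)" by measurable
    show "AE y in lborel. integrable lborel (\<lambda>w. case (y, w) of (y, w) \<Rightarrow> ?g y w)"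
      using inner(1) by simp
    show "integrable lborel (\<lambda>y. \<integral>w. norm (case (y, w) of (y, w) \<Rightarrow> ?g y w) \<partial>lborel)"
    proof (rule Bochner_Integration.integrable_bound)
      show "integrable lborel (\<lambda>y. (C * (1 + \<bar>x\<bar>) * M) * (\<bar>ker 0 h y\<bar> * (1 + \<bar>y\<bar>)))"
        by (intro integrable_mult_right integrable_ker_lin h)
      show "AE y in lborel. norm (\<integral>w. norm (case (y, w) of (y, w) \<Rightarrow> ?g y w) \<partial>lborel)
          \<le> norm ((C * (1 + \<bar>x\<bar>) * M) * (\<bar>ker 0 h y\<bar> * (1 + \<bar>y\<bar>)))"
      proof (intro AE_I2)
        fix y
        have "norm (\<integral>w. norm (case (y, w) of (y, w) \<Rightarrow> ?g y w) \<partial>lborel) = (\<integral>w. norm (?g y w) \<partial>lborel)"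
          by simp
        also have "\<dots> = \<bar>ker 0 h y\<bar> * (\<integral>w. \<bar>ker j t (w - y) * f (x - w)\<bar> \<partial>lborel)"
          by (simp only: real_norm_def abs_mult[of "ker 0 h y"] integral_mult_right_zero)
        also have "\<dots> \<le> \<bar>ker 0 h y\<bar> * (C * (1 + \<bar>x\<bar>) * M * (1 + \<bar>y\<bar>))"
          by (intro mult_left_mono bnd) auto
        also have "\<dots> \<le> norm ((C * (1 + \<bar>x\<bar>) * M) * (\<bar>ker 0 h y\<bar> * (1 + \<bar>y\<bar>)))"
          by (simp only: real_norm_def) (rule order_trans[OF _ abs_ge_self], simp add: mult_ac)
        finally show "norm (\<integral>w. norm (case (y, w) of (y, w) \<Rightarrow> ?g y w) \<partial>lborel)
          \<le> norm ((C * (1 + \<bar>x\<bar>) * M) * (\<bar>ker 0 h y\<bar> * (1 + \<bar>y\<bar>)))" .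
      qed
    qed measurable
  qed
  note F = lborel_pair.Fubini_integral[OF this]
  have "conv 0 h (conv j t f) x = (\<integral>y. \<integral>w. ?g y w \<partial>lborel \<partial>lborel)"
    by (simp only: conv_def[of 0 h] inner(2) integral_mult_right_zero)
  also have "\<dots> = (\<integral>w. \<integral>y. ?g y w \<partial>lborel \<partial>lborel)" using F by simp
  also have "\<dots> = (\<integral>w. (\<integral>y. ker 0 h y * ker j t (w - y) \<partial>lborel) * f (x - w) \<partial>lborel)"
    by (simp only: mult.assoc[symmetric] integral_mult_left_zero)
  also have "\<dots> = conv j (t + h) f x" by (simp only: ker_semigroup[OF h t] conv_def)
  finally show ?thesis .
qed

lemma conv_scaling:
  assumes \<sigma>: "\<sigma> > 0" and t: "t > 0"
  shows "conv j (\<sigma> * t) f (qroot \<sigma> * x) = conv j t (\<lambda>y. f (qroot \<sigma> * y)) x / qroot \<sigma> ^ j"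
  using \<sigma> t by (simp add: conv_scaled qroot_mult power_mult_distrib right_diff_distrib mult.assoc)

section \<open>Duhamel integrals\<close>

text \<open>The integrand of the Beta function at (1 - j/4, 1/2): the singularity of j kernel
  derivatives at the final time times the size of the source at the initial time.\<close>

definition beta_weight :: "nat \<Rightarrow> real \<Rightarrow> real" where
  "beta_weight j r = (1 - r) powr (-(real j / 4)) * r powr (-1/2)"

definition beta_mass :: "nat \<Rightarrow> real" where
  "beta_mass j = (LINT r:{0<..<1}|lborel. beta_weight j r)"

lemma set_integrable_beta_weight:
  assumes "j < 4" shows "set_integrable lborel {0<..<1} (beta_weight j)"
proof -
  have "((\<lambda>t. t powr (1/2 - 1) * (1 - t) powr ((1 - real j / 4) - 1)) has_integral Beta (1/2) (1 - real j / 4)) {0..1}"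
    using assms by (intro has_integral_Beta_real) auto
  then have "beta_weight j integrable_on {0..1}"
    by (auto simp: beta_weight_def[abs_def] integrable_on_def mult.commute)
  then have "beta_weight j integrable_on {0<..<1}"
    using integrable_on_Icc_iff_Ioo by blast
  \<comment> \<open>The Beta integral is known in the gauge sense; nonnegativity upgrades it to
    Lebesgue integrability.\<close>
  then have "beta_weight j absolutely_integrable_on {0<..<1}"
    by (rule nonnegative_absolutely_integrable_1) (auto simp: beta_weight_def)
  then have "integrable lebesgue (\<lambda>r. indicator {0<..<1} r *\<^sub>R beta_weight j r)"
    by (simp add: set_integrable_def)
  moreover have [measurable]: "beta_weight j \<in> borel_measurable borel"
    unfolding beta_weight_def[abs_def] by measurable
  ultimately show ?thesis
    by (simp add: set_integrable_def integrable_completion)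
qed

text \<open>The affine map from (0,1) to (a,b). The exponent \<open>1/2 - j/4\<close> collects 1
  from the differential, \<open>-j/4\<close> from the kernel and \<open>-1/2\<close> from the
  source.\<close>

lemma
  assumes ab: "a < b" and j: "j < 4"
  shows set_integrable_weight: "set_integrable lborel {a<..<b} (\<lambda>s. (b - s) powr (-(real j / 4)) * (s - a) powr (-1/2))" (is ?A)
    and set_integral_weight: "(LINT s:{a<..<b}|lborel. (b - s) powr (-(real j / 4)) * (s - a) powr (-1/2))
      = (b - a) powr (1/2 - real j / 4) * beta_mass j" (is ?B)
proof -
  let ?f = "\<lambda>s. indicator {a<..<b} s *\<^sub>R ((b - s) powr (-(real j / 4)) * (s - a) powr (-1/2))"
  let ?g = "\<lambda>r. (b - a) powr (-(real j / 4) - 1/2) * (indicator {0<..<1} r *\<^sub>R beta_weight j r)"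
  have fg: "?f (a + (b - a) * r) = ?g r" for r
  proof (cases "r \<in> {0<..<1}")
    case True
    have "(b - a) * r < (b - a) * 1" "0 < (b - a) * r"
      using True ab by (auto intro: mult_strict_left_mono)
    then have "a + (b - a) * r \<in> {a<..<b}" by auto
    moreover have "b - (a + (b - a) * r) = (b - a) * (1 - r)" by (simp add: algebra_simps)
    moreover have "((b - a) * (1 - r)) powr (-(real j / 4)) * ((b - a) * r) powr (-1/2)
        = (b - a) powr (-(real j / 4) - 1/2) * beta_weight j r"
    proof -
      have "((b - a) * (1 - r)) powr (-(real j / 4)) = (b - a) powr (-(real j / 4)) * (1 - r) powr (-(real j / 4))"
        "((b - a) * r) powr (-1/2) = (b - a) powr (-1/2) * r powr (-1/2)"
        using True ab by (auto intro!: powr_mult)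
      moreover have "(b - a) powr (-(real j / 4) - 1/2) = (b - a) powr (-(real j / 4)) * (b - a) powr (-1/2)"
        by (subst powr_add[symmetric]) simp
      ultimately show ?thesis by (simp only: beta_weight_def mult_ac)
    qed
    ultimately show ?thesis using True by simp
  next
    case False
    have "a + (b - a) * r \<notin> {a<..<b}"
    proof
      assume "a + (b - a) * r \<in> {a<..<b}"
      then have "0 < (b - a) * r" "(b - a) * r < b - a"
        unfolding greaterThanLessThan_iff by linarith+
      moreover have "r \<ge> 1 \<Longrightarrow> b - a \<le> (b - a) * r" using mult_left_mono[of 1 r "b - a"] ab by simp
      moreover have "r \<le> 0 \<Longrightarrow> (b - a) * r \<le> 0" using ab by (simp add: mult_nonneg_nonpos)
      ultimately show False using False by fastforce
    qed
    with False show ?thesis by simp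
  qed
  have i: "integrable lborel ?g"
    using set_integrable_beta_weight[OF j] by (simp add: set_integrable_def)
  have "integrable lborel (\<lambda>r. ?f (a + (b - a) * r))" unfolding fg by (rule i)
  then show ?A using ab lborel_integrable_real_affine_iff[of "b - a" ?f a] by (simp add: set_integrable_def)
  have "(\<integral>s. ?f s \<partial>lborel) = \<bar>b - a\<bar> *\<^sub>R (\<integral>r. ?f (a + (b - a) * r) \<partial>lborel)"
    by (rule lborel_integral_real_affine) (use ab in auto)
  also have "\<dots> = (b - a) * ((b - a) powr (-(real j / 4) - 1/2) * beta_mass j)"
    unfolding fg using ab by (simp add: beta_mass_def set_lebesgue_integral_def)
  also have "\<dots> = ((b - a) powr 1 * (b - a) powr (-(real j / 4) - 1/2)) * beta_mass j"
    using ab by simp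
  also have "(b - a) powr 1 * (b - a) powr (-(real j / 4) - 1/2) = (b - a) powr (1/2 - real j / 4)"
    by (subst powr_add[symmetric]) simp
  finally show ?B by (simp add: set_lebesgue_integral_def)
qed

text \<open>Abstracts the nonlinearity \<open>Nl v\<close> to its continuity for positive times and
  its \<open>s^(-1/2)\<close> bound.\<close>

locale duhamel =
  fixes N :: "real \<Rightarrow> real \<Rightarrow> real" and C :: real
  assumes cont: "continuous_on (UNIV \<times> {0<..}) (\<lambda>p. N (fst p) (snd p))"
    and bound: "\<And>y s. s > 0 \<Longrightarrow> \<bar>N y s\<bar> \<le> C * s powr (-1/2)"
begin

lemma C_nonneg: "C \<ge> 0"
  using bound[of 1 0] by (simp add: order_trans[OF abs_ge_zero])

text \<open>The contribution at time \<open>b\<close> of the source active during (a,b). The open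
  interval keeps the two singular endpoints out.\<close>

definition duh :: "nat \<Rightarrow> real \<Rightarrow> real \<Rightarrow> real \<Rightarrow> real" where
  "duh j a b x = (LINT s:{a<..<b}|lborel. conv j (b - s) (\<lambda>y. N y s) x)"

text \<open>Continuity is known only for positive times, so the source is cut off to 0 elsewhere to
  obtain a globally Borel function.\<close>

lemma borel_measurable_source [measurable (raw)]:
  assumes [measurable]: "f \<in> borel_measurable M" "g \<in> borel_measurable M"
  shows "(\<lambda>x. if g x > 0 then N (f x) (g x) else 0) \<in> borel_measurable M"
proof -
  have "(\<lambda>p. if p \<in> UNIV \<times> {0<..} then N (fst p) (snd p) else 0) \<in> borel_measurable borel"
  proof -
    have "UNIV \<times> {0<..} \<in> sets (borel :: (real \<times> real) measure)"
      by (intro borel_open open_Times) auto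
    from borel_measurable_continuous_on_indicator[OF this cont]
    have "(\<lambda>p. indicator (UNIV \<times> {0<..}) p *\<^sub>R N (fst p) (snd p)) \<in> borel_measurable borel" .
    also have "(\<lambda>p. indicator (UNIV \<times> {0<..}) p *\<^sub>R N (fst p) (snd p))
        = (\<lambda>p. if p \<in> UNIV \<times> {0<..} then N (fst p) (snd p) else 0)"
      by (auto simp: indicator_def)
    finally show ?thesis .
  qed
  note meas = this
  have "(\<lambda>x. (f x, g x)) \<in> measurable M (borel :: (real \<times> real) measure)"
    unfolding borel_prod[symmetric] by measurable
  from measurable_compose[OF this meas] show ?thesis by (simp cong: if_cong)
qed

lemma source_measurable: "s > 0 \<Longrightarrow> (\<lambda>y. N y s) \<in> borel_measurable borel"
  using borel_measurable_source[of "\<lambda>y. y" borel "\<lambda>_. s"] by simp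

lemma borel_measurable_conv_source [measurable (raw)]:
  assumes [measurable]: "f \<in> borel_measurable M" "g \<in> borel_measurable M" "r \<in> borel_measurable M"
  shows "(\<lambda>x. indicator {0<..} (g x) * conv j (r x) (\<lambda>y. N y (g x)) (f x)) \<in> borel_measurable M"
proof -
  have "(\<lambda>x. \<integral>y. ker j (r x) y * (if g x > 0 then N (f x - y) (g x) else 0) \<partial>lborel) \<in> borel_measurable M"
    by measurable
  also have "(\<lambda>x. \<integral>y. ker j (r x) y * (if g x > 0 then N (f x - y) (g x) else 0) \<partial>lborel)
      = (\<lambda>x. indicator {0<..} (g x) * conv j (r x) (\<lambda>y. N y (g x)) (f x))"
    by (auto simp: conv_def indicator_def)
  finally show ?thesis .
qed

lemma conv_source_bound:
  assumes "0 < s" "s < b"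
  shows "\<bar>conv j (b - s) (\<lambda>y. N y s) x\<bar> \<le> C * Gnorm 0 j * ((b - s) powr (-(real j / 4)) * s powr (-1/2))"
proof -
  have "\<bar>conv j (b - s) (\<lambda>y. N y s) x\<bar> \<le> (C * s powr (-1/2)) * Gnorm 0 j / qroot (b - s) ^ j"
    using assms by (intro conv_bound source_measurable bound) auto
  also have "\<dots> = C * Gnorm 0 j * ((b - s) powr (-(real j / 4)) * s powr (-1/2))"
    using assms by (simp add: qroot_power powr_minus field_simps)
  finally show ?thesis .
qed

text \<open>Enlarging \<open>s^(-1/2)\<close> to \<open>(s - a)^(-1/2)\<close> gives bounds that
  depend only on the length of (a,b). This is what makes the time modulus of \<open>U\<close>
  uniform down to time 0.\<close>

lemma conv_source_bound':
  assumes "0 \<le> a" "a < s" "s < b"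
  shows "\<bar>conv j (b - s) (\<lambda>y. N y s) x\<bar> \<le> C * Gnorm 0 j * ((b - s) powr (-(real j / 4)) * (s - a) powr (-1/2))"
proof -
  have "s powr (-1/2) \<le> (s - a) powr (-1/2)" using assms by (intro powr_mono2') auto
  then have "C * Gnorm 0 j * ((b - s) powr (-(real j / 4)) * s powr (-1/2))
      \<le> C * Gnorm 0 j * ((b - s) powr (-(real j / 4)) * (s - a) powr (-1/2))"
    by (intro mult_left_mono) (auto simp: C_nonneg Gnorm_nonneg)
  moreover have "\<bar>conv j (b - s) (\<lambda>y. N y s) x\<bar> \<le> C * Gnorm 0 j * ((b - s) powr (-(real j / 4)) * s powr (-1/2))"
    using assms by (intro conv_source_bound) auto
  ultimately show ?thesis by linarith
qed

lemma measurable_conv_source_indicator: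
  assumes "0 \<le> a"
  shows "(\<lambda>s. indicator {a<..<b} s *\<^sub>R conv j (b' - s) (\<lambda>y. N y s) x) \<in> borel_measurable borel"
proof -
  have "(\<lambda>s. indicator {a<..<b} s * (indicator {0<..} s * conv j (b' - s) (\<lambda>y. N y s) x)) \<in> borel_measurable borel"
    by measurable
  also have "(\<lambda>s. indicator {a<..<b} s * (indicator {0<..} s * conv j (b' - s) (\<lambda>y. N y s) x))
     = (\<lambda>s. indicator {a<..<b} s *\<^sub>R conv j (b' - s) (\<lambda>y. N y s) x)"
    using assms by (auto simp: indicator_def)
  finally show ?thesis .
qed

lemma
  assumes a: "0 \<le> a" "a < b" and j: "j < 4"
  shows set_integrable_conv_source: "set_integrable lborel {a<..<b} (\<lambda>s. conv j (b - s) (\<lambda>y. N y s) x)"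
    and duh_bound: "\<bar>duh j a b x\<bar> \<le> C * Gnorm 0 j * beta_mass j * (b - a) powr (1/2 - real j / 4)"
proof -
  let ?w = "\<lambda>s. C * Gnorm 0 j * (indicator {a<..<b} s *\<^sub>R ((b - s) powr (-(real j / 4)) * (s - a) powr (-1/2)))"
  have w: "integrable lborel ?w"
    using set_integrable_weight[OF a(2) j] by (simp add: set_integrable_def)
  have le: "norm (indicator {a<..<b} s *\<^sub>R conv j (b - s) (\<lambda>y. N y s) x) \<le> ?w s" for s
    using conv_source_bound'[OF a(1), of s b j x] by (auto simp: indicator_def)
  show si: "set_integrable lborel {a<..<b} (\<lambda>s. conv j (b - s) (\<lambda>y. N y s) x)"
    unfolding set_integrable_def
    by (rule Bochner_Integration.integrable_bound[OF w])
       (use measurable_conv_source_indicator[OF a(1), of b j b x] order_trans[OF le abs_ge_self] in auto)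
  have "norm (duh j a b x) \<le> (\<integral>s. ?w s \<partial>lborel)"
    unfolding duh_def set_lebesgue_integral_def
    by (rule Bochner_Integration.integral_norm_bound_integral[OF si[unfolded set_integrable_def] w le])
  also have "\<dots> = C * Gnorm 0 j * ((b - a) powr (1/2 - real j / 4) * beta_mass j)"
    unfolding integral_mult_right_zero using set_integral_weight[OF a(2) j]
    by (simp add: set_lebesgue_integral_def)
  finally show "\<bar>duh j a b x\<bar> \<le> C * Gnorm 0 j * beta_mass j * (b - a) powr (1/2 - real j / 4)"
    by (simp add: mult_ac)
qed

text \<open>The second kernel derivative costs only \<open>(t - s)^(-1/2)\<close>, so the majorant
  is a Beta weight independent of \<open>x\<close>.\<close>

lemma duh_deriv:
  assumes t: "t > 0"
  shows "(duh 1 0 t has_real_derivative duh 2 0 t x) (at x)"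
  unfolding duh_def set_lebesgue_integral_def
proof (rule has_real_derivative_integral[where d=1
      and g="\<lambda>s. C * Gnorm 0 2 * (indicator {0<..<t} s *\<^sub>R ((t - s) powr (-(real 2 / 4)) * (s - 0) powr (-1/2)))"])
  show "integrable lborel (\<lambda>s. C * Gnorm 0 2 * (indicator {0<..<t} s *\<^sub>R ((t - s) powr (-(real 2 / 4)) * (s - 0) powr (-1/2))))"
    by (rule integrable_mult_right) (use set_integrable_weight[OF t, of 2] in \<open>simp add: set_integrable_def\<close>)
  show "integrable lborel (\<lambda>s. indicator {0<..<t} s *\<^sub>R conv 1 (t - s) (\<lambda>y. N y s) x)" for x
    using set_integrable_conv_source[of 0 t 1 x] t by (simp add: set_integrable_def)
  show "(\<lambda>s. indicator {0<..<t} s *\<^sub>R conv 2 (t - s) (\<lambda>y. N y s) x) \<in> borel_measurable lborel"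
    using measurable_conv_source_indicator[of 0 t 2 t x] by simp
  fix x s
  show "\<bar>indicator {0<..<t} s *\<^sub>R conv 2 (t - s) (\<lambda>y. N y s) x\<bar>
      \<le> C * Gnorm 0 2 * (indicator {0<..<t} s *\<^sub>R ((t - s) powr (-(real 2 / 4)) * (s - 0) powr (-1/2)))"
    using conv_source_bound'[of 0 s t 2 x] by (auto simp: indicator_def)
  show "((\<lambda>x. indicator {0<..<t} s *\<^sub>R conv 1 (t - s) (\<lambda>y. N y s) x) has_real_derivative
      indicator {0<..<t} s *\<^sub>R conv 2 (t - s) (\<lambda>y. N y s) x) (at x)"
  proof (cases "s \<in> {0<..<t}")
    case True
    then show ?thesis
      using conv_deriv[of "t - s" "\<lambda>y. N y s" "C * s powr (-1/2)" 1 x] source_measurable[of s] bound[of s]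
      by (simp add: numeral_2_eq_2)
  qed simp
qed simp

lemma duh_split:
  assumes t: "t > 0" and h: "h > 0" and j: "j < 4"
  shows "duh j 0 (t + h) x = (LINT s:{0<..<t}|lborel. conv j (t + h - s) (\<lambda>y. N y s) x) + duh j t (t + h) x"
proof -
  let ?f = "\<lambda>s. conv j (t + h - s) (\<lambda>y. N y s) x"
  have i: "set_integrable lborel {0<..<t + h} ?f"
    by (rule set_integrable_conv_source) (use t h j in auto)
  have 1: "set_integrable lborel {0<..<t} ?f"
    by (rule set_integrable_subset[OF i]) (use h in auto)
  have 2: "set_integrable lborel {t<..<t + h} ?f"
    by (rule set_integrable_subset[OF i]) (use t in auto)
  \<comment> \<open>The open intervals (0,t) and (t,t+h) miss only the null set
    \<open>{t}\<close>.\<close>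
  have "AE s in lborel. s \<noteq> t" by (rule AE_lborel_singleton)
  then have "AE s in lborel. indicator {0<..<t + h} s *\<^sub>R ?f s = indicator {0<..<t} s *\<^sub>R ?f s + indicator {t<..<t + h} s *\<^sub>R ?f s"
    by eventually_elim (use t h in \<open>auto simp: indicator_def\<close>)
  then have "(\<integral>s. indicator {0<..<t + h} s *\<^sub>R ?f s \<partial>lborel) = (\<integral>s. indicator {0<..<t} s *\<^sub>R ?f s + indicator {t<..<t + h} s *\<^sub>R ?f s \<partial>lborel)"
    using i 1 2 by (intro integral_cong_AE) (auto simp: set_integrable_def)
  also have "\<dots> = (\<integral>s. indicator {0<..<t} s *\<^sub>R ?f s \<partial>lborel) + (\<integral>s. indicator {t<..<t + h} s *\<^sub>R ?f s \<partial>lborel)"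
    using 1 2 by (intro Bochner_Integration.integral_add) (auto simp: set_integrable_def)
  finally show "duh j 0 (t + h) x = (LINT s:{0<..<t}|lborel. ?f s) + duh j t (t + h) x"
    by (simp add: duh_def set_lebesgue_integral_def)
qed

text \<open>Fubini carries the flow over time \<open>h\<close> inside the time integral, where the
  semigroup law advances each kernel from \<open>t - s\<close> to \<open>t + h - s\<close>; the
  source on (t, t+h) remains as a separate term.\<close>

lemma duh_restart:
  assumes t: "t > 0" and h: "h > 0"
  shows "duh 1 0 (t + h) x = conv 0 h (duh 1 0 t) x + duh 1 t (t + h) x"
proof -
  let ?w = "\<lambda>s. C * Gnorm 0 1 * (indicator {0<..<t} s *\<^sub>R ((t - s) powr (-(real 1 / 4)) * (s - 0) powr (-1/2)))"
  have w: "integrable lborel ?w"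
    by (rule integrable_mult_right) (use set_integrable_weight[OF t, of 1] in \<open>simp add: set_integrable_def\<close>)
  let ?F = "\<lambda>y s. ker 0 h y * (indicator {0<..<t} s *\<^sub>R conv 1 (t - s) (\<lambda>z. N z s) (x - y))"
  have meas: "case_prod ?F \<in> borel_measurable (borel \<Otimes>\<^sub>M borel)"
  proof -
    have "(\<lambda>p. ker 0 h (fst p) * (indicator {0<..<t} (snd p) * (indicator {0<..} (snd p) * conv 1 (t - snd p) (\<lambda>z. N z (snd p)) (x - fst p))))
        \<in> borel_measurable (borel \<Otimes>\<^sub>M borel)" by measurable
    also have "(\<lambda>p. ker 0 h (fst p) * (indicator {0<..<t} (snd p) * (indicator {0<..} (snd p) * conv 1 (t - snd p) (\<lambda>z. N z (snd p)) (x - fst p))))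
        = case_prod ?F"
      by (auto simp: indicator_def fun_eq_iff)
    finally show ?thesis .
  qed
  have "conv 0 h (duh 1 0 t) x = (\<integral>y. \<integral>s. ?F y s \<partial>lborel \<partial>lborel)"
    by (simp only: conv_def[of 0 h] duh_def set_lebesgue_integral_def integral_mult_right_zero)
  also have "\<dots> = (\<integral>s. \<integral>y. ?F y s \<partial>lborel \<partial>lborel)"
  proof (rule Fubini_dominated[OF integrable_ker[OF h, of 0] w meas])
    fix y s
    have "\<bar>indicator {0<..<t} s *\<^sub>R conv 1 (t - s) (\<lambda>z. N z s) (x - y)\<bar> \<le> ?w s"
      using conv_source_bound'[of 0 s t 1 "x - y"] by (auto simp: indicator_def)
    also have "\<dots> \<le> \<bar>?w s\<bar>" by (rule abs_ge_self)
    finally show "\<bar>?F y s\<bar> \<le> \<bar>ker 0 h y\<bar> * \<bar>?w s\<bar>"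
      unfolding abs_mult[of "ker 0 h y"] by (rule mult_left_mono) simp
  qed
  also have "\<dots> = (\<integral>s. indicator {0<..<t} s *\<^sub>R conv 1 (t + h - s) (\<lambda>z. N z s) x \<partial>lborel)"
  proof (intro Bochner_Integration.integral_cong refl)
    fix s
    show "(\<integral>y. ?F y s \<partial>lborel) = indicator {0<..<t} s *\<^sub>R conv 1 (t + h - s) (\<lambda>z. N z s) x"
    proof (cases "s \<in> {0<..<t}")
      case True
      then have "lingrowth (\<lambda>z. N z s)"
        by (intro lingrowth_bounded[of _ "C * s powr (-1/2)"] source_measurable bound) auto
      with True have "conv 0 h (conv 1 (t - s) (\<lambda>z. N z s)) x = conv 1 (t - s + h) (\<lambda>z. N z s) x"
        by (intro conv_semigroup h) auto
      moreover have "t - s + h = t + h - s" by simp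
      ultimately show ?thesis using True by (simp add: conv_def[of 0 h])
    qed simp
  qed
  finally show ?thesis
    using duh_split[OF t h, of 1 x] by (simp add: set_lebesgue_integral_def)
qed

text \<open>Power count with \<open>s = sigma r\<close>: \<open>sigma\<close> from the differential,
  \<open>sigma^(-1/4)\<close> from the kernel derivative and \<open>sigma^(-1/2)\<close> from the
  source leave \<open>sigma^(1/4)\<close>.\<close>

lemma duh_scaling:
  assumes \<sigma>: "\<sigma> > 0" and t: "t > 0"
    and N: "\<And>y s. s > 0 \<Longrightarrow> N (qroot \<sigma> * y) (\<sigma> * s) = N y s / (qroot \<sigma>)\<^sup>2"
  shows "duh 1 0 (\<sigma> * t) (qroot \<sigma> * x) = qroot \<sigma> * duh 1 0 t x"
proof -
  note q = qroot_pos[OF \<sigma>]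
  let ?f = "\<lambda>s. indicator {0<..<\<sigma> * t} s *\<^sub>R conv 1 (\<sigma> * t - s) (\<lambda>y. N y s) (qroot \<sigma> * x)"
  have "duh 1 0 (\<sigma> * t) (qroot \<sigma> * x) = \<bar>\<sigma>\<bar> *\<^sub>R (\<integral>r. ?f (0 + \<sigma> * r) \<partial>lborel)"
    unfolding duh_def set_lebesgue_integral_def by (rule lborel_integral_real_affine) (use \<sigma> in auto)
  also have "\<dots> = (\<integral>r. \<sigma> * ?f (0 + \<sigma> * r) \<partial>lborel)" using \<sigma> by simp
  also have "\<dots> = (\<integral>r. qroot \<sigma> * (indicator {0<..<t} r *\<^sub>R conv 1 (t - r) (\<lambda>y. N y r) x) \<partial>lborel)"
  proof (intro Bochner_Integration.integral_cong refl)
    fix r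
    show "\<sigma> * ?f (0 + \<sigma> * r) = qroot \<sigma> * (indicator {0<..<t} r *\<^sub>R conv 1 (t - r) (\<lambda>y. N y r) x)"
    proof (cases "r \<in> {0<..<t}")
      case True
      have "conv 1 (\<sigma> * t - \<sigma> * r) (\<lambda>y. N y (\<sigma> * r)) (qroot \<sigma> * x)
          = conv 1 (\<sigma> * (t - r)) (\<lambda>y. N y (\<sigma> * r)) (qroot \<sigma> * x)" by (simp add: algebra_simps)
      also have "\<dots> = conv 1 (t - r) (\<lambda>y. N y r / (qroot \<sigma>)\<^sup>2) x / qroot \<sigma>"
        using True conv_scaling[OF \<sigma>, of "t - r" 1 "\<lambda>y. N y (\<sigma> * r)" x] by (simp add: N)
      also have "\<dots> = conv 1 (t - r) (\<lambda>y. N y r) x / qroot \<sigma> ^ 3"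
        by (simp add: conv_def power3_eq_cube power2_eq_square)
      finally have "conv 1 (\<sigma> * t - \<sigma> * r) (\<lambda>y. N y (\<sigma> * r)) (qroot \<sigma> * x) = conv 1 (t - r) (\<lambda>y. N y r) x / qroot \<sigma> ^ 3" .
      moreover have "\<sigma> / qroot \<sigma> ^ 3 = qroot \<sigma>"
        using q qroot_power4[OF \<sigma>] by (simp add: field_simps power3_eq_cube power4_eq_xxxx)
      moreover have "\<sigma> * (c / qroot \<sigma> ^ 3) = \<sigma> / qroot \<sigma> ^ 3 * c" for c by simp
      ultimately show ?thesis using True \<sigma> by simp
    next
      case False
      then show ?thesis using \<sigma> by (auto simp: indicator_def zero_less_mult_iff)
    qed
  qed
  also have "\<dots> = qroot \<sigma> * duh 1 0 t x" by (simp add: duh_def set_lebesgue_integral_def)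
  finally show ?thesis .
qed

end

section \<open>Smoothness and Taylor expansions\<close>

lemma Ck_imp_continuous_on: "Ck k S f \<Longrightarrow> continuous_on S f"
  by (cases k) auto

lemma Ck_SucI:
  assumes "continuous_on S f"
    and "\<And>p. p \<in> S \<Longrightarrow> (f has_derivative (\<lambda>h. fst h * f1 p + snd h * f2 p)) (at p)"
    and "Ck k S f1" "Ck k S f2"
  shows "Ck (Suc k) S f"
  unfolding Ck.simps using assms by blast

lemma Ck_Suc_imp_Ck: "Ck (Suc k) S f \<Longrightarrow> Ck k S f"
proof (induction k arbitrary: f)
  case (Suc k)
  from Suc.prems obtain f1 f2 where
    "continuous_on S f" "\<forall>p\<in>S. (f has_derivative (\<lambda>h. fst h * f1 p + snd h * f2 p)) (at p)"
    "Ck (Suc k) S f1" "Ck (Suc k) S f2"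
    using Ck.simps(2)[of "Suc k" S f] by blast
  with Suc.IH[of f1] Suc.IH[of f2] show ?case by auto
qed simp

text \<open>Openness matters: \<open>Ck\<close> uses full derivatives \<open>at p\<close>, which see
  values of the function near \<open>p\<close>.\<close>

lemma Ck_cong:
  assumes "open S" "\<And>p. p \<in> S \<Longrightarrow> f p = g p" "Ck k S f"
  shows "Ck k S g"
proof (cases k)
  case 0
  then show ?thesis using assms by (simp cong: continuous_on_cong)
next
  case (Suc m)
  then obtain f1 f2 where f: "continuous_on S f"
    "\<forall>p\<in>S. (f has_derivative (\<lambda>h. fst h * f1 p + snd h * f2 p)) (at p)" "Ck m S f1" "Ck m S f2"
    using assms(3) by auto
  have "(g has_derivative (\<lambda>h. fst h * f1 p + snd h * f2 p)) (at p)" if "p \<in> S" for p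
    using f(2) that assms by (intro has_derivative_transform_within_open[of f _ p UNIV S g]) auto
  moreover have "continuous_on S g" using f(1) assms(2) by (simp cong: continuous_on_cong)
  ultimately show ?thesis unfolding Suc using f(3,4) by (intro Ck_SucI)
qed

lemma Ck_const: "Ck k S (\<lambda>_. c)"
proof (induction k arbitrary: c)
  case (Suc k)
  show ?case by (rule Ck_SucI[where ?f1.0="\<lambda>_. 0" and ?f2.0="\<lambda>_. 0"]) (use Suc in auto)
qed simp

lemma Ck_add: "Ck k S f \<Longrightarrow> Ck k S g \<Longrightarrow> Ck k S (\<lambda>p. f p + g p)"
proof (induction k arbitrary: f g)
  case 0 then show ?case by (simp add: continuous_on_add)
next
  case (Suc k)
  from Suc.prems(1) obtain f1 f2 where f: "continuous_on S f"
    "\<forall>p\<in>S. (f has_derivative (\<lambda>h. fst h * f1 p + snd h * f2 p)) (at p)" "Ck k S f1" "Ck k S f2" by auto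
  from Suc.prems(2) obtain g1 g2 where g: "continuous_on S g"
    "\<forall>p\<in>S. (g has_derivative (\<lambda>h. fst h * g1 p + snd h * g2 p)) (at p)" "Ck k S g1" "Ck k S g2" by auto
  have "((\<lambda>p. f p + g p) has_derivative (\<lambda>h. fst h * (f1 p + g1 p) + snd h * (f2 p + g2 p))) (at p)" if "p \<in> S" for p
    using has_derivative_add[OF f(2)[rule_format, OF that] g(2)[rule_format, OF that]]
    by (simp add: algebra_simps)
  then show ?case
    by (rule Ck_SucI[OF continuous_on_add[OF f(1) g(1)] _ Suc.IH[OF f(3) g(3)] Suc.IH[OF f(4) g(4)]])
qed

lemma Ck_mult: "Ck k S f \<Longrightarrow> Ck k S g \<Longrightarrow> Ck k S (\<lambda>p. f p * g p)"
proof (induction k arbitrary: f g)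
  case 0 then show ?case by (simp add: continuous_on_mult)
next
  case (Suc k)
  from Suc.prems(1) obtain f1 f2 where f: "continuous_on S f"
    "\<forall>p\<in>S. (f has_derivative (\<lambda>h. fst h * f1 p + snd h * f2 p)) (at p)" "Ck k S f1" "Ck k S f2" by auto
  from Suc.prems(2) obtain g1 g2 where g: "continuous_on S g"
    "\<forall>p\<in>S. (g has_derivative (\<lambda>h. fst h * g1 p + snd h * g2 p)) (at p)" "Ck k S g1" "Ck k S g2" by auto
  note fk = Ck_Suc_imp_Ck[OF Suc.prems(1)] and gk = Ck_Suc_imp_Ck[OF Suc.prems(2)]
  have "((\<lambda>p. f p * g p) has_derivative (\<lambda>h. fst h * (f p * g1 p + f1 p * g p) + snd h * (f p * g2 p + f2 p * g p))) (at p)"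
    if "p \<in> S" for p
    using has_derivative_mult[OF f(2)[rule_format, OF that] g(2)[rule_format, OF that]]
    by (simp add: algebra_simps)
  then show ?case
    by (rule Ck_SucI[OF continuous_on_mult[OF f(1) g(1)] _
        Ck_add[OF Suc.IH[OF fk g(3)] Suc.IH[OF f(3) gk]] Ck_add[OF Suc.IH[OF fk g(4)] Suc.IH[OF f(4) gk]]])
qed

lemma Ck_inverse_one_plus_square: "Ck k S f \<Longrightarrow> Ck k S (\<lambda>p. inverse (1 + (f p)\<^sup>2))"
proof (induction k arbitrary: f)
  case 0
  then show ?case by (auto intro!: continuous_intros simp: sum_power2_eq_zero_iff) (smt (verit) zero_le_power2)
next
  case (Suc k)
  from Suc.prems(1) obtain f1 f2 where f: "continuous_on S f"
    "\<forall>p\<in>S. (f has_derivative (\<lambda>h. fst h * f1 p + snd h * f2 p)) (at p)" "Ck k S f1" "Ck k S f2" by auto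
  note fk = Ck_Suc_imp_Ck[OF Suc.prems(1)]
  let ?r = "\<lambda>p. inverse (1 + (f p)\<^sup>2)"
  have nz: "1 + (f p)\<^sup>2 \<noteq> 0" for p by (smt (verit) zero_le_power2)
  have "(?r has_derivative (\<lambda>h. fst h * (-2 * (f p * f1 p * (?r p * ?r p))) + snd h * (-2 * (f p * f2 p * (?r p * ?r p))))) (at p)"
    if "p \<in> S" for p
  proof -
    have "((\<lambda>p. 1 + (f p)\<^sup>2) has_derivative (\<lambda>h. 0 + 2 * (fst h * f1 p + snd h * f2 p) * f p)) (at p)"
      using f(2) that by (auto intro!: derivative_eq_intros)
    from Deriv.has_derivative_inverse[OF nz this] show ?thesis
      by (rule has_derivative_eq_rhs) (simp add: fun_eq_iff algebra_simps)
  qed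
  moreover have "Ck k S (\<lambda>p. -2 * (f p * g p * (?r p * ?r p)))" if "Ck k S g" for g
    by (intro Ck_mult Ck_const fk that Suc.IH)
  moreover have "continuous_on S ?r"
    using f(1) nz by (auto intro!: continuous_intros)
  ultimately show ?case using f(3,4) by (intro Ck_SucI)
qed

lemma smooth2_on_const: "smooth2_on S (\<lambda>_. c)"
  and smooth2_on_add: "smooth2_on S f \<Longrightarrow> smooth2_on S g \<Longrightarrow> smooth2_on S (\<lambda>p. f p + g p)"
  and smooth2_on_mult: "smooth2_on S f \<Longrightarrow> smooth2_on S g \<Longrightarrow> smooth2_on S (\<lambda>p. f p * g p)"
  and smooth2_on_inverse: "smooth2_on S f \<Longrightarrow> smooth2_on S (\<lambda>p. inverse (1 + (f p)\<^sup>2))"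
  and smooth2_on_imp_continuous_on: "smooth2_on S f \<Longrightarrow> continuous_on S f"
  by (auto simp: smooth2_on_def intro: Ck_const Ck_add Ck_mult Ck_inverse_one_plus_square Ck_imp_continuous_on)

definition smooth_half :: "(real \<Rightarrow> real \<Rightarrow> real) \<Rightarrow> bool" where
  "smooth_half u \<longleftrightarrow> smooth2_on (UNIV \<times> {0<..}) (\<lambda>p. u (fst p) (snd p))"

text \<open>\<open>Ck\<close> only asserts that some partial derivatives exist. Restricting to a
  line of constant \<open>t\<close> identifies the first one with \<open>dx u\<close>, so its
  regularity passes to \<open>dx u\<close> at every order.\<close>

lemma smooth_half_dx:
  assumes "smooth_half u"
  shows "t > 0 \<Longrightarrow> ((\<lambda>y. u y t) has_real_derivative dx u x t) (at x)" and "smooth_half (dx u)"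
proof -
  let ?S = "UNIV \<times> {0<..} :: (real \<times> real) set"
  let ?f = "\<lambda>p. u (fst p) (snd p)"
  have op: "open ?S" by (intro open_Times) auto
  have slice: "((\<lambda>y. u y t) has_real_derivative f1 (x, t)) (at x)"
    if "\<forall>p\<in>?S. (?f has_derivative (\<lambda>h. fst h * f1 p + snd h * f2 p)) (at p)" "t > 0" for f1 f2 x t
  proof -
    have "((\<lambda>y. (y, t)) has_derivative (\<lambda>h. (h, 0))) (at x)" by (auto intro!: derivative_eq_intros)
    moreover have "(?f has_derivative (\<lambda>h. fst h * f1 (x, t) + snd h * f2 (x, t))) (at (x, t))"
      using that by auto
    ultimately have "((\<lambda>y. ?f (y, t)) has_derivative (\<lambda>h. fst (h, 0::real) * f1 (x, t) + snd (h, 0) * f2 (x, t))) (at x)"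
      by (rule has_derivative_compose)
    then show ?thesis by (simp add: has_field_derivative_def mult_commute_abs)
  qed
  have main: "(\<forall>x. \<forall>t>0. ((\<lambda>y. u y t) has_real_derivative dx u x t) (at x)) \<and> Ck k ?S (\<lambda>p. dx u (fst p) (snd p))" for k
  proof -
    have "Ck (Suc k) ?S ?f" using assms by (auto simp: smooth_half_def smooth2_on_def)
    then obtain f1 f2 where f: "\<forall>p\<in>?S. (?f has_derivative (\<lambda>h. fst h * f1 p + snd h * f2 p)) (at p)" "Ck k ?S f1"
      by auto
    have eq: "dx u x t = f1 (x, t)" if "t > 0" for x t
      unfolding dx_def using slice[OF f(1) that] by (rule DERIV_imp_deriv)
    then have "Ck k ?S (\<lambda>p. dx u (fst p) (snd p))"
      by (intro Ck_cong[OF op _ f(2)]) auto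
    then show ?thesis using eq slice[OF f(1)] by simp
  qed
  show "smooth_half (dx u)" using main by (simp add: smooth_half_def smooth2_on_def)
  show "t > 0 \<Longrightarrow> ((\<lambda>y. u y t) has_real_derivative dx u x t) (at x)" using main by blast
qed

lemma smooth_half_continuous_on: "smooth_half u \<Longrightarrow> continuous_on (UNIV \<times> {0<..}) (\<lambda>p. u (fst p) (snd p))"
  by (simp add: smooth_half_def smooth2_on_imp_continuous_on)

text \<open>\<open>Nl v\<close> is a polynomial in \<open>v\<close>, its first two x-derivatives and
  \<open>1 / (1 + v^2)\<close>.\<close>

lemma smooth_half_Nl:
  assumes "smooth_half v" shows "smooth_half (Nl v)"
proof -
  note v = assms and v1 = smooth_half_dx(2)[OF assms]
  note v2 = smooth_half_dx(2)[OF v1]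
  let ?r = "\<lambda>p. inverse (1 + (v (fst p) (snd p))\<^sup>2)"
  have "(\<lambda>p. Nl v (fst p) (snd p)) = (\<lambda>p. (1 + (-1) * (?r p * ?r p)) * dx (dx v) (fst p) (snd p)
      + 3 * v (fst p) (snd p) * (dx v (fst p) (snd p) * dx v (fst p) (snd p)) * (?r p * ?r p * ?r p))"
    by (simp add: Nl_def alphaN_def FN_def divide_inverse power2_eq_square power3_eq_cube fun_eq_iff)
  moreover have "smooth2_on (UNIV \<times> {0<..}) \<dots>"
    using v v1 v2 unfolding smooth_half_def
    by (intro smooth2_on_add smooth2_on_mult smooth2_on_const smooth2_on_inverse)
  ultimately show ?thesis by (simp add: smooth_half_def)
qed

text \<open>Integration against the kernel needs a remainder bound for all \<open>y\<close>, but
  \<open>d n\<close> is controlled only near \<open>x\<close>. For \<open>\<bar>y\<bar>\<close> at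
  most 1 this is Taylor's theorem; beyond, linear growth of the increment suffices, because there
  lower powers of \<open>\<bar>y\<bar>\<close> are dominated by the n-th.\<close>

lemma taylor_remainder_global:
  fixes d :: "nat \<Rightarrow> real \<Rightarrow> real"
  assumes n: "n > 0" and der: "\<And>m z. m < n \<Longrightarrow> (d m has_real_derivative d (Suc m) z) (at z)"
    and M: "\<And>z. \<bar>z - x\<bar> \<le> 1 \<Longrightarrow> \<bar>d n z\<bar> \<le> M"
    and L: "\<And>y. \<bar>y\<bar> \<ge> 1 \<Longrightarrow> \<bar>d 0 (x - y) - d 0 x\<bar> \<le> L * \<bar>y\<bar>"
  shows "\<bar>d 0 (x - y) - (\<Sum>m<n. d m x / fact m * (- y) ^ m)\<bar> \<le> (M + L + (\<Sum>m<n. \<bar>d m x\<bar>)) * \<bar>y\<bar> ^ n"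
proof -
  have M0: "M \<ge> 0" using M[of x] by simp
  have L0: "L \<ge> 0" using L[of 1] by simp
  have S0: "(\<Sum>m<n. \<bar>d m x\<bar>) \<ge> 0" by (intro sum_nonneg) auto
  consider "y = 0" | "y \<noteq> 0" "\<bar>y\<bar> \<le> 1" | "\<bar>y\<bar> > 1" by linarith
  then show ?thesis
  proof cases
    case 1
    have "(\<Sum>m<n. d m x / fact m * (0::real) ^ m) = d 0 x"
      using n by (simp add: power_0_left if_distrib sum.delta' cong: if_cong)
    with 1 n show ?thesis by (simp add: power_0_left)
  next
    case 2
    define a where "a = min x (x - y)"
    define b where "b = max x (x - y)"
    have "\<exists>t. (if x - y < x then x - y < t \<and> t < x else x < t \<and> t < x - y) \<and>
       d 0 (x - y) = (\<Sum>m<n. d m x / fact m * ((x - y) - x) ^ m) + d n t / fact n * ((x - y) - x) ^ n"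
      by (rule Taylor[of n d "d 0" a b]) (use n der 2 in \<open>auto simp: a_def b_def\<close>)
    then obtain t where t: "if x - y < x then x - y < t \<and> t < x else x < t \<and> t < x - y"
      and eq: "d 0 (x - y) = (\<Sum>m<n. d m x / fact m * (- y) ^ m) + d n t / fact n * (- y) ^ n" by auto
    have "\<bar>t - x\<bar> \<le> 1" using t 2 by (auto split: if_splits)
    then have "\<bar>d n t\<bar> / fact n \<le> M"
      using M[of t] M0 by (intro order_trans[OF divide_left_mono[of 1 "fact n"]]) auto
    then have "\<bar>d n t\<bar> / fact n \<le> M + L + (\<Sum>m<n. \<bar>d m x\<bar>)" using L0 S0 by linarith
    then have "\<bar>d n t\<bar> / fact n * \<bar>y\<bar> ^ n \<le> (M + L + (\<Sum>m<n. \<bar>d m x\<bar>)) * \<bar>y\<bar> ^ n"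
      by (intro mult_right_mono) auto
    then show ?thesis unfolding eq by (simp add: abs_mult power_abs)
  next
    case 3
    have pw: "\<bar>y\<bar> ^ m \<le> \<bar>y\<bar> ^ n" if "m \<le> n" for m using 3 that by (intro power_increasing) auto
    have split: "(\<Sum>m<n. d m x / fact m * (- y) ^ m) = d 0 x + (\<Sum>m\<in>{1..<n}. d m x / fact m * (- y) ^ m)"
    proof -
      have "{..<n} = insert 0 {1..<n}" using n by auto
      then show ?thesis by simp
    qed
    have "\<bar>\<Sum>m\<in>{1..<n}. d m x / fact m * (- y) ^ m\<bar> \<le> (\<Sum>m\<in>{1..<n}. \<bar>d m x\<bar> * \<bar>y\<bar> ^ n)"
    proof (rule order_trans[OF sum_abs sum_mono])
      fix m assume m: "m \<in> {1..<n}"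
      have "\<bar>d m x\<bar> / fact m \<le> \<bar>d m x\<bar> / 1" by (intro divide_left_mono) auto
      then have "\<bar>d m x\<bar> / fact m * \<bar>y\<bar> ^ m \<le> \<bar>d m x\<bar> * \<bar>y\<bar> ^ n"
        using pw[of m] m by (intro mult_mono) auto
      then show "\<bar>d m x / fact m * (- y) ^ m\<bar> \<le> \<bar>d m x\<bar> * \<bar>y\<bar> ^ n" by (simp add: abs_mult power_abs)
    qed
    also have "\<dots> \<le> (\<Sum>m<n. \<bar>d m x\<bar>) * \<bar>y\<bar> ^ n"
      unfolding sum_distrib_right by (intro sum_mono2) auto
    finally have 1: "\<bar>\<Sum>m\<in>{1..<n}. d m x / fact m * (- y) ^ m\<bar> \<le> (\<Sum>m<n. \<bar>d m x\<bar>) * \<bar>y\<bar> ^ n" .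
    have "L * \<bar>y\<bar> \<le> L * \<bar>y\<bar> ^ n" using pw[of 1] n L0 by (intro mult_left_mono) auto
    with L[of y] 3 have 2: "\<bar>d 0 (x - y) - d 0 x\<bar> \<le> L * \<bar>y\<bar> ^ n" by simp
    have "0 \<le> M * \<bar>y\<bar> ^ n" using M0 by simp
    with 1 2 show ?thesis unfolding split distrib_right by linarith
  qed
qed

text \<open>Replaces \<open>f\<close> by its Taylor polynomial under the integral; each monomial
  contributes a kernel moment, and the remainder is a weighted L1 bound.\<close>

lemma conv_taylor:
  assumes t: "t > 0" and f: "lingrowth f"
    and b: "\<And>y. \<bar>f (x - y) - (\<Sum>m<n. a m * (- y) ^ m)\<bar> \<le> K * \<bar>y\<bar> ^ n"
  shows "\<bar>conv j t f x - (\<Sum>m<n. a m * (- qroot t) ^ m * (\<integral>z. z ^ m * Gder j z \<partial>lborel)) / qroot t ^ j\<bar>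
     \<le> K * Gnorm n j * qroot t ^ n / qroot t ^ j"
proof -
  note q = qroot_pos[OF t]
  let ?q = "qroot t"
  have i: "integrable lborel (\<lambda>z. Gder j z * f (x - ?q * z))"
    using integrable_conv[OF t f, of j x] integrable_ker_mult_iff[OF t, of j "\<lambda>y. f (x - y)"] by simp
  have i2: "integrable lborel (\<lambda>z. \<Sum>m<n. a m * (- ?q) ^ m * (z ^ m * Gder j z))"
    by (intro Bochner_Integration.integrable_sum integrable_mult_right integrable_Gder)
  have "conv j t f x - (\<Sum>m<n. a m * (- ?q) ^ m * (\<integral>z. z ^ m * Gder j z \<partial>lborel)) / ?q ^ j
      = ((\<integral>z. Gder j z * f (x - ?q * z) \<partial>lborel) - (\<integral>z. (\<Sum>m<n. a m * (- ?q) ^ m * (z ^ m * Gder j z)) \<partial>lborel)) / ?q ^ j"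
    by (subst Bochner_Integration.integral_sum)
       (auto simp: conv_scaled[OF t] diff_divide_distrib intro: integrable_Gder)
  also have "(\<integral>z. Gder j z * f (x - ?q * z) \<partial>lborel) - (\<integral>z. (\<Sum>m<n. a m * (- ?q) ^ m * (z ^ m * Gder j z)) \<partial>lborel)
      = (\<integral>z. Gder j z * f (x - ?q * z) - (\<Sum>m<n. a m * (- ?q) ^ m * (z ^ m * Gder j z)) \<partial>lborel)" (is "_ = ?I")
    by (rule Bochner_Integration.integral_diff[OF i i2, symmetric])
  finally have eq: "conv j t f x - (\<Sum>m<n. a m * (- ?q) ^ m * (\<integral>z. z ^ m * Gder j z \<partial>lborel)) / ?q ^ j = ?I / ?q ^ j" .
  have "norm ?I \<le> (\<integral>z. (K * ?q ^ n) * (\<bar>z\<bar> ^ n * \<bar>Gder j z\<bar>) \<partial>lborel)"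
  proof (rule Bochner_Integration.integral_norm_bound_integral[OF Bochner_Integration.integrable_diff[OF i i2]])
    show "integrable lborel (\<lambda>z. (K * ?q ^ n) * (\<bar>z\<bar> ^ n * \<bar>Gder j z\<bar>))"
      by (intro integrable_mult_right integrable_abs_Gder)
    fix z
    have "Gder j z * f (x - ?q * z) - (\<Sum>m<n. a m * (- ?q) ^ m * (z ^ m * Gder j z))
        = Gder j z * (f (x - ?q * z) - (\<Sum>m<n. a m * (- (?q * z)) ^ m))"
    proof -
      have "(- (?q * z)) ^ m = (- ?q) ^ m * z ^ m" for m by (simp flip: power_mult_distrib)
      then show ?thesis by (simp add: right_diff_distrib sum_distrib_left mult_ac)
    qed
    then show "norm (Gder j z * f (x - ?q * z) - (\<Sum>m<n. a m * (- ?q) ^ m * (z ^ m * Gder j z)))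
        \<le> (K * ?q ^ n) * (\<bar>z\<bar> ^ n * \<bar>Gder j z\<bar>)"
      using mult_left_mono[OF b[of "?q * z"], of "\<bar>Gder j z\<bar>"] q
      by (simp add: abs_mult power_mult_distrib mult_ac)
  qed
  then have "\<bar>?I\<bar> \<le> K * Gnorm n j * ?q ^ n"
    unfolding integral_mult_right_zero Gnorm_def[symmetric] real_norm_def by (simp add: mult_ac)
  then show ?thesis unfolding eq using q by (simp add: divide_right_mono)
qed

text \<open>Moments 1, 2 and 3 vanish, so the first correction is of order
  \<open>qroot t ^ 4 = t\<close>. Stopping at degree 5 leaves an error of order
  \<open>t^(5/4)\<close>, which survives division by \<open>t\<close>.\<close>

lemma conv_0_expansion:
  assumes t: "t > 0" and f: "lingrowth f"
    and b: "\<And>y. \<bar>f (x - y) - (\<Sum>m<5. a m * (- y) ^ m)\<bar> \<le> K * \<bar>y\<bar> ^ 5"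
  shows "\<bar>conv 0 t f x - (a 0 - 24 * t * a 4)\<bar> \<le> K * Gnorm 5 0 * qroot t * t"
proof -
  have "(\<Sum>m<5. a m * (- qroot t) ^ m * (\<integral>z. z ^ m * Gder 0 z \<partial>lborel)) = a 0 - 24 * t * a 4"
    using Gder_odd_moment[of 1] Gder_odd_moment[of 3] qroot_power4[OF t]
    by (simp add: lessThan_nat_numeral Gder_moment_0 Gder_moment_2 Gder_moment_4 numeral_2_eq_2[symmetric])
  moreover have "qroot t ^ 5 = qroot t * t" using qroot_power4[OF t] power_Suc[of "qroot t" 4] by simp
  ultimately show ?thesis using conv_taylor[OF t f b, of 0] by (simp add: mult.assoc)
qed

text \<open>The moments 0 and -1 of G' kill the constant term and cancel the sign of
  \<open>- qroot t\<close>, so one kernel derivative reproduces the derivative of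
  \<open>f\<close>.\<close>

lemma conv_1_expansion:
  assumes t: "t > 0" and f: "lingrowth f"
    and b: "\<And>y. \<bar>f (x - y) - (\<Sum>m<2. a m * (- y) ^ m)\<bar> \<le> K * \<bar>y\<bar> ^ 2"
  shows "\<bar>conv 1 t f x - a 1\<bar> \<le> K * Gnorm 2 1 * qroot t"
proof -
  note q = qroot_pos[OF t]
  have "(\<Sum>m<2. a m * (- qroot t) ^ m * (\<integral>z. z ^ m * Gder 1 z \<partial>lborel)) / qroot t ^ 1 = a 1"
    using q Gder_1_moment_0 Gder_1_moment_1 by (simp add: lessThan_nat_numeral numeral_2_eq_2)
  moreover have "K * Gnorm 2 1 * qroot t ^ 2 / qroot t ^ 1 = K * Gnorm 2 1 * qroot t"
    using q by (simp add: power2_eq_square)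
  ultimately show ?thesis using conv_taylor[OF t f b, of 1] by simp
qed

lemma tendsto_qroot_0: "(qroot \<longlongrightarrow> 0) (at_right 0)"
proof -
  have "((\<lambda>t::real. t powr (1/4)) \<longlongrightarrow> 0 powr (1/4)) (at_right 0)"
    by (intro tendsto_powr2 tendsto_ident_at tendsto_const) (auto simp: eventually_at_right_less less_imp_le intro: eventually_mono[OF eventually_at_right_less])
  then show ?thesis by (simp add: qroot_def[abs_def])
qed

lemma biheat_generator:
  assumes f: "lingrowth f" and b: "\<And>y. \<bar>f (x - y) - (\<Sum>m<5. a m * (- y) ^ m)\<bar> \<le> K * \<bar>y\<bar> ^ 5"
  shows "((\<lambda>h. (conv 0 h f x - a 0) / h) \<longlongrightarrow> - 24 * a 4) (at_right 0)"
proof -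
  have "((\<lambda>h. (conv 0 h f x - a 0) / h - (- 24 * a 4)) \<longlongrightarrow> 0) (at_right 0)"
  proof (rule Lim_null_comparison)
    show "\<forall>\<^sub>F h in at_right 0. norm ((conv 0 h f x - a 0) / h - (- 24 * a 4)) \<le> K * Gnorm 5 0 * qroot h"
      using eventually_at_right_less[of 0]
    proof eventually_elim
      case (elim h)
      have "(conv 0 h f x - a 0) / h - (- 24 * a 4) = (conv 0 h f x - (a 0 - 24 * h * a 4)) / h"
        using elim by (simp add: field_simps)
      moreover have "\<bar>conv 0 h f x - (a 0 - 24 * h * a 4)\<bar> / h \<le> K * Gnorm 5 0 * qroot h"
        using conv_0_expansion[OF elim f b] elim by (simp add: pos_divide_le_eq)
      ultimately show ?case using elim by simp
    qed
    show "((\<lambda>h. K * Gnorm 5 0 * qroot h) \<longlongrightarrow> 0) (at_right 0)"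
      using tendsto_mult_right_zero[OF tendsto_qroot_0, of "K * Gnorm 5 0"] .
  qed
  then show ?thesis by (simp only: LIM_zero_iff)
qed

lemma set_integral_close:
  fixes g :: "real \<Rightarrow> real"
  assumes ab: "a < b" and g: "set_integrable lborel {a<..<b} g"
    and e: "\<And>s. a < s \<Longrightarrow> s < b \<Longrightarrow> \<bar>g s - c\<bar> \<le> e"
  shows "\<bar>(LINT s:{a<..<b}|lborel. g s) - (b - a) * c\<bar> \<le> e * (b - a)"
proof -
  let ?I = "\<lambda>s. indicator {a<..<b} s :: real"
  have I: "integrable lborel (\<lambda>s. ?I s * k)" "(\<integral>s. ?I s * k \<partial>lborel) = (b - a) * k" for k
    using ab by auto
  have gi: "integrable lborel (\<lambda>s. ?I s * g s)" using g by (simp add: set_integrable_def)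
  have "(LINT s:{a<..<b}|lborel. g s) - (b - a) * c = (\<integral>s. ?I s * g s \<partial>lborel) - (\<integral>s. ?I s * c \<partial>lborel)"
    by (simp only: set_lebesgue_integral_def real_scaleR_def I(2))
  also have "\<dots> = (\<integral>s. ?I s * g s - ?I s * c \<partial>lborel)"
    by (rule Bochner_Integration.integral_diff[symmetric, OF gi I(1)])
  also have "norm \<dots> \<le> (\<integral>s. ?I s * e \<partial>lborel)"
    by (rule Bochner_Integration.integral_norm_bound_integral[OF Bochner_Integration.integrable_diff[OF gi I(1)] I(1)])
       (use e in \<open>auto simp: indicator_def\<close>)
  also have "\<dots> = (b - a) * e" by (rule I(2))
  finally show ?thesis by (simp add: mult.commute)
qed

lemma qroot_mono: "0 \<le> s \<Longrightarrow> s \<le> t \<Longrightarrow> qroot s \<le> qroot t"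
  by (simp add: qroot_def powr_mono2)

context duhamel
begin

text \<open>Connects the gauge integrals and pointwise derivatives of the statement with
  \<open>duh\<close>. Passing to the open interval discards the endpoints, where
  \<open>biheat 0\<close> and the source at time 0 carry no information.\<close>

lemma integral_deriv_biheat:
  assumes t: "t > 0"
  shows "integral {0..t} (\<lambda>s. deriv (biheat (t - s) (\<lambda>y. N y s)) x) = duh 1 0 t x"
    and "integral {0..t} (\<lambda>s. (deriv ^^ 2) (biheat (t - s) (\<lambda>y. N y s)) x) = duh 2 0 t x"
proof -
  have "integral {0..t} (\<lambda>s. deriv (biheat (t - s) (\<lambda>y. N y s)) x) = integral {0<..<t} (\<lambda>s. conv 1 (t - s) (\<lambda>y. N y s) x)"
    unfolding integral_open_interval_real
    by (intro integral_cong deriv_biheat(1)[OF _ source_measurable bound]) auto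
  also have "\<dots> = duh 1 0 t x"
    unfolding duh_def by (rule set_borel_integral_eq_integral(2)[symmetric, OF set_integrable_conv_source]) (use t in auto)
  finally show "integral {0..t} (\<lambda>s. deriv (biheat (t - s) (\<lambda>y. N y s)) x) = duh 1 0 t x" .
  have "integral {0..t} (\<lambda>s. (deriv ^^ 2) (biheat (t - s) (\<lambda>y. N y s)) x) = integral {0<..<t} (\<lambda>s. conv 2 (t - s) (\<lambda>y. N y s) x)"
    unfolding integral_open_interval_real
    by (intro integral_cong deriv_biheat(2)[OF _ source_measurable bound]) auto
  also have "\<dots> = duh 2 0 t x"
    unfolding duh_def by (rule set_borel_integral_eq_integral(2)[symmetric, OF set_integrable_conv_source]) (use t in auto)
  finally show "integral {0..t} (\<lambda>s. (deriv ^^ 2) (biheat (t - s) (\<lambda>y. N y s)) x) = duh 2 0 t x" .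
qed

lemma lingrowth_duh:
  assumes t: "t > 0" shows "lingrowth (duh 1 0 t)"
proof (rule lingrowth_bounded[OF borel_measurable_continuous_onI])
  show "continuous_on UNIV (duh 1 0 t)"
    by (intro continuous_at_imp_continuous_on ballI DERIV_isCont[OF duh_deriv[OF t]])
  show "\<bar>duh 1 0 t x\<bar> \<le> C * Gnorm 0 1 * beta_mass 1 * (t - 0) powr (1/2 - real 1 / 4)" for x
    by (rule duh_bound) (use t in auto)
qed

text \<open>On (t, t+h) the integrand is within a multiple of \<open>qroot h\<close> of
  \<open>N1 x s\<close>, uniformly in \<open>s\<close>, so the average over the interval tends to
  \<open>N1 x t\<close>.\<close>

lemma duh_right_derivative:
  assumes t: "t > 0"
    and D1: "\<And>y s. s > 0 \<Longrightarrow> ((\<lambda>y. N y s) has_real_derivative N1 y s) (at y)"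
    and D2: "\<And>y s. s > 0 \<Longrightarrow> ((\<lambda>y. N1 y s) has_real_derivative N2 y s) (at y)"
    and c1: "continuous_on (UNIV \<times> {0<..}) (\<lambda>p. N1 (fst p) (snd p))"
    and c2: "continuous_on (UNIV \<times> {0<..}) (\<lambda>p. N2 (fst p) (snd p))"
  shows "((\<lambda>h. duh 1 t (t + h) x / h) \<longlongrightarrow> N1 x t) (at_right 0)"
proof -
  \<comment> \<open>Compactness of this box makes the Taylor constants uniform in
    \<open>s\<close>.\<close>
  let ?K = "{x - 1..x + 1} \<times> {t..t + 1}"
  have sub: "?K \<subseteq> UNIV \<times> {0<..}" using t by auto
  have cK: "compact ?K" by (intro compact_Times) auto
  have bdd: "\<exists>M. \<forall>p\<in>?K. \<bar>g (fst p) (snd p)\<bar> \<le> M" if "continuous_on (UNIV \<times> {0<..}) (\<lambda>p. g (fst p) (snd p))"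
    for g :: "real \<Rightarrow> real \<Rightarrow> real"
    using compact_imp_bounded[OF compact_continuous_image[OF continuous_on_subset[OF that sub] cK]]
    by (auto simp: bounded_iff)
  obtain M1 where M1: "\<And>y s. (y, s) \<in> ?K \<Longrightarrow> \<bar>N1 y s\<bar> \<le> M1" using bdd[OF c1] by fastforce
  obtain M2 where M2: "\<And>y s. (y, s) \<in> ?K \<Longrightarrow> \<bar>N2 y s\<bar> \<le> M2" using bdd[OF c2] by fastforce
  define B where "B = C * t powr (-1/2)"
  have B: "\<bar>N y s\<bar> \<le> B" if "s \<ge> t" for y s
  proof -
    have "s powr (-1/2) \<le> t powr (-1/2)" using t that by (intro powr_mono2') auto
    then have "C * s powr (-1/2) \<le> B" unfolding B_def using C_nonneg by (intro mult_left_mono)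
    with bound[of s y] t that show ?thesis by linarith
  qed
  have B0: "B \<ge> 0" using B[of t 0] by simp
  \<comment> \<open>\<open>M2\<close> bounds the Taylor remainder near \<open>x\<close>,
    \<open>2 * B\<close> the increment far away, and \<open>B + M1\<close> the two coefficients at
    \<open>x\<close>.\<close>
  define K where "K = M2 + 3 * B + M1"
  have exp: "\<bar>conv 1 \<tau> (\<lambda>y. N y s) x - N1 x s\<bar> \<le> K * Gnorm 2 1 * qroot \<tau>"
    if s: "t \<le> s" "s \<le> t + 1" and \<tau>: "\<tau> > 0" for s \<tau>
  proof -
    have s0: "s > 0" using s t by simp
    define d where "d m z = (if m = 0 then N z s else if m = 1 then N1 z s else N2 z s)" for m :: nat and z
    have "\<bar>N (x - y) s - (\<Sum>m<2. d m x / fact m * (- y) ^ m)\<bar> \<le> K * \<bar>y\<bar> ^ 2" for y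
    proof -
      have "\<bar>d 0 (x - y) - (\<Sum>m<2. d m x / fact m * (- y) ^ m)\<bar> \<le> (M2 + 2 * B + (\<Sum>m<2. \<bar>d m x\<bar>)) * \<bar>y\<bar> ^ 2"
      proof (rule taylor_remainder_global)
        show "(d m has_real_derivative d (Suc m) z) (at z)" if "m < 2" for m z
          using that D1[OF s0, of z] D2[OF s0, of z] by (cases "m = 0") (auto simp: d_def[abs_def])
        show "\<bar>d 2 z\<bar> \<le> M2" if "\<bar>z - x\<bar> \<le> 1" for z
          using that s by (auto simp: d_def intro!: M2)
        show "\<bar>d 0 (x - y) - d 0 x\<bar> \<le> 2 * B * \<bar>y\<bar>" if "\<bar>y\<bar> \<ge> 1" for y
        proof -
          have "\<bar>d 0 (x - y) - d 0 x\<bar> \<le> 2 * B" using B[of s "x - y"] B[of s x] s by (simp add: d_def)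
          also have "\<dots> \<le> 2 * B * \<bar>y\<bar>" using that B0 mult_left_mono[of 1 "\<bar>y\<bar>" "2 * B"] by simp
          finally show ?thesis .
        qed
      qed simp
      also have "\<dots> \<le> K * \<bar>y\<bar> ^ 2"
        using B[of s x] M1[of x s] s
        by (intro mult_right_mono) (auto simp: K_def d_def numeral_2_eq_2)
      finally show ?thesis by (simp add: d_def)
    qed
    moreover have "lingrowth (\<lambda>y. N y s)"
      by (rule lingrowth_bounded[OF source_measurable[OF s0] B]) (use s in auto)
    ultimately have "\<bar>conv 1 \<tau> (\<lambda>y. N y s) x - d 1 x / fact 1\<bar> \<le> K * Gnorm 2 1 * qroot \<tau>"
      by (intro conv_1_expansion[OF \<tau>])
    then show ?thesis by (simp add: d_def)
  qed
  have K0: "K \<ge> 0"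
    using M1[of x t] M2[of x t] B0 by (auto simp: K_def intro!: add_nonneg_nonneg intro: order_trans[OF abs_ge_zero])
  show ?thesis
  proof (rule tendstoI)
    fix e :: real assume e: "e > 0"
    have "continuous_on {0<..} (\<lambda>s. N1 x s)"
    proof -
      have "continuous_on {0<..} (\<lambda>s. (\<lambda>p. N1 (fst p) (snd p)) (x, s))"
        by (rule continuous_on_compose2[OF c1])
           (auto intro!: continuous_on_Pair continuous_on_const continuous_on_id)
      then show ?thesis by simp
    qed
    then have "isCont (\<lambda>s. N1 x s) t" using t by (simp add: continuous_on_eq_continuous_at)
    then obtain d where d: "d > 0" "\<And>s. \<bar>s - t\<bar> < d \<Longrightarrow> \<bar>N1 x s - N1 x t\<bar> < e / 4"
      using e unfolding continuous_at_eps_delta dist_real_def by (metis divide_pos_pos zero_less_numeral)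
    have "((\<lambda>h. K * Gnorm 2 1 * qroot h) \<longlongrightarrow> 0) (at_right 0)"
      using tendsto_mult_right_zero[OF tendsto_qroot_0] .
    then have "\<forall>\<^sub>F h in at_right 0. K * Gnorm 2 1 * qroot h < e / 4"
      using e by (intro order_tendstoD) auto
    moreover have "\<forall>\<^sub>F h in at_right 0. h \<in> {0<..<min d 1}"
      using d by (intro eventually_at_right_real) auto
    ultimately show "\<forall>\<^sub>F h in at_right 0. dist (duh 1 t (t + h) x / h) (N1 x t) < e"
    proof eventually_elim
      case (elim h)
      then have h: "0 < h" "h < d" "h < 1" by auto
      \<comment> \<open>Two errors of at most \<open>e / 4\<close> each: the convolution over a time
        below \<open>h\<close>, and the variation of \<open>N1 x\<close> on (t, t+h).\<close>
      have "\<bar>duh 1 t (t + h) x - ((t + h) - t) * N1 x t\<bar> \<le> (e / 2) * ((t + h) - t)"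
        unfolding duh_def
      proof (rule set_integral_close)
        show "set_integrable lborel {t<..<t + h} (\<lambda>s. conv 1 (t + h - s) (\<lambda>y. N y s) x)"
          by (rule set_integrable_conv_source) (use t h in auto)
        fix s assume s: "t < s" "s < t + h"
        have "\<bar>conv 1 (t + h - s) (\<lambda>y. N y s) x - N1 x s\<bar> \<le> K * Gnorm 2 1 * qroot (t + h - s)"
          using s h by (intro exp) auto
        also have "\<dots> \<le> K * Gnorm 2 1 * qroot h"
          using s K0 Gnorm_nonneg by (intro mult_left_mono qroot_mono) auto
        finally show "\<bar>conv 1 (t + h - s) (\<lambda>y. N y s) x - N1 x t\<bar> \<le> e / 2"
          using d(2)[of s] s h elim(1) by linarith
      qed (use h in auto)
      then have "\<bar>duh 1 t (t + h) x - h * N1 x t\<bar> / h \<le> e / 2" using h by (simp add: pos_divide_le_eq)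
      moreover have "duh 1 t (t + h) x / h - N1 x t = (duh 1 t (t + h) x - h * N1 x t) / h"
        using h by (simp add: field_simps)
      ultimately have "\<bar>duh 1 t (t + h) x / h - N1 x t\<bar> \<le> e / 2" using h by simp
      then show ?case using e by (simp add: dist_real_def)
    qed
  qed
qed

end

section \<open>The initial profile and the nonlinearity\<close>

lemma phiAB_Lipschitz: "\<bar>phiAB A B x - phiAB A B y\<bar> \<le> (\<bar>A\<bar> + \<bar>B\<bar>) * \<bar>x - y\<bar>"
proof -
  \<comment> \<open>Written with positive and negative parts, which are 1-Lipschitz, no case split
    on signs is needed.\<close>
  have eq: "phiAB A B z = A * max z 0 + B * max (- z) 0" for z by (simp add: phiAB_def max_def)
  have "phiAB A B x - phiAB A B y = A * (max x 0 - max y 0) + B * (max (- x) 0 - max (- y) 0)"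
    unfolding eq by (simp add: algebra_simps)
  also have "\<bar>\<dots>\<bar> \<le> \<bar>A\<bar> * \<bar>max x 0 - max y 0\<bar> + \<bar>B\<bar> * \<bar>max (- x) 0 - max (- y) 0\<bar>"
    by (rule order_trans[OF abs_triangle_ineq]) (simp add: abs_mult)
  also have "\<dots> \<le> \<bar>A\<bar> * \<bar>x - y\<bar> + \<bar>B\<bar> * \<bar>x - y\<bar>"
    by (intro add_mono mult_left_mono) auto
  finally show ?thesis by (simp add: distrib_right)
qed

lemma lingrowth_phiAB: "lingrowth (phiAB A B)"
  by (rule lingrowth_Lipschitz[OF phiAB_Lipschitz])

lemma phiAB_scaling: "q > 0 \<Longrightarrow> phiAB A B (q * y) = q * phiAB A B y"
  by (simp add: phiAB_def zero_le_mult_iff)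

lemma phiAB_deriv:
  assumes "x \<noteq> 0"
  shows "(phiAB A B has_real_derivative (if x < 0 then - B else A)) (at x)"
proof (cases "x < 0")
  case True
  have "((\<lambda>y. - B * y) has_real_derivative - B) (at x)" by (auto intro!: derivative_eq_intros)
  then have "(phiAB A B has_real_derivative - B) (at x)"
    by (rule has_field_derivative_transform_within_open[of _ _ _ "{..<0}"]) (use True in \<open>auto simp: phiAB_def\<close>)
  with True show ?thesis by simp
next
  case False
  have "((\<lambda>y. A * y) has_real_derivative A) (at x)" by (auto intro!: derivative_eq_intros)
  then have "(phiAB A B has_real_derivative A) (at x)"
    by (rule has_field_derivative_transform_within_open[of _ _ _ "{0<..}"]) (use False assms in \<open>auto simp: phiAB_def\<close>)
  with False show ?thesis by simp
qed

text \<open>Here the derivative falls on the profile rather than on the kernel, so that the initial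
  value of \<open>v\<close> appears. The kink is met only at \<open>y = x\<close>, a null set, and
  the Lipschitz bound provides the majorant.\<close>

lemma conv_phiAB_deriv:
  assumes t: "t > 0"
  shows "(conv 0 t (phiAB A B) has_real_derivative conv 0 t (\<lambda>y. if y < 0 then - B else A) x) (at x)"
  unfolding conv_def
proof (rule has_real_derivative_integral_Lipschitz[where d=1 and g="\<lambda>y. (\<bar>A\<bar> + \<bar>B\<bar>) * \<bar>ker 0 t y\<bar>"])
  show "integrable lborel (\<lambda>y. ker 0 t y * phiAB A B (x - y))" for x
    by (rule integrable_conv[OF t lingrowth_phiAB])
  have "AE y in lborel. y \<noteq> x" by (rule AE_lborel_singleton)
  then show "AE y in lborel. ((\<lambda>x. ker 0 t y * phiAB A B (x - y)) has_real_derivative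
      ker 0 t y * (if x - y < 0 then - B else A)) (at x)"
  proof eventually_elim
    case (elim y)
    have "((\<lambda>x. phiAB A B (x - y)) has_real_derivative (if x - y < 0 then - B else A) * 1) (at x)"
      by (rule DERIV_chain2[OF phiAB_deriv]) (use elim in \<open>auto intro!: derivative_eq_intros\<close>)
    from DERIV_cmult[OF this, of "ker 0 t y"] show ?case by simp
  qed
  show "integrable lborel (\<lambda>y. (\<bar>A\<bar> + \<bar>B\<bar>) * \<bar>ker 0 t y\<bar>)"
    by (intro integrable_mult_right integrable_abs integrable_ker t)
  show "\<bar>ker 0 t y * phiAB A B (u - y) - ker 0 t y * phiAB A B (x - y)\<bar> \<le> (\<bar>A\<bar> + \<bar>B\<bar>) * \<bar>ker 0 t y\<bar> * \<bar>u - x\<bar>" for u y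
    using mult_left_mono[OF phiAB_Lipschitz[of A B "u - y" "x - y"], of "\<bar>ker 0 t y\<bar>"]
    by (simp add: abs_mult flip: right_diff_distrib) (simp add: mult_ac)
qed (use t in auto)

text \<open>With \<open>r = 1 + w^2\<close> the flux is \<open>w2 / r^2 - 3 w w1^2 / r^3\<close>.
  Subtracting it from the linear part \<open>w2\<close> leaves exactly the nonlinearity built from
  \<open>alphaN\<close> and \<open>FN\<close>.\<close>

lemma geometric_flux:
  fixes w w1 :: "real \<Rightarrow> real"
  assumes w: "(w has_real_derivative w1 y) (at y)" and w1: "(w1 has_real_derivative w2) (at y)"
  shows "(1 + (w y)\<^sup>2) powr (-1/2) * deriv (\<lambda>z. w1 z * (1 + (w z)\<^sup>2) powr (-3/2)) y
    = w2 - (alphaN (w y) * w2 + FN (w y) (w1 y))"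
proof -
  have gen: "w2 * a - X * b = w2 - ((1 - a) * w2 + X * b)" for a b X :: real by (simp add: algebra_simps)
  define r where "r = 1 + (w y)\<^sup>2"
  have r: "r > 0" by (simp add: r_def add_pos_nonneg)
  have "((\<lambda>z. 1 + (w z)\<^sup>2) has_real_derivative 2 * w y * w1 y) (at y)"
    using w by (auto intro!: derivative_eq_intros)
  from DERIV_fun_powr[OF this, of "-3/2"] r
  have "((\<lambda>z. (1 + (w z)\<^sup>2) powr (-3/2)) has_real_derivative (-3/2) * r powr (-3/2 - 1) * (2 * w y * w1 y)) (at y)"
    by (simp add: r_def)
  from DERIV_mult[OF w1 this]
  have "((\<lambda>z. w1 z * (1 + (w z)\<^sup>2) powr (-3/2)) has_real_derivative
      w2 * r powr (-3/2) + (-3/2) * r powr (-3/2 - 1) * (2 * w y * w1 y) * w1 y) (at y)"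
    by (simp add: r_def)
  then have D: "deriv (\<lambda>z. w1 z * (1 + (w z)\<^sup>2) powr (-3/2)) y
      = w2 * r powr (-3/2) - 3 * w y * (w1 y)\<^sup>2 * r powr (-5/2)"
    by (auto dest!: DERIV_imp_deriv simp: power2_eq_square)
  have "(1 + (w y)\<^sup>2) powr (-1/2) * deriv (\<lambda>z. w1 z * (1 + (w z)\<^sup>2) powr (-3/2)) y
      = w2 * (r powr (-1/2) * r powr (-3/2)) - 3 * w y * (w1 y)\<^sup>2 * (r powr (-1/2) * r powr (-5/2))"
    unfolding D r_def[symmetric] by (simp only: right_diff_distrib mult_ac)
  also have "r powr (-1/2) * r powr (-3/2) = inverse (r ^ 2)"
  proof -
    have "r powr (-1/2) * r powr (-3/2) = r powr (- 2)" by (subst powr_add[symmetric]) simp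
    then show ?thesis using r by (simp only: powr_minus powr_numeral)
  qed
  also have "r powr (-1/2) * r powr (-5/2) = inverse (r ^ 3)"
  proof -
    have "r powr (-1/2) * r powr (-5/2) = r powr (- 3)" by (subst powr_add[symmetric]) simp
    then show ?thesis using r by (simp only: powr_minus powr_numeral)
  qed
  also have "w2 * inverse (r ^ 2) - 3 * w y * (w1 y)\<^sup>2 * inverse (r ^ 3) = w2 - (alphaN (w y) * w2 + FN (w y) (w1 y))"
    unfolding alphaN_def FN_def r_def[symmetric] divide_inverse mult_1_left by (rule gen)
  finally show ?thesis .
qed

text \<open>The coefficients are bounded uniformly in \<open>v\<close>: \<open>alphaN\<close> by 1,
  and \<open>\<bar>w\<bar> / (1 + w^2)^3\<close> by 1. Squaring the gradient bound doubles its
  exponent to \<open>-1/2\<close>, the exponent of the second derivative.\<close>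

lemma Nl_bound:
  assumes "\<bar>dx v x s\<bar> \<le> C1 * s powr (-1/4)" "\<bar>dx (dx v) x s\<bar> \<le> C2 * s powr (-1/2)"
  shows "\<bar>Nl v x s\<bar> \<le> (C2 + 3 * C1\<^sup>2) * s powr (-1/2)"
proof -
  let ?w = "v x s"
  have r1: "1 + ?w\<^sup>2 \<ge> 1" by simp
  have "\<bar>alphaN ?w\<bar> \<le> 1"
  proof -
    have ge: "(1 + ?w\<^sup>2)\<^sup>2 \<ge> 1" using r1 by (rule one_le_power)
    then have "(1 + ?w\<^sup>2)\<^sup>2 > 0" by linarith
    with ge have "1 / (1 + ?w\<^sup>2)\<^sup>2 \<le> 1" by (simp only: pos_divide_le_eq mult_1)
    moreover have "0 \<le> 1 / (1 + ?w\<^sup>2)\<^sup>2" by simp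
    ultimately show ?thesis unfolding alphaN_def by linarith
  qed
  then have 1: "\<bar>alphaN ?w * dx (dx v) x s\<bar> \<le> C2 * s powr (-1/2)"
    unfolding abs_mult using assms(2) mult_left_le_one_le[of "\<bar>dx (dx v) x s\<bar>" "\<bar>alphaN ?w\<bar>"] by linarith
  have "\<bar>?w\<bar> \<le> 1 + ?w\<^sup>2"
  proof -
    have "0 \<le> (\<bar>?w\<bar> - 1)\<^sup>2" by simp
    then have "2 * \<bar>?w\<bar> \<le> 1 + ?w\<^sup>2" by (simp add: power2_diff)
    then show ?thesis by linarith
  qed
  also have "\<dots> \<le> (1 + ?w\<^sup>2) ^ 3" using power_increasing[OF _ r1, of 1 3] by simp
  finally have "\<bar>?w\<bar> \<le> (1 + ?w\<^sup>2) ^ 3" .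
  have w3: "\<bar>?w\<bar> / (1 + ?w\<^sup>2) ^ 3 \<le> 1"
  proof -
    have "0 < (1 + ?w\<^sup>2) ^ 3" using r1 by (intro zero_less_power) linarith
    then show ?thesis using \<open>\<bar>?w\<bar> \<le> (1 + ?w\<^sup>2) ^ 3\<close> by (simp only: pos_divide_le_eq mult_1)
  qed
  have "\<bar>dx v x s\<bar>\<^sup>2 \<le> (C1 * s powr (-1/4))\<^sup>2" using assms(1) by (intro power_mono) auto
  also have "\<dots> = C1\<^sup>2 * s powr (-1/2)"
    by (simp add: power_mult_distrib power2_eq_square powr_add[symmetric])
  finally have p: "(dx v x s)\<^sup>2 \<le> C1\<^sup>2 * s powr (-1/2)" by simp
  have "\<bar>FN ?w (dx v x s)\<bar> = 3 * (\<bar>?w\<bar> / (1 + ?w\<^sup>2) ^ 3 * (dx v x s)\<^sup>2)"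
    by (simp add: FN_def abs_mult abs_divide power_abs)
  also have "\<dots> \<le> 3 * (1 * (dx v x s)\<^sup>2)" using w3 by (intro mult_left_mono mult_right_mono) auto
  finally have 2: "\<bar>FN ?w (dx v x s)\<bar> \<le> 3 * C1\<^sup>2 * s powr (-1/2)" using p by simp
  show ?thesis using 1 2 unfolding Nl_def distrib_right by linarith
qed

text \<open>General factors \<open>q\<close> and \<open>c\<close> allow the lemma to be applied to
  \<open>v\<close> and then again to \<open>dx v\<close>.\<close>

lemma dx_scaling:
  assumes u: "smooth_half u" and \<sigma>: "\<sigma> > 0" and t: "t > 0"
    and eq: "\<And>y. u (q * y) (\<sigma> * t) = c * u y t"
  shows "q * dx u (q * x) (\<sigma> * t) = c * dx u x t"
proof (rule DERIV_unique)
  have "((\<lambda>y. u (q * y) (\<sigma> * t)) has_real_derivative dx u (q * x) (\<sigma> * t) * q) (at x)"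
    by (rule DERIV_chain2[OF smooth_half_dx(1)[OF u]]) (use \<sigma> t in \<open>auto intro!: derivative_eq_intros\<close>)
  then show "((\<lambda>y. u (q * y) (\<sigma> * t)) has_real_derivative q * dx u (q * x) (\<sigma> * t)) (at x)"
    by (simp add: mult.commute)
  show "((\<lambda>y. u (q * y) (\<sigma> * t)) has_real_derivative c * dx u x t) (at x)"
    unfolding eq by (rule DERIV_cmult[OF smooth_half_dx(1)[OF u t]])
qed

text \<open>Both \<open>v_xx\<close> and \<open>v_x^2\<close> carry two inverse lengths, and the
  coefficients depend only on the scale-invariant \<open>v\<close>.\<close>

lemma Nl_scaling:
  assumes v: "smooth_half v" and \<sigma>: "\<sigma> > 0" and t: "t > 0"
    and eq: "\<And>y. v (qroot \<sigma> * y) (\<sigma> * t) = v y t"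
  shows "Nl v (qroot \<sigma> * x) (\<sigma> * t) = Nl v x t / (qroot \<sigma>)\<^sup>2"
proof -
  note q = qroot_pos[OF \<sigma>]
  have 1: "dx v (qroot \<sigma> * y) (\<sigma> * t) = (1 / qroot \<sigma>) * dx v y t" for y
    using dx_scaling[OF v \<sigma> t, of "qroot \<sigma>" 1 y] eq q by (simp add: field_simps)
  have 2: "dx (dx v) (qroot \<sigma> * x) (\<sigma> * t) = dx (dx v) x t / (qroot \<sigma>)\<^sup>2"
    using dx_scaling[OF smooth_half_dx(2)[OF v] \<sigma> t 1, of x] q by (simp add: field_simps power2_eq_square)
  show ?thesis
    unfolding Nl_def eq 1 2 by (simp add: FN_def power_divide add_divide_distrib)
qed

lemma conv_add:
  assumes "t > 0" "lingrowth f" "lingrowth g"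
  shows "conv j t (\<lambda>y. f y + g y) x = conv j t f x + conv j t g x"
  using integrable_conv[OF assms(1,2), of j x] integrable_conv[OF assms(1,3), of j x]
  by (simp add: conv_def distrib_left)

theorem theorem5p6:
  fixes A B :: real and v U :: "real \<Rightarrow> real \<Rightarrow> real"
  assumes smooth: "smooth2_on (UNIV \<times> {0<..}) (\<lambda>p. v (fst p) (snd p))"
    and bd0: "\<exists>C0. \<forall>x. \<forall>t>0. \<bar>v x t\<bar> \<le> C0"
    and bd1: "\<exists>C1. \<forall>x. \<forall>t>0. \<bar>dx v x t\<bar> \<le> C1 * t powr (-1/4)"
    and bd2: "\<exists>C2. \<forall>x. \<forall>t>0. \<bar>dx (dx v) x t\<bar> \<le> C2 * t powr (-1/2)"
    and mild: "\<forall>x. \<forall>t>0. v x t =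
        biheat t (\<lambda>y. if y < 0 then - B else A) x
        + integral {0..t} (\<lambda>s. (deriv ^^ 2) (biheat (t - s) (\<lambda>y. Nl v y s)) x)"
    and selfsim: "\<forall>x. \<forall>t>0. \<forall>\<sigma>>0. v (\<sigma> powr (1/4) * x) (\<sigma> * t) = v x t"
    and U_def: "\<forall>x. \<forall>t>0. U x t =
        biheat t (phiAB A B) x
        + integral {0..t} (\<lambda>s. deriv (biheat (t - s) (\<lambda>y. Nl v y s)) x)"
  shows "uniformly_continuous_on (UNIV \<times> {0<..}) (\<lambda>p. U (fst p) (snd p))
    \<and> (\<forall>x. ((\<lambda>p. U (fst p) (snd p)) \<longlongrightarrow> phiAB A B x) (at (x, 0) within UNIV \<times> {0<..}))
    \<and> (\<forall>x. \<forall>t>0. ((\<lambda>y. U y t) has_real_derivative v x t) (at x))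
    \<and> (\<forall>x. \<forall>t>0. ((\<lambda>s. U x s) has_real_derivative
          - deriv (\<lambda>y. (1 + (dx U y t)\<^sup>2) powr (-1/2)
               * deriv (\<lambda>z. dx (dx U) z t * (1 + (dx U z t)\<^sup>2) powr (-3/2)) y) x) (at t))
    \<and> (\<forall>x. \<forall>t>0. \<forall>\<sigma>>0. \<sigma> powr (-1/4) * U (\<sigma> powr (1/4) * x) (\<sigma> * t) = U x t)"
proof -
  have v: "smooth_half v" using smooth by (simp add: smooth_half_def)
  obtain C0 where C0: "\<And>x t. t > 0 \<Longrightarrow> \<bar>v x t\<bar> \<le> C0" using bd0 by blast
  obtain C1 where C1: "\<And>x t. t > 0 \<Longrightarrow> \<bar>dx v x t\<bar> \<le> C1 * t powr (-1/4)" using bd1 by blast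
  obtain C2 where C2: "\<And>x t. t > 0 \<Longrightarrow> \<bar>dx (dx v) x t\<bar> \<le> C2 * t powr (-1/2)" using bd2 by blast
  have N: "smooth_half (Nl v)" by (rule smooth_half_Nl[OF v])
  note N1 = smooth_half_dx(2)[OF N]
  interpret duhamel "Nl v" "C2 + 3 * C1\<^sup>2"
    by unfold_locales (intro smooth_half_continuous_on N, intro Nl_bound C1 C2)

  \<comment> \<open>A Lipschitz constant common to all times: \<open>C0\<close> bounds the slope
    \<open>v\<close> for positive times, \<open>\<bar>A\<bar> + \<bar>B\<bar>\<close> covers the
    profile.\<close>
  define L where "L = \<bar>C0\<bar> + \<bar>A\<bar> + \<bar>B\<bar>"
  \<comment> \<open>The two summands are the coefficients of \<open>qroot h\<close> in the bounds
    for the flow and for the Duhamel integral.\<close>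
  define H where "H = L * Gnorm 1 0 + (C2 + 3 * C1\<^sup>2) * Gnorm 0 1 * beta_mass 1"

  have U: "U x t = conv 0 t (phiAB A B) x + duh 1 0 t x" if "t > 0" for x t
    using U_def that by (simp only: biheat_eq_conv[OF that lingrowth_phiAB] integral_deriv_biheat(1)[OF that])
  have v_mild: "v x t = conv 0 t (\<lambda>y. if y < 0 then - B else A) x + duh 2 0 t x" if "t > 0" for x t
  proof -
    have "lingrowth (\<lambda>y. if y < 0 then - B else A)"
      by (rule lingrowth_bounded[where C="\<bar>A\<bar> + \<bar>B\<bar>"]) auto
    then show ?thesis
      using mild that by (simp only: biheat_eq_conv[OF that] integral_deriv_biheat(2)[OF that])
  qed
  have Ux: "((\<lambda>y. U y t) has_real_derivative v x t) (at x)" if "t > 0" for x t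
    using DERIV_add[OF conv_phiAB_deriv[OF that] duh_deriv[OF that]]
    by (simp only: U[OF that] v_mild[OF that])
  have dxU: "dx U x t = v x t" if "t > 0" for x t
    unfolding dx_def by (rule DERIV_imp_deriv[OF Ux[OF that]])
  have dxdxU: "dx (dx U) x t = dx v x t" if "t > 0" for x t
    unfolding dx_def[of "dx U"] dx_def[of v] using dxU[OF that] by simp

  \<comment> \<open>Extending \<open>U\<close> by the profile at time 0 lets restarting and the
    moduli treat \<open>t = 0\<close> and \<open>t > 0\<close> alike.\<close>
  define V where "V t y = (if t = 0 then phiAB A B y else U y t)" for t y
  have V_Lip: "\<bar>V t x - V t y\<bar> \<le> L * \<bar>x - y\<bar>" if "t \<ge> 0" for t x y
  proof (cases "t = 0")
    case True
    have "(\<bar>A\<bar> + \<bar>B\<bar>) * \<bar>x - y\<bar> \<le> L * \<bar>x - y\<bar>" by (intro mult_right_mono) (auto simp: L_def)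
    with phiAB_Lipschitz[of A B x y] True show ?thesis by (simp add: V_def)
  next
    case False
    with that have t: "t > 0" by simp
    have "norm (U x t - U y t) \<le> C0 * norm (x - y)"
      by (rule field_differentiable_bound[of UNIV "\<lambda>y. U y t" "\<lambda>y. v y t"]) (use Ux[OF t] C0[OF t] in auto)
    moreover have "C0 * \<bar>x - y\<bar> \<le> L * \<bar>x - y\<bar>" by (intro mult_right_mono) (auto simp: L_def)
    ultimately show ?thesis using False by (simp add: V_def)
  qed
  have restart: "U x (t + h) = conv 0 h (V t) x + duh 1 t (t + h) x" if t: "t \<ge> 0" and h: "h > 0" for x t h
  proof (cases "t = 0")
    case True
    then show ?thesis using U[OF h] by (simp add: V_def[abs_def])
  next
    case False
    with t have t: "t > 0" by simp
    \<comment> \<open>The flow of the profile is Lipschitz, as its derivative is the flow of bounded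
      data; linear growth then allows the semigroup and additivity.\<close>
    have "lingrowth (conv 0 t (phiAB A B))"
    proof (rule lingrowth_Lipschitz)
      fix x y
      have "norm (conv 0 t (phiAB A B) x - conv 0 t (phiAB A B) y) \<le> ((\<bar>A\<bar> + \<bar>B\<bar>) * Gnorm 0 0) * norm (x - y)"
      proof (rule field_differentiable_bound[of UNIV _ "conv 0 t (\<lambda>y. if y < 0 then - B else A)"])
        show "norm (conv 0 t (\<lambda>y. if y < 0 then - B else A) z) \<le> (\<bar>A\<bar> + \<bar>B\<bar>) * Gnorm 0 0" for z
          using conv_bound[OF t, of "\<lambda>y. if y < 0 then - B else A" "\<bar>A\<bar> + \<bar>B\<bar>" 0 z] by simp
      qed (use conv_phiAB_deriv[OF t] in auto)
      then show "\<bar>conv 0 t (phiAB A B) x - conv 0 t (phiAB A B) y\<bar> \<le> ((\<bar>A\<bar> + \<bar>B\<bar>) * Gnorm 0 0) * \<bar>x - y\<bar>" by simp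
    qed
    note add = conv_add[OF h this lingrowth_duh[OF t], of 0 x]
    have "V t = (\<lambda>y. conv 0 t (phiAB A B) y + duh 1 0 t y)" using False U[OF t] by (simp add: V_def fun_eq_iff)
    moreover have "U x (t + h) = conv 0 (t + h) (phiAB A B) x + duh 1 0 (t + h) x" by (rule U) (use t h in auto)
    ultimately show ?thesis
      by (simp only: add conv_semigroup[OF h t lingrowth_phiAB] duh_restart[OF t h])
  qed

  have V_Hoelder: "\<bar>U x (t + h) - V t x\<bar> \<le> H * qroot h" if t: "t \<ge> 0" and h: "h > 0" for x t h
  proof -
    have "\<bar>conv 0 h (V t) x - V t x\<bar> \<le> L * Gnorm 1 0 * qroot h"
      by (rule conv_Lipschitz_approx[OF h V_Lip[OF t]])
    moreover have "\<bar>duh 1 t (t + h) x\<bar> \<le> (C2 + 3 * C1\<^sup>2) * Gnorm 0 1 * beta_mass 1 * (t + h - t) powr (1/2 - real 1 / 4)"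
      by (rule duh_bound) (use t h in auto)
    then have "\<bar>duh 1 t (t + h) x\<bar> \<le> (C2 + 3 * C1\<^sup>2) * Gnorm 0 1 * beta_mass 1 * qroot h"
      by (simp add: qroot_def)
    ultimately show ?thesis unfolding restart[OF t h] H_def distrib_right by linarith
  qed
  have H0: "H \<ge> 0" using V_Hoelder[of 0 1 0] by (simp add: qroot_def)
  have L0: "L \<ge> 0" by (simp add: L_def)
  have modulus: "\<bar>V t x - V s y\<bar> \<le> L * \<bar>x - y\<bar> + H * qroot \<bar>t - s\<bar>" if "t \<ge> 0" "s \<ge> 0" for t s x y
  proof -
    have time: "\<bar>V t x - V s x\<bar> \<le> H * qroot (t - s)" if "s \<ge> 0" "t > s" for t s x
      using V_Hoelder[of s "t - s" x] that by (simp add: V_def[of t])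
    have "\<bar>V t x - V s x\<bar> \<le> H * qroot \<bar>t - s\<bar>"
      using time[of s t x] time[of t s x] that H0 qroot_nonneg[of 0]
      by (cases t s rule: linorder_cases) (auto simp: abs_minus_commute)
    with V_Lip[OF that(2), of x y] show ?thesis by linarith
  qed
  \<comment> \<open>Proved on the closed half plane, so that restriction yields both the uniform
    continuity and the limit at time 0.\<close>
  have unif: "uniformly_continuous_on (UNIV \<times> {0..}) (\<lambda>p. V (snd p) (fst p))"
    unfolding uniformly_continuous_on_def
  proof (intro allI impI)
    fix e :: real assume e: "e > 0"
    have "((\<lambda>d. L * d + H * qroot d) \<longlongrightarrow> L * 0 + H * 0) (at_right 0)"
      by (intro tendsto_intros tendsto_qroot_0)
    then have "\<forall>\<^sub>F d in at_right 0. L * d + H * qroot d < e"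
      using e by (intro order_tendstoD) auto
    moreover have "\<forall>\<^sub>F d::real in at_right 0. d > 0" by (rule eventually_at_right_less)
    ultimately have "\<forall>\<^sub>F d in at_right 0. L * d + H * qroot d < e \<and> d > 0" by (rule eventually_conj)
    then obtain d where d: "L * d + H * qroot d < e" "d > 0"
      using eventually_happens'[OF trivial_limit_at_right_real] by blast
    show "\<exists>d>0. \<forall>p\<in>UNIV \<times> {0..}. \<forall>p'\<in>UNIV \<times> {0..}. dist p' p < d \<longrightarrow> dist (V (snd p') (fst p')) (V (snd p) (fst p)) < e"
    proof (intro exI[of _ d] conjI ballI impI)
      fix p p' :: "real \<times> real"
      assume p: "p \<in> UNIV \<times> {0..}" "p' \<in> UNIV \<times> {0..}" and pd: "dist p' p < d"
      have "\<bar>fst p' - fst p\<bar> \<le> d" "\<bar>snd p' - snd p\<bar> \<le> d"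
        using dist_fst_le[of p' p] dist_snd_le[of p' p] pd by (auto simp: dist_real_def)
      then have "L * \<bar>fst p' - fst p\<bar> \<le> L * d" "H * qroot \<bar>snd p' - snd p\<bar> \<le> H * qroot d"
        using L0 H0 by (auto intro!: mult_left_mono qroot_mono)
      moreover have "\<bar>V (snd p') (fst p') - V (snd p) (fst p)\<bar> \<le> L * \<bar>fst p' - fst p\<bar> + H * qroot \<bar>snd p' - snd p\<bar>"
        by (rule modulus) (use p in auto)
      ultimately show "dist (V (snd p') (fst p')) (V (snd p) (fst p)) < e" using d by (simp add: dist_real_def)
    qed (use d in auto)
  qed
  have part1: "uniformly_continuous_on (UNIV \<times> {0<..}) (\<lambda>p. U (fst p) (snd p))"
    unfolding uniformly_continuous_on_def
  proof (intro allI impI)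
    fix e :: real assume "e > 0"
    with unif obtain d where d: "d > 0"
      "\<And>p p'. p \<in> UNIV \<times> {0..} \<Longrightarrow> p' \<in> UNIV \<times> {0..} \<Longrightarrow> dist p' p < d \<Longrightarrow> dist (V (snd p') (fst p')) (V (snd p) (fst p)) < e"
      unfolding uniformly_continuous_on_def by metis
    have VU: "V (snd p) (fst p) = U (fst p) (snd p)" "p \<in> UNIV \<times> {0..}" if "p \<in> UNIV \<times> {0<..}" for p
      using that by (auto simp: V_def)
    show "\<exists>d>0. \<forall>p\<in>UNIV \<times> {0<..}. \<forall>p'\<in>UNIV \<times> {0<..}. dist p' p < d \<longrightarrow> dist (U (fst p') (snd p')) (U (fst p) (snd p)) < e"
      using d(1) d(2)[OF VU(2) VU(2)] by (intro exI[of _ d] conjI ballI impI) (simp_all only: VU(1))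
  qed
  have part2: "((\<lambda>p. U (fst p) (snd p)) \<longlongrightarrow> phiAB A B x) (at (x, 0) within UNIV \<times> {0<..})" for x
  proof -
    have "((\<lambda>p. V (snd p) (fst p)) \<longlongrightarrow> V 0 x) (at (x, 0) within UNIV \<times> {0..})"
      using uniformly_continuous_imp_continuous[OF unif] by (auto simp: continuous_on)
    then have "((\<lambda>p. V (snd p) (fst p)) \<longlongrightarrow> V 0 x) (at (x, 0) within UNIV \<times> {0<..})"
      by (rule tendsto_within_subset) auto
    moreover have "\<forall>\<^sub>F p in at (x, 0) within UNIV \<times> {0<..}. V (snd p) (fst p) = U (fst p) (snd p)"
      unfolding eventually_at_filter by (rule always_eventually) (auto simp: V_def)
    ultimately show ?thesis by (simp add: V_def tendsto_cong)
  qed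

  have vs: "v (qroot \<sigma> * y) (\<sigma> * t) = v y t" if "t > 0" "\<sigma> > 0" for y t \<sigma>
    using selfsim that by (simp add: qroot_def)
  have U_scaling: "U (qroot \<sigma> * x) (\<sigma> * t) = qroot \<sigma> * U x t" if t: "t > 0" and \<sigma>: "\<sigma> > 0" for x t \<sigma>
  proof -
    note q = qroot_pos[OF \<sigma>]
    have "duh 1 0 (\<sigma> * t) (qroot \<sigma> * x) = qroot \<sigma> * duh 1 0 t x"
      by (rule duh_scaling[OF \<sigma> t Nl_scaling[OF v \<sigma>]]) (use vs \<sigma> in auto)
    moreover have "conv 0 (\<sigma> * t) (phiAB A B) (qroot \<sigma> * x) = qroot \<sigma> * conv 0 t (phiAB A B) x"
      using conv_scaling[OF \<sigma> t, of 0 "phiAB A B" x] q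
      by (simp add: phiAB_scaling conv_def mult.left_commute)
    ultimately show ?thesis using U[OF t] U[of "\<sigma> * t"] t \<sigma> by (simp add: distrib_left)
  qed
  have part5: "\<sigma> powr (-1/4) * U (\<sigma> powr (1/4) * x) (\<sigma> * t) = U x t" if "t > 0" "\<sigma> > 0" for x t \<sigma>
  proof -
    have "\<sigma> powr (-1/4) * qroot \<sigma> = 1"
      using that by (simp add: qroot_def powr_add[symmetric])
    then show ?thesis using U_scaling[OF that, of x] by (simp add: qroot_def mult.assoc[symmetric])
  qed

  \<comment> \<open>The right-hand side in expanded form; \<open>flux\<close> later identifies it
    with the geometric one.\<close>
  define R where "R x t = - dx (dx (dx v)) x t + dx (Nl v) x t" for x t
  have part4: "((\<lambda>s. U x s) has_real_derivative R x t) (at t)" if t: "t > 0" for x t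
  proof -
    have "\<exists>D. ((\<lambda>s. U x s) has_real_derivative D) (at t)"
    proof -
      have q: "(qroot has_real_derivative (1/4) * t powr (1/4 - 1)) (at t)"
        unfolding qroot_def[abs_def] by (rule has_real_derivative_powr[OF t])
      have "((\<lambda>s. x / qroot s) has_real_derivative - (x * ((1/4) * t powr (1/4 - 1))) / (qroot t * qroot t)) (at t)"
        using DERIV_divide[OF DERIV_const[of x] q] qroot_pos[OF t] by simp
      from DERIV_chain2[OF Ux[OF zero_less_one] this]
      have "((\<lambda>s. U (x / qroot s) 1) has_real_derivative
          v (x / qroot t) 1 * (- (x * ((1/4) * t powr (1/4 - 1))) / (qroot t * qroot t))) (at t)" .
      from DERIV_mult[OF q this] obtain D where
        D: "((\<lambda>s. qroot s * U (x / qroot s) 1) has_real_derivative D) (at t)" by blast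
      have "((\<lambda>s. U x s) has_real_derivative D) (at t)"
      \<comment> \<open>Self-similarity expresses \<open>U x s\<close> through the slice at time 1,
        whose x-derivative is \<open>v\<close>; time enters only through
        \<open>qroot\<close>.\<close>
      proof (rule has_field_derivative_transform_within_open[OF D, of "{0<..}"])
        fix s :: real assume "s \<in> {0<..}"
        then show "qroot s * U (x / qroot s) 1 = U x s"
          using U_scaling[of 1 s "x / qroot s"] qroot_pos[of s] by simp
      qed (use t in auto)
      then show ?thesis by blast
    qed
    then obtain D where D: "((\<lambda>s. U x s) has_real_derivative D) (at t)" by blast
    then have "((\<lambda>h. (U x (t + h) - U x t) / h) \<longlongrightarrow> D) (at_right 0)"
      unfolding DERIV_def by (rule filterlim_mono[OF _ order_refl at_le]) auto
    moreover have "((\<lambda>h. (U x (t + h) - U x t) / h) \<longlongrightarrow> R x t) (at_right 0)"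
    proof -
      \<comment> \<open>The x-derivatives of \<open>U\<close> at time \<open>t\<close>: for
        \<open>m > 0\<close> the m-th is the derivative of \<open>v\<close> of order
        \<open>m - 1\<close>.\<close>
      define d where "d m z = (if m = 0 then U z t else (dx ^^ (m - 1)) v z t)" for m :: nat and z
      have sm: "smooth_half ((dx ^^ m) v)" for m
        by (induction m) (auto intro: v smooth_half_dx(2))
      have der: "(d m has_real_derivative d (Suc m) z) (at z)" for m z
        using Ux[OF t, of z] smooth_half_dx(1)[OF sm t, of "m - 1" z]
        by (cases m) (auto simp: d_def[abs_def])
      have "continuous_on {x - 1..x + 1} (d 5)"
        by (intro continuous_at_imp_continuous_on ballI DERIV_isCont[OF der])
      from compact_imp_bounded[OF compact_continuous_image[OF this compact_Icc]]
      obtain M where M: "\<And>z. z \<in> {x - 1..x + 1} \<Longrightarrow> \<bar>d 5 z\<bar> \<le> M"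
        unfolding bounded_iff real_norm_def by blast
      have d0: "d 0 = V t" using t by (simp add: d_def V_def fun_eq_iff)
      have T: "\<bar>d 0 (x - y) - (\<Sum>m<5. d m x / fact m * (- y) ^ m)\<bar> \<le> (M + L + (\<Sum>m<5. \<bar>d m x\<bar>)) * \<bar>y\<bar> ^ 5" for y
      proof (rule taylor_remainder_global)
        show "\<bar>d 5 z\<bar> \<le> M" if "\<bar>z - x\<bar> \<le> 1" for z using that by (intro M) auto
        show "\<bar>d 0 (x - y) - d 0 x\<bar> \<le> L * \<bar>y\<bar>" for y
          unfolding d0 using V_Lip[of t "x - y" x] t by simp
      qed (use der in auto)
      have "lingrowth (d 0)" unfolding d0 by (rule lingrowth_Lipschitz[OF V_Lip]) (use t in simp)
      note gen = biheat_generator[OF this T]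
      \<comment> \<open>\<open>fact 4 = 24\<close> cancels the fourth moment, and the fourth
        derivative of \<open>U\<close> is the third of \<open>v\<close>.\<close>
      have d0x: "V t x / fact 0 = U x t" and d4: "- 24 * (d 4 x / fact 4) = - dx (dx (dx v)) x t"
        using t by (simp_all add: d_def V_def fact_numeral numeral_3_eq_3)
      from gen
      have "((\<lambda>h. (conv 0 h (V t) x - U x t) / h) \<longlongrightarrow> - dx (dx (dx v)) x t) (at_right 0)"
        unfolding d0 d0x d4 .
      moreover have "((\<lambda>h. duh 1 t (t + h) x / h) \<longlongrightarrow> dx (Nl v) x t) (at_right 0)"
        using N N1 smooth_half_dx(2)[OF N1] t
        by (intro duh_right_derivative[where ?N2.0="dx (dx (Nl v))"] smooth_half_dx(1) smooth_half_continuous_on)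
      ultimately have "((\<lambda>h. (conv 0 h (V t) x - U x t) / h + duh 1 t (t + h) x / h) \<longlongrightarrow> R x t) (at_right 0)"
        unfolding R_def by (rule tendsto_add)
      moreover have "\<forall>\<^sub>F h in at_right 0. (conv 0 h (V t) x - U x t) / h + duh 1 t (t + h) x / h = (U x (t + h) - U x t) / h"
        using eventually_at_right_less[of 0]
        by eventually_elim (use t in \<open>simp add: restart add_divide_distrib diff_divide_distrib\<close>)
      ultimately show ?thesis by (rule Lim_transform_eventually)
    qed
    ultimately have "D = R x t"
      by (intro tendsto_unique[OF trivial_limit_at_right_real])
    with D show ?thesis by simp
  qed
  have flux: "- deriv (\<lambda>y. (1 + (dx U y t)\<^sup>2) powr (-1/2)
       * deriv (\<lambda>z. dx (dx U) z t * (1 + (dx U z t)\<^sup>2) powr (-3/2)) y) x = R x t" if t: "t > 0" for x t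
  proof -
    note v1 = smooth_half_dx(2)[OF v]
    note v2 = smooth_half_dx(2)[OF v1]
    have "(\<lambda>y. (1 + (dx U y t)\<^sup>2) powr (-1/2) * deriv (\<lambda>z. dx (dx U) z t * (1 + (dx U z t)\<^sup>2) powr (-3/2)) y)
        = (\<lambda>y. dx (dx v) y t - Nl v y t)"
      unfolding dxU[OF t] dxdxU[OF t] Nl_def
      by (rule ext, rule geometric_flux[OF smooth_half_dx(1)[OF v t] smooth_half_dx(1)[OF v1 t]])
    moreover have "deriv (\<lambda>y. dx (dx v) y t - Nl v y t) x = dx (dx (dx v)) x t - dx (Nl v) x t"
      by (rule DERIV_imp_deriv[OF DERIV_diff[OF smooth_half_dx(1)[OF v2 t] smooth_half_dx(1)[OF N t]]])
    ultimately show ?thesis by (simp add: R_def)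
  qed
  show ?thesis
  proof (intro conjI allI impI)
    fix x t :: real assume t: "t > 0"
    show "((\<lambda>s. U x s) has_real_derivative
          - deriv (\<lambda>y. (1 + (dx U y t)\<^sup>2) powr (-1/2)
               * deriv (\<lambda>z. dx (dx U) z t * (1 + (dx U z t)\<^sup>2) powr (-3/2)) y) x) (at t)"
      unfolding flux[OF t] by (rule part4[OF t])
  qed (rule part1 part2 Ux part5; assumption)+
qed

end
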